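(* Suppose $m>0$ and $(m-n)/2<\alpha<(m-1)/2$. Then there is a constant $C$ such that, for all $\varphi$, $$\left\||x|^{\alpha-m/2}|D_x|^\alpha e^{it|D_x|^m}\varphi(x)\right\|_{L^2(\mathbb{R}_t\times\mathbb{R}^n_x)}\leq C\|\varphi\|_{L^2(\mathbb{R}^n_x)}.$$ Suppose $m>0$ and $(m-n+1)/2<\alpha<(m-1)/2$. Then there is a constant $C$ such that, for all $\varphi$, $$\left\||x|^{\alpha-m/2}|D'|^\alpha e^{it(|D_1|^m-|D'|^m)}\varphi(x)\right\|_{L^2(\mathbb{R}_t\times\mathbb{R}^n_x)}\leq C\|\varphi\|_{L^2(\mathbb{R}^n_x)},$$ where $D'=(D_2,\ldots,D_n)$.
   Context: Notation: $x=(x_1,\ldots,x_n)\in\mathbb{R}^n$, $D_x=(D_1,\ldots,D_n)$ with $D_j=\frac1i\frac{\partial}{\partial x_j}$. Functions of $D_x$ are Fourier multipliers on $\mathbb{R}^n$: $|D_x|^\alpha$, $e^{it|D_x|^m}$, $|D'|^\alpha$ and $e^{it(|D_1|^m-|D'|^m)}$ have symbols $|\xi|^\alpha$, $e^{it|\xi|^m}$, $|\xi'|^\alpha$ and $e^{it(|\xi_1|^m-|\xi'|^m)}$, where $\xi=(\xi_1,\xi')$ and $\xi'=(\xi_2,\ldots,\xi_n)$. *)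

theory Defs
  imports "HOL-Analysis.Analysis"
begin

definition in_L2 :: "'a measure \<Rightarrow> ('a \<Rightarrow> complex) \<Rightarrow> bool" where
  "in_L2 M f \<longleftrightarrow> f \<in> borel_measurable M \<and> integrable M (\<lambda>x. (cmod (f x))\<^sup>2)"

text \<open>Meaningful only for \<open>f\<close> with \<open>in_L2 M f\<close>: the Bochner integral of a non-integrable function
  is 0.\<close>

definition L2_norm :: "'a measure \<Rightarrow> ('a \<Rightarrow> complex) \<Rightarrow> real" where
  "L2_norm M f = sqrt (\<integral>x. (cmod (f x))\<^sup>2 \<partial>M)"

text \<open>Iterated partial derivatives along a list of directions, the head being applied last.\<close>

primrec partials ::
  "'a::euclidean_space list \<Rightarrow> ('a \<Rightarrow> complex) \<Rightarrow> 'a \<Rightarrow> complex" where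
  "partials [] f = f"
| "partials (b # bs) f = (\<lambda>x. frechet_derivative (partials bs f) (at x) b)"

definition schwartz :: "('a::euclidean_space \<Rightarrow> complex) \<Rightarrow> bool" where
  "schwartz f \<longleftrightarrow>
     (\<forall>bs \<in> lists Basis.
        (\<forall>x. partials bs f differentiable (at x)) \<and>
        (\<forall>N::nat. \<exists>B. \<forall>x. norm x ^ N * cmod (partials bs f x) \<le> B))"

text \<open>The sign in the exponent makes \<open>D\<^sub>j = (1 / \<i>) \<partial>\<^sub>j\<close> the multiplier with symbol \<open>\<xi>\<^sub>j\<close>.\<close>

definition fourier :: "('a::euclidean_space \<Rightarrow> complex) \<Rightarrow> 'a \<Rightarrow> complex" where
  "fourier f \<xi> = (\<integral>x. exp (- \<i> * of_real (x \<bullet> \<xi>)) * f x \<partial>lborel)"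

text \<open>Functions that act as tempered distributions by integration. Continuity of the functional
  on the Schwartz space is automatic, by the uniform boundedness principle.\<close>

definition tempered :: "('a::euclidean_space \<Rightarrow> complex) \<Rightarrow> bool" where
  "tempered f \<longleftrightarrow> f \<in> borel_measurable lborel \<and>
     (\<forall>\<psi>. schwartz \<psi> \<longrightarrow> integrable lborel (\<lambda>x. f x * \<psi> x))"

text \<open>\<open>g\<close> is the Fourier transform of \<open>f\<close> in the sense of tempered distributions. This determines
  \<open>g\<close> from \<open>f\<close>, and \<open>f\<close> from \<open>g\<close>, up to null sets.\<close>

definition has_fourier_transform ::
  "('a::euclidean_space \<Rightarrow> complex) \<Rightarrow> ('a \<Rightarrow> complex) \<Rightarrow> bool" where
  "has_fourier_transform f g \<longleftrightarrow> tempered f \<and> tempered g \<and>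
     (\<forall>\<psi>. schwartz \<psi> \<longrightarrow>
        (\<integral>x. f x * fourier \<psi> x \<partial>lborel) = (\<integral>\<xi>. g \<xi> * \<psi> \<xi> \<partial>lborel))"

text \<open>The tempered distribution \<open>\<sigma>(D) \<phi>\<close>, whose Fourier transform is \<open>\<sigma>\<close> times that of \<open>\<phi>\<close>, is
  given by the function \<open>u\<close>. A relation rather than a function, since for unbounded \<open>\<sigma>\<close> and
  square-integrable \<open>\<phi>\<close> the distribution \<open>\<sigma>(D) \<phi>\<close> need not be a function; \<open>u\<close> is unique up to null
  sets.\<close>

definition is_multiplier_image ::
  "('a::euclidean_space \<Rightarrow> complex) \<Rightarrow> ('a \<Rightarrow> complex) \<Rightarrow> ('a \<Rightarrow> complex) \<Rightarrow> bool" where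
  "is_multiplier_image \<sigma> \<phi> u \<longleftrightarrow>
     (\<exists>g. has_fourier_transform \<phi> g \<and> has_fourier_transform u (\<lambda>\<xi>. \<sigma> \<xi> * g \<xi>))"

text \<open>With \<open>k\<close> the index of the distinguished (``first'') coordinate, \<open>omit k \<xi>\<close> is \<open>\<xi>'\<close>, the
  vector of the remaining coordinates, embedded isometrically with zero \<open>k\<close>-th component.\<close>

definition omit :: "'n::finite \<Rightarrow> real ^ 'n \<Rightarrow> real ^ 'n" where
  "omit k \<xi> = (\<chi> j. if j = k then 0 else \<xi> $ j)"

end

theory Submission
  imports Defs "HOL-Probability.Characteristic_Functions"
begin

text \<open>Put \<open>s = m / 2 - \<alpha>\<close>. The weight is then \<open>|x|\<^sup>-\<^sup>s\<close>, and the hypotheses on \<open>\<alpha>\<close> say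
\<open>1 / 2 < s < N / 2\<close>, where \<open>N\<close> is the number of coordinates in which the amplitude \<open>|\<cdot>|\<^sup>\<alpha>\<close> is
radial: \<open>N = n\<close> for the first operator and \<open>N = n - 1\<close> for the second. Both phases have the form
\<open>q(\<xi>) = \<beta>(\<xi>'') \<plusminus> |\<xi>'|\<^sup>m\<close>, with \<open>\<xi>'\<close> a group of \<open>N\<close> coordinates and \<open>\<xi>''\<close> the others
(\<open>radial_phase\<close>), so one estimate (\<open>smoothing_estimate\<close>) covers both.

For integrable Fourier data \<open>f = |\<xi>'|\<^sup>\<alpha> g\<close> the solution is, up to a power of \<open>2\<pi>\<close>, the absolutely
convergent integral \<open>U(t, x) = \<integral> e\<^sup>i\<^sup>(\<^sup>t\<^sup>q\<^sup>(\<^sup>\<xi>\<^sup>)\<^sup>+\<^sup>x\<^sup>\<bullet>\<^sup>\<xi>\<^sup>) f(\<xi>) d\<xi>\<close>. The weight \<open>|x|\<^sup>-\<^sup>2\<^sup>s\<close> is at most a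
superposition of the Gaussians \<open>e\<^sup>-\<^sup>\<tau>\<^sup>|\<^sup>x\<^sup>|\<^sup>2\<^sup>/\<^sup>2\<close> with density \<open>\<tau>\<^sup>s\<^sup>-\<^sup>1 d\<tau>\<close>, and further Gaussian cutoffs in \<open>t\<close>
and \<open>x\<close> do no harm since Fatou's lemma removes them. Against a Gaussian, \<open>|U|\<^sup>2\<close> integrates to a double
integral of \<open>f(\<xi>) f(\<eta>)\<close> with a nonnegative kernel, the Fourier transform of the Gaussian at
\<open>(q(\<xi>) - q(\<eta>), \<xi> - \<eta>)\<close>. A Schur test (\<open>gaussian_schur\<close>) leaves a single inequality: the integral of
this kernel against \<open>|\<eta>'|\<^sup>2\<^sup>\<alpha> d\<eta> \<tau>\<^sup>s\<^sup>-\<^sup>1 d\<tau>\<close> is bounded uniformly in \<open>\<xi>\<close> and in the cutoffs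
(\<open>phase_kernel_bound\<close>).

That inequality replaces the restriction theorem for the sphere, and it is proved without surface
measure. The coordinates \<open>\<xi>''\<close> merely shift the phase, and their Gaussians have mass \<open>2\<pi>\<close>. In the
coordinates \<open>\<eta>'\<close> one works where a given \<open>\<eta>\<^sub>j\<close> is the largest: there \<open>\<lambda> = |\<eta>'|\<^sup>m\<close> can be used as a
coordinate instead of \<open>\<eta>\<^sub>j\<close>, at the price of a bounded factor, and the Gaussian in \<open>q(\<xi>) - q(\<eta>)\<close> becomes a
function of \<open>\<lambda>\<close> alone with integral \<open>2\<pi>\<close>. With \<open>r = |\<eta>'|\<close> each of the \<open>N - 1\<close> remaining coordinates contributes
at most \<open>min (2\<pi>) (2 r (2\<pi>/\<tau>)\<^sup>1\<^sup>/\<^sup>2)\<close>; the integral over \<open>\<tau>\<close> converges at \<open>0\<close> because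
\<open>s > 1 / 2\<close> and at infinity because \<open>s < N / 2\<close>, and all powers of \<open>r\<close> cancel
(\<open>radial_kernel_bound\<close>).

To reach all square integrable \<open>\<phi>\<close>, a Fourier transform of \<open>\<phi>\<close> is constructed from truncations
(\<open>L2_fourier_exists\<close>), the Fourier data are cut off, and the waves converge in the weighted space by
the estimate already proved. That the limit is the image of \<open>\<phi>\<close> under the multiplier is checked on
Schwartz functions: the limit passes through the pairing (\<open>weighted_pairing_tendsto\<close>) since
\<open>|x|\<^sup>s\<close> times a rapidly decreasing function is square integrable.\<close>

section \<open>Square integrability and limits in the mean\<close>

abbreviation L2_sq :: "'a measure \<Rightarrow> ('a \<Rightarrow> complex) \<Rightarrow> ennreal" where
  "L2_sq M f \<equiv> (\<integral>\<^sup>+x. ennreal ((cmod (f x))\<^sup>2) \<partial>M)"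

lemma in_L2_nn_integral:
  assumes "in_L2 lborel \<phi>"
  shows "\<phi> \<in> borel_measurable borel" "L2_sq lborel \<phi> = ennreal ((L2_norm lborel \<phi>)\<^sup>2)"
proof -
  show "\<phi> \<in> borel_measurable borel" using assms by (simp add: in_L2_def)
  have "L2_sq lborel \<phi> = ennreal (\<integral>x. (cmod (\<phi> x))\<^sup>2 \<partial>lborel)"
    using assms by (intro nn_integral_eq_integral) (auto simp: in_L2_def)
  then show "L2_sq lborel \<phi> = ennreal ((L2_norm lborel \<phi>)\<^sup>2)"
    by (simp add: L2_norm_def)
qed

lemma in_L2I:
  assumes m: "f \<in> borel_measurable lborel" and le: "L2_sq lborel f \<le> ennreal (c\<^sup>2)" and c: "0 \<le> c"
  shows "in_L2 lborel f" "L2_norm lborel f \<le> c"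
proof -
  note [measurable] = m
  have i: "integrable lborel (\<lambda>x. (cmod (f x))\<^sup>2)"
    by (rule integrableI_bounded) (use le_less_trans[OF le] in auto)
  then show "in_L2 lborel f" using m by (simp add: in_L2_def)
  have "ennreal (\<integral>x. (cmod (f x))\<^sup>2 \<partial>lborel) \<le> ennreal (c\<^sup>2)"
    using le by (subst (asm) nn_integral_eq_integral[OF i]) auto
  then have "(\<integral>x. (cmod (f x))\<^sup>2 \<partial>lborel) \<le> c\<^sup>2" by (simp add: ennreal_le_iff)
  then show "L2_norm lborel f \<le> c" unfolding L2_norm_def using c by (intro real_le_lsqrt) auto
qed

lemma cmod_sq_add_le: "(cmod (a + b))\<^sup>2 \<le> 2 * (cmod a)\<^sup>2 + 2 * (cmod b)\<^sup>2"
proof -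
  have "(cmod (a + b))\<^sup>2 \<le> (cmod a + cmod b)\<^sup>2" by (intro power_mono norm_triangle_ineq) auto
  also have "\<dots> \<le> 2 * (cmod a)\<^sup>2 + 2 * (cmod b)\<^sup>2"
    using sum_squares_bound[of "cmod a" "cmod b"] by (simp add: power2_sum)
  finally show ?thesis .
qed

lemma L2_sum_le:
  fixes f g :: "'a \<Rightarrow> complex"
  assumes [measurable]: "f \<in> borel_measurable M" "g \<in> borel_measurable M"
  shows "L2_sq M f \<le> 2 * L2_sq M (\<lambda>x. f x - g x) + 2 * L2_sq M g"
proof -
  have "L2_sq M f \<le> (\<integral>\<^sup>+x. 2 * ennreal ((cmod (f x - g x))\<^sup>2) + 2 * ennreal ((cmod (g x))\<^sup>2) \<partial>M)"
  proof (rule nn_integral_mono)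
    fix x
    have "ennreal ((cmod (f x))\<^sup>2) \<le> ennreal (2 * (cmod (f x - g x))\<^sup>2 + 2 * (cmod (g x))\<^sup>2)"
      using cmod_sq_add_le[of "f x - g x" "g x"] by (intro ennreal_leI) simp
    then show "ennreal ((cmod (f x))\<^sup>2) \<le> 2 * ennreal ((cmod (f x - g x))\<^sup>2) + 2 * ennreal ((cmod (g x))\<^sup>2)"
      by (simp add: ennreal_mult)
  qed
  also have "\<dots> = 2 * L2_sq M (\<lambda>x. f x - g x) + 2 * L2_sq M g"
    by (simp add: nn_integral_add nn_integral_cmult)
  finally show ?thesis .
qed

lemma L2_mult_integrable:
  fixes f g :: "'a \<Rightarrow> complex"
  assumes [measurable]: "f \<in> borel_measurable M" "g \<in> borel_measurable M"
    and f: "L2_sq M f < \<infinity>" and g: "L2_sq M g < \<infinity>"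
  shows "integrable M (\<lambda>x. f x * g x)"
proof (rule integrableI_bounded)
  have "(\<integral>\<^sup>+x. ennreal (norm (f x * g x)) \<partial>M) \<le> (\<integral>\<^sup>+x. ennreal ((cmod (f x))\<^sup>2) + ennreal ((cmod (g x))\<^sup>2) \<partial>M)"
  proof (rule nn_integral_mono)
    fix x
    have "norm (f x * g x) \<le> (cmod (f x))\<^sup>2 + (cmod (g x))\<^sup>2"
      using sum_squares_bound[of "cmod (f x)" "cmod (g x)"] mult_nonneg_nonneg[OF norm_ge_zero[of "f x"] norm_ge_zero[of "g x"]]
      unfolding norm_mult by linarith
    then show "ennreal (norm (f x * g x)) \<le> ennreal ((cmod (f x))\<^sup>2) + ennreal ((cmod (g x))\<^sup>2)"
      by (simp add: ennreal_plus[symmetric] ennreal_leI del: ennreal_plus)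
  qed
  also have "\<dots> < \<infinity>" using f g by (subst nn_integral_add) auto
  finally show "(\<integral>\<^sup>+x. ennreal (norm (f x * g x)) \<partial>M) < \<infinity>" .
qed measurable

lemma L2_bounded_set_integrable:
  fixes f :: "'a::euclidean_space \<Rightarrow> complex"
  assumes [measurable]: "f \<in> borel_measurable borel" "A \<in> sets borel" and L2: "L2_sq lborel f < \<infinity>" and A: "bounded A"
  shows "integrable lborel (\<lambda>x. f x * indicator A x)"
proof (rule L2_mult_integrable)
  have "L2_sq lborel (indicator A) = (\<integral>\<^sup>+x. indicator A x \<partial>lborel)"
    by (intro nn_integral_cong) (auto simp: indicator_def)
  also have "\<dots> < \<infinity>" using emeasure_bounded_finite[OF A] by simp
  finally show "L2_sq lborel (indicator A) < \<infinity>" .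
qed (use L2 in auto)

text \<open>Geometric decay turns convergence in the mean into pointwise convergence almost everywhere.\<close>

lemma geometric_subseq:
  fixes e :: "nat \<Rightarrow> ennreal"
  assumes e: "e \<longlonglongrightarrow> 0"
  obtains r :: "nat \<Rightarrow> nat" where "strict_mono r" "\<And>n. e (r n) \<le> ennreal ((1/4) ^ n)"
proof -
  have ev: "eventually (\<lambda>n. e n < ennreal ((1/4) ^ k)) sequentially" for k :: nat
    by (rule order_tendstoD(2)[OF e]) simp
  have ex: "\<exists>n. e n \<le> ennreal ((1/4) ^ k) \<and> j < n" for k j :: nat
    using eventually_happens[OF eventually_conj[OF ev[of k] eventually_gt_at_top[of j]]] less_imp_le by auto
  have "\<exists>r. \<forall>n. e (r n) \<le> ennreal ((1/4) ^ n) \<and> r n < r (Suc n)"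
  proof (rule dependent_nat_choice[where P="\<lambda>n r. e r \<le> ennreal ((1/4) ^ n)" and Q="\<lambda>n a b. a < b"])
    show "\<exists>x. e x \<le> ennreal ((1 / 4) ^ 0)" using ex[of 0 0] by blast
  qed (rule ex)
  then show ?thesis using that by (auto simp: strict_mono_Suc_iff)
qed

text \<open>Along a subsequence the mean squares of the increments are at most \<open>4\<^sup>-\<^sup>n\<close>, so that the sum of
\<open>2\<^sup>n\<close> times their squares is finite almost everywhere; the increments are then dominated by a geometric series and the
subsequence converges. Fatou's lemma hands the modulus \<open>e\<close> of the Cauchy sequence on to the limit, along the whole
sequence.\<close>

lemma L2_complete:
  fixes F :: "nat \<Rightarrow> 'a \<Rightarrow> complex"
  assumes [measurable]: "\<And>n. F n \<in> borel_measurable M"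
    and cauchy: "\<And>k l. k \<le> l \<Longrightarrow> L2_sq M (\<lambda>x. F l x - F k x) \<le> e k"
    and e: "e \<longlonglongrightarrow> 0"
  obtains G where "G \<in> borel_measurable M" "\<And>k. L2_sq M (\<lambda>x. G x - F k x) \<le> e k"
proof -
  obtain r where r: "\<And>n. e (r n) \<le> ennreal ((1/4) ^ n)" "strict_mono r"
    using geometric_subseq[OF e] by blast
  define d where "d n x = cmod (F (r (Suc n)) x - F (r n) x)" for n x
  have [measurable]: "d n \<in> borel_measurable M" for n unfolding d_def by measurable
  \<comment> \<open>The factors \<open>2 ^ n\<close> make square summability of the increments yield geometric decay.\<close>
  have "(\<integral>\<^sup>+x. (\<Sum>n. ennreal (2 ^ n * (d n x)\<^sup>2)) \<partial>M) = (\<Sum>n. \<integral>\<^sup>+x. ennreal (2 ^ n * (d n x)\<^sup>2) \<partial>M)"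
    by (rule nn_integral_suminf) simp
  also have "\<dots> \<le> (\<Sum>n. ennreal ((1/2) ^ n))"
  proof (rule suminf_le)
    fix n
    have "(\<integral>\<^sup>+x. ennreal (2 ^ n * (d n x)\<^sup>2) \<partial>M) = ennreal (2 ^ n) * (\<integral>\<^sup>+x. ennreal ((d n x)\<^sup>2) \<partial>M)"
      by (subst nn_integral_cmult[symmetric]) (auto simp: ennreal_mult)
    also have "\<dots> \<le> ennreal (2 ^ n) * ennreal ((1/4) ^ n)"
      unfolding d_def by (intro mult_left_mono order.trans[OF cauchy r(1)]) (use r(2) in \<open>auto simp: strict_mono_less_eq\<close>)
    also have "\<dots> = ennreal ((1/2) ^ n)"
      by (simp add: ennreal_mult[symmetric] power_mult_distrib[symmetric])
    finally show "(\<integral>\<^sup>+x. ennreal (2 ^ n * (d n x)\<^sup>2) \<partial>M) \<le> ennreal ((1/2) ^ n)" .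
  qed auto
  also have "\<dots> < \<infinity>"
    by (subst suminf_ennreal2) (auto simp: summable_geometric)
  finally have "AE x in M. (\<Sum>n. ennreal (2 ^ n * (d n x)\<^sup>2)) \<noteq> \<infinity>"
    by (intro nn_integral_PInf_AE) auto
  then have conv: "AE x in M. convergent (\<lambda>n. F (r n) x)"
  proof eventually_elim
    case (elim x)
    have "summable (\<lambda>n. 2 ^ n * (d n x)\<^sup>2)"
      using elim by (intro summable_suminf_not_top) auto
    then have "(\<lambda>n. 2 ^ n * (d n x)\<^sup>2) \<longlonglongrightarrow> 0"
      by (rule summable_LIMSEQ_zero)
    then have "Bseq (\<lambda>n. 2 ^ n * (d n x)\<^sup>2)"
      by (rule convergent_imp_Bseq[OF convergentI])
    then obtain C where C: "C > 0" "\<And>n. 2 ^ n * (d n x)\<^sup>2 \<le> C"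
      by (auto simp: Bseq_def)
    have dle: "d n x \<le> sqrt C * (1 / sqrt 2) ^ n" for n
    proof -
      have "(d n x)\<^sup>2 \<le> C * (1/2) ^ n"
        using C(2)[of n] by (simp add: field_simps)
      also have "\<dots> = (sqrt C * (1 / sqrt 2) ^ n)\<^sup>2"
      proof -
        have "((1 / sqrt 2) ^ n)\<^sup>2 = ((1 / sqrt 2)\<^sup>2) ^ n"
          by (simp only: power_mult[symmetric] mult.commute)
        then show ?thesis using C(1) by (simp add: power_mult_distrib power_divide)
      qed
      finally show ?thesis
        by (rule power2_le_imp_le) (use C(1) in auto)
    qed
    have sg: "summable (\<lambda>n. sqrt C * (1 / sqrt 2) ^ n)"
      by (intro summable_mult summable_geometric) auto
    have "summable (\<lambda>n. F (r (Suc n)) x - F (r n) x)"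
    proof (rule summable_comparison_test'[OF sg, of 0])
      show "norm (F (r (Suc n)) x - F (r n) x) \<le> sqrt C * (1 / sqrt 2) ^ n" for n
        using dle[of n] by (simp only: d_def)
    qed
    then have "convergent (\<lambda>n. \<Sum>i<n. F (r (Suc i)) x - F (r i) x)"
      by (simp add: summable_iff_convergent)
    then have "convergent (\<lambda>n. (F (r n) x - F (r 0) x) + F (r 0) x)"
      by (intro convergent_add convergent_const) (simp add: sum_lessThan_telescope[of "\<lambda>n. F (r n) x"])
    then show ?case by simp
  qed
  \<comment> \<open>Where the subsequence diverges \<open>lim\<close> has some value, on a null set only.\<close>
  define G where "G x = lim (\<lambda>n. F (r n) x)" for x
  have [measurable]: "G \<in> borel_measurable M"
    unfolding G_def by measurable
  have "L2_sq M (\<lambda>x. G x - F k x) \<le> e k" for k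
  proof -
    have "AE x in M. ennreal ((cmod (G x - F k x))\<^sup>2) = liminf (\<lambda>n. ennreal ((cmod (F (r n) x - F k x))\<^sup>2))"
      using conv
    proof eventually_elim
      case (elim x)
      then have "(\<lambda>n. F (r n) x) \<longlonglongrightarrow> G x"
        by (simp add: G_def convergent_LIMSEQ_iff)
      then have "(\<lambda>n. ennreal ((cmod (F (r n) x - F k x))\<^sup>2)) \<longlonglongrightarrow> ennreal ((cmod (G x - F k x))\<^sup>2)"
        by (intro tendsto_intros tendsto_ennrealI)
      then show ?case
        by (intro lim_imp_Liminf[symmetric]) auto
    qed
    then have "L2_sq M (\<lambda>x. G x - F k x) = (\<integral>\<^sup>+x. liminf (\<lambda>n. ennreal ((cmod (F (r n) x - F k x))\<^sup>2)) \<partial>M)"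
      by (rule nn_integral_cong_AE)
    also have "\<dots> \<le> liminf (\<lambda>n. \<integral>\<^sup>+x. ennreal ((cmod (F (r n) x - F k x))\<^sup>2) \<partial>M)"
      by (rule nn_integral_liminf) simp
    also have "\<dots> \<le> e k"
    proof (rule Liminf_le)
      show "\<forall>\<^sub>F n in sequentially. L2_sq M (\<lambda>x. F (r n) x - F k x) \<le> e k"
        using eventually_ge_at_top[of k]
        by eventually_elim (rule cauchy, use seq_suble[OF r(2)] order.trans in blast)
    qed simp
    finally show ?thesis .
  qed
  then show ?thesis using that[of G] by simp
qed

text \<open>Along a subsequence the integrals are summable, hence so are the functions themselves almost
everywhere. Applied to slices of a space-time integral.\<close>

lemma nn_integral_tendsto_0_AE_subseq:
  fixes D :: "nat \<Rightarrow> 'a \<Rightarrow> ennreal"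
  assumes [measurable]: "\<And>n. D n \<in> borel_measurable M" and le: "\<And>n. (\<integral>\<^sup>+x. D n x \<partial>M) \<le> e n" and e: "e \<longlonglongrightarrow> 0"
  obtains r :: "nat \<Rightarrow> nat" where "strict_mono r" "AE x in M. (\<forall>n. D (r n) x < \<infinity>) \<and> (\<lambda>n. D (r n) x) \<longlonglongrightarrow> 0"
proof -
  obtain r where r: "\<And>n. e (r n) \<le> ennreal ((1/4) ^ n)" "strict_mono r"
    using geometric_subseq[OF e] by blast
  have "(\<integral>\<^sup>+x. (\<Sum>n. D (r n) x) \<partial>M) = (\<Sum>n. \<integral>\<^sup>+x. D (r n) x \<partial>M)"
    by (rule nn_integral_suminf) simp
  also have "\<dots> \<le> (\<Sum>n. ennreal ((1/4) ^ n))"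
    by (rule suminf_le) (auto intro: order.trans[OF le r(1)])
  also have "\<dots> < \<infinity>"
    by (subst suminf_ennreal2) (auto simp: summable_geometric)
  finally have "AE x in M. (\<Sum>n. D (r n) x) \<noteq> \<infinity>"
    by (intro nn_integral_PInf_AE) auto
  then have "AE x in M. (\<forall>n. D (r n) x < \<infinity>) \<and> (\<lambda>n. D (r n) x) \<longlonglongrightarrow> 0"
  proof eventually_elim
    case (elim x)
    have fin: "D (r n) x < \<infinity>" for n
    proof -
      have "D (r n) x \<le> (\<Sum>n. D (r n) x)" using sum_le_suminf[of "\<lambda>n. D (r n) x" "{n}"] by simp
      also have "\<dots> < \<infinity>" using elim by (simp add: less_top)
      finally show ?thesis .
    qed
    define d where "d n = enn2real (D (r n) x)" for n
    have d: "D (r n) x = ennreal (d n)" for n using fin[of n] by (simp add: d_def)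
    have "summable d" using elim unfolding d by (intro summable_suminf_not_top) (auto simp: d_def)
    then have "d \<longlonglongrightarrow> 0" by (rule summable_LIMSEQ_zero)
    then have "(\<lambda>n. D (r n) x) \<longlonglongrightarrow> 0"
      unfolding d by (subst ennreal_tendsto_0_iff) (auto simp: d_def)
    with fin show ?case by simp
  qed
  with r(2) show ?thesis by (rule that)
qed

lemma tail_tendsto_0:
  fixes f :: "'a \<Rightarrow> ennreal"
  assumes [measurable]: "f \<in> borel_measurable M" "\<And>n. A n \<in> sets M"
    and f: "(\<integral>\<^sup>+x. f x \<partial>M) < \<infinity>" and A: "incseq A" "(\<Union>n. A n) = UNIV"
  shows "(\<lambda>n::nat. \<integral>\<^sup>+x. f x * indicator (- A n) x \<partial>M) \<longlonglongrightarrow> 0"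
proof -
  have "A n \<subseteq> space M" for n by (rule sets.sets_into_space[OF assms(2)])
  then have sp: "space M = UNIV" using A(2) by blast
  have [measurable]: "- A n \<in> sets M" for n
    using sets.compl_sets[OF assms(2)[of n]] by (simp add: sp Compl_eq_Diff_UNIV)
  have "(\<lambda>n::nat. \<integral>\<^sup>+x. f x * indicator (- A n) x \<partial>M) \<longlonglongrightarrow> (\<integral>\<^sup>+x. 0 \<partial>M)"
  proof (rule nn_integral_dominated_convergence[where w=f])
    show "AE x in M. (\<lambda>n. f x * indicator (- A n) x) \<longlonglongrightarrow> 0"
    proof (rule AE_I2)
      fix x
      obtain k where "x \<in> A k" using A(2) by blast
      then have "\<forall>n\<ge>k. f x * indicator (- A n) x = 0" using A(1) by (auto simp: incseq_def indicator_def)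
      then show "(\<lambda>n. f x * indicator (- A n) x) \<longlonglongrightarrow> 0"
        by (intro tendsto_eventually) (auto simp: eventually_sequentially)
    qed
  qed (use f in \<open>auto simp: indicator_def\<close>)
  then show ?thesis by simp
qed

text \<open>Cauchy--Schwarz with \<open>W\<close> put on the difference and \<open>1 / W\<close> on the test function. The limit need not
be square integrable itself, which is why integrability of \<open>f g\<close> is a conclusion.\<close>

lemma weighted_pairing_tendsto:
  fixes F :: "nat \<Rightarrow> 'a \<Rightarrow> complex" and f g :: "'a \<Rightarrow> complex" and W :: "'a \<Rightarrow> real"
  assumes [measurable]: "\<And>n. F n \<in> borel_measurable M" "f \<in> borel_measurable M" "g \<in> borel_measurable M" "W \<in> borel_measurable M"
    and W: "AE x in M. 0 < W x"
    and g: "(\<integral>\<^sup>+x. ennreal ((cmod (g x) / W x)\<^sup>2) \<partial>M) < \<infinity>"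
    and D: "\<And>n. (\<integral>\<^sup>+x. ennreal ((W x * cmod (F n x - f x))\<^sup>2) \<partial>M) \<le> D n" "\<And>n. D n < \<infinity>" "D \<longlonglongrightarrow> 0"
    and int: "\<And>n. integrable M (\<lambda>x. F n x * g x)"
  shows "integrable M (\<lambda>x. f x * g x)" "(\<lambda>n. \<integral>x. F n x * g x \<partial>M) \<longlonglongrightarrow> (\<integral>x. f x * g x \<partial>M)"
proof -
  define d where "d n x = (F n x - f x) * g x" for n x
  have [measurable]: "d n \<in> borel_measurable M" for n unfolding d_def by measurable
  define Q where "Q = (\<integral>\<^sup>+x. ennreal ((cmod (g x) / W x)\<^sup>2) \<partial>M)"
  have Q: "Q < \<infinity>" using g by (simp add: Q_def)
  have le: "(\<integral>\<^sup>+x. ennreal (cmod (d n x)) \<partial>M)\<^sup>2 \<le> D n * Q" for n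
  proof -
    have "(\<integral>\<^sup>+x. ennreal (cmod (d n x)) \<partial>M) = (\<integral>\<^sup>+x. ennreal \<bar>W x * cmod (F n x - f x)\<bar> * ennreal \<bar>cmod (g x) / W x\<bar> \<partial>M)"
      using W by (intro nn_integral_cong_AE, eventually_elim) (simp add: d_def norm_mult ennreal_mult[symmetric])
    also have "\<dots>\<^sup>2 \<le> (\<integral>\<^sup>+x. (ennreal \<bar>W x * cmod (F n x - f x)\<bar>)\<^sup>2 \<partial>M) * (\<integral>\<^sup>+x. (ennreal \<bar>cmod (g x) / W x\<bar>)\<^sup>2 \<partial>M)"
      by (rule Cauchy_Schwarz_nn_integral) measurable
    also have "\<dots> = (\<integral>\<^sup>+x. ennreal ((W x * cmod (F n x - f x))\<^sup>2) \<partial>M) * Q"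
    proof -
      have "(ennreal \<bar>z\<bar>)\<^sup>2 = ennreal (z\<^sup>2)" for z :: real by (simp add: ennreal_power)
      then show ?thesis by (simp only: Q_def)
    qed
    also have "\<dots> \<le> D n * Q" by (intro mult_right_mono D) auto
    finally show ?thesis .
  qed
  have di: "integrable M (d n)" for n
  proof (rule integrableI_bounded)
    have "D n * Q < \<infinity>" using D(2)[of n] Q by (simp add: ennreal_mult_less_top)
    then have "(\<integral>\<^sup>+x. ennreal (cmod (d n x)) \<partial>M)\<^sup>2 < \<infinity>" using le[of n] by (rule le_less_trans[rotated])
    then show "(\<integral>\<^sup>+x. ennreal (norm (d n x)) \<partial>M) < \<infinity>" by (auto simp: power2_eq_square ennreal_mult_less_top)
  qed measurable
  have "integrable M (\<lambda>x. F 0 x * g x - d 0 x)" by (intro Bochner_Integration.integrable_diff int di)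
  then show fg: "integrable M (\<lambda>x. f x * g x)" by (simp add: d_def algebra_simps)
  have eq: "(\<integral>x. F n x * g x \<partial>M) - (\<integral>x. f x * g x \<partial>M) = (\<integral>x. d n x \<partial>M)" for n
    unfolding d_def left_diff_distrib by (rule Bochner_Integration.integral_diff[OF int fg, symmetric])
  have "(\<lambda>n. ennreal ((cmod (\<integral>x. d n x \<partial>M))\<^sup>2)) \<longlonglongrightarrow> 0"
  proof (rule tendsto_sandwich[of "\<lambda>_. 0" _ _ "\<lambda>n. D n * Q"])
    show "(\<lambda>n. D n * Q) \<longlonglongrightarrow> 0"
      using ennreal_tendsto_cmult[OF _ D(3), of Q] Q by (simp add: mult.commute)
    have "ennreal ((cmod (\<integral>x. d n x \<partial>M))\<^sup>2) \<le> D n * Q" for n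
    proof -
      have "ennreal ((cmod (\<integral>x. d n x \<partial>M))\<^sup>2) = (ennreal (cmod (\<integral>x. d n x \<partial>M)))\<^sup>2" by (simp add: ennreal_power)
      also have "\<dots> \<le> (\<integral>\<^sup>+x. ennreal (cmod (d n x)) \<partial>M)\<^sup>2"
        by (intro power_mono integral_norm_bound_ennreal di) auto
      finally show ?thesis using le[of n] by (rule order.trans)
    qed
    then show "\<forall>\<^sub>F n in sequentially. ennreal ((cmod (\<integral>x. d n x \<partial>M))\<^sup>2) \<le> D n * Q" by simp
  qed auto
  then have "(\<lambda>n. (cmod (\<integral>x. d n x \<partial>M))\<^sup>2) \<longlonglongrightarrow> 0"
    by (subst (asm) ennreal_tendsto_0_iff) auto
  then have "(\<lambda>n. cmod (\<integral>x. d n x \<partial>M)) \<longlonglongrightarrow> 0"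
    using tendsto_real_sqrt[of "\<lambda>n. (cmod (\<integral>x. d n x \<partial>M))\<^sup>2" 0] by simp
  then have "(\<lambda>n. (\<integral>x. F n x * g x \<partial>M) - (\<integral>x. f x * g x \<partial>M)) \<longlonglongrightarrow> 0"
    unfolding eq by (simp only: tendsto_norm_zero_iff)
  then show "(\<lambda>n. \<integral>x. F n x * g x \<partial>M) \<longlonglongrightarrow> (\<integral>x. f x * g x \<partial>M)"
    by (rule LIM_zero_cancel)
qed

section \<open>Gaussians and their Fourier transforms\<close>

text \<open>Euclidean space over an arbitrary finite set of coordinates. Splitting off one coordinate, or a group
of them, changes the dimension, which a type of vectors does not allow.\<close>

abbreviation lborel_on :: "'i set \<Rightarrow> ('i \<Rightarrow> real) measure" where
  "lborel_on I \<equiv> PiM I (\<lambda>_. lborel)"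

interpretation lborel_PiM: product_sigma_finite "\<lambda>_. lborel :: real measure" ..

lemma gaussian_1d:
  fixes c v :: real
  assumes c: "0 < c"
  shows "has_bochner_integral lborel (\<lambda>x. exp (\<i> * of_real (x * v)) * of_real (exp (- (c * x\<^sup>2 / 2))))
           (complex_of_real (sqrt (2 * pi / c) * exp (- (v\<^sup>2 / (2 * c)))))"
proof -
  define s where "s = sqrt c"
  have s: "s > 0" "s\<^sup>2 = c" using c by (auto simp: s_def)
  have int: "integrable lborel (\<lambda>x. std_normal_density x *\<^sub>R iexp (v / s * x))"
    by (rule Bochner_Integration.integrable_bound[OF integrable_normal_density[where \<mu>=0 and \<sigma>=1]])
       (auto simp: normal_density_nonneg)
  have "char std_normal_distribution (v / s) = (\<integral>x. std_normal_density x *\<^sub>R iexp (v / s * x) \<partial>lborel)"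
    unfolding char_def by (subst integral_density) (auto simp: normal_density_nonneg)
  then have hb: "has_bochner_integral lborel (\<lambda>x. std_normal_density x *\<^sub>R iexp (v / s * x))
          (of_real (exp (- ((v / s)\<^sup>2) / 2)))"
    using int by (simp add: has_bochner_integral_iff char_std_normal_distribution)
  have "has_bochner_integral lborel (\<lambda>x. std_normal_density (0 + s * x) *\<^sub>R iexp (v / s * (0 + s * x)))
          (of_real (exp (- ((v / s)\<^sup>2) / 2)) /\<^sub>R \<bar>s\<bar>)"
    by (subst lborel_has_bochner_integral_real_affine_iff[symmetric]) (use s hb in auto)
  then have "has_bochner_integral lborel
      (\<lambda>x. of_real (sqrt (2 * pi)) * (std_normal_density (0 + s * x) *\<^sub>R iexp (v / s * (0 + s * x))))
          (of_real (sqrt (2 * pi)) * (of_real (exp (- ((v / s)\<^sup>2) / 2)) /\<^sub>R \<bar>s\<bar>))"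
    by (intro has_bochner_integral_mult_right) auto
  moreover have "of_real (sqrt (2 * pi)) * (std_normal_density (0 + s * x) *\<^sub>R iexp (v / s * (0 + s * x)))
     = exp (\<i> * of_real (x * v)) * of_real (exp (- (c * x\<^sup>2 / 2)))" for x
    using s by (simp add: std_normal_density_def scaleR_conv_of_real power_mult_distrib mult_ac)
  moreover have "of_real (sqrt (2 * pi)) * (of_real (exp (- ((v / s)\<^sup>2) / 2)) /\<^sub>R \<bar>s\<bar>)
     = complex_of_real (sqrt (2 * pi / c) * exp (- (v\<^sup>2 / (2 * c))))"
    using s by (simp add: scaleR_conv_of_real power_divide real_sqrt_divide s_def divide_simps)
  ultimately show ?thesis by simp
qed

lemma nn_gaussian_1d:
  assumes "0 < c"
  shows "(\<integral>\<^sup>+x. ennreal (exp (- (c * x\<^sup>2 / 2))) \<partial>lborel) = ennreal (sqrt (2 * pi / c))"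
proof -
  have "has_bochner_integral lborel (\<lambda>x. complex_of_real (exp (- (c * x\<^sup>2 / 2)))) (complex_of_real (sqrt (2 * pi / c)))"
    using gaussian_1d[OF assms, of 0] by simp
  then have "has_bochner_integral lborel (\<lambda>x. Re (complex_of_real (exp (- (c * x\<^sup>2 / 2))))) (Re (complex_of_real (sqrt (2 * pi / c))))"
    by (rule has_bochner_integral_Re)
  then show ?thesis
    by (subst nn_integral_eq_integral) (auto simp: has_bochner_integral_iff)
qed

lemma nn_gaussian_1d_shift:
  assumes "0 < c"
  shows "(\<integral>\<^sup>+y. ennreal (exp (- ((x - y)\<^sup>2 / (2 * c)))) \<partial>lborel) = ennreal (sqrt (2 * pi * c))"
proof -
  have "(\<integral>\<^sup>+y. ennreal (exp (- ((x - y)\<^sup>2 / (2 * c)))) \<partial>lborel)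
      = (\<integral>\<^sup>+y. ennreal (exp (- ((1/c) * y\<^sup>2 / 2))) \<partial>lborel)"
    by (subst nn_integral_real_affine[where c="-1" and t=x]) (auto simp: field_simps)
  also have "\<dots> = ennreal (sqrt (2 * pi * c))"
    by (subst nn_gaussian_1d) (use assms in auto)
  finally show ?thesis .
qed

text \<open>The Fourier transform of \<open>y \<mapsto> exp (- c y\<^sup>2 / 2)\<close> on the line. Its integral is \<open>2 * pi\<close>
whatever the value of \<open>c\<close>.\<close>

definition gauss_hat1 :: "real \<Rightarrow> real \<Rightarrow> real" where
  "gauss_hat1 c z = sqrt (2 * pi / c) * exp (- (z\<^sup>2 / (2 * c)))"

lemma gauss_hat1_measurable [measurable (raw)]:
  assumes [measurable]: "f \<in> borel_measurable M" "g \<in> borel_measurable M"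
  shows "(\<lambda>x. gauss_hat1 (f x) (g x)) \<in> borel_measurable M"
  unfolding gauss_hat1_def by measurable

lemma gauss_hat1_nonneg: "0 \<le> c \<Longrightarrow> 0 \<le> gauss_hat1 c z"
  by (simp add: gauss_hat1_def)

lemma gauss_hat1_le: "0 < c \<Longrightarrow> gauss_hat1 c z \<le> sqrt (2 * pi / c)"
  by (simp add: gauss_hat1_def mult_left_le)

lemma nn_integral_gauss_hat1:
  assumes c: "0 < c"
  shows "(\<integral>\<^sup>+y. ennreal (gauss_hat1 c (x - y)) \<partial>lborel) = ennreal (2 * pi)"
proof -
  have "sqrt (2 * pi / c) * sqrt (2 * pi * c) = sqrt ((2 * pi)\<^sup>2)"
    using c by (simp only: real_sqrt_mult[symmetric]) (simp add: power2_eq_square)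
  also have "\<dots> = 2 * pi" by (rule real_sqrt_unique) auto
  finally have e: "sqrt (2 * pi / c) * sqrt (2 * pi * c) = 2 * pi" .
  have "(\<integral>\<^sup>+y. ennreal (gauss_hat1 c (x - y)) \<partial>lborel)
     = (\<integral>\<^sup>+y. ennreal (sqrt (2 * pi / c)) * ennreal (exp (- ((x - y)\<^sup>2 / (2 * c)))) \<partial>lborel)"
    by (intro nn_integral_cong) (auto simp: gauss_hat1_def ennreal_mult' less_imp_le[OF c])
  also have "\<dots> = ennreal (sqrt (2 * pi / c)) * ennreal (sqrt (2 * pi * c))"
    by (subst nn_integral_cmult) (auto simp: nn_gaussian_1d_shift[OF c])
  finally show ?thesis
    using c e by (simp add: ennreal_mult[symmetric])
qed

lemma nn_integral_gauss_hat1_interval: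
  assumes c: "0 < c" and r: "0 \<le> r"
  shows "(\<integral>\<^sup>+y. ennreal (gauss_hat1 c (x - y)) * indicator {-r..r} y \<partial>lborel) \<le> ennreal (min (2 * pi) (2 * r * sqrt (2 * pi / c)))"
proof -
  have "(\<integral>\<^sup>+y. ennreal (gauss_hat1 c (x - y)) * indicator {-r..r} y \<partial>lborel) \<le> (\<integral>\<^sup>+y. ennreal (gauss_hat1 c (x - y)) \<partial>lborel)"
    by (intro nn_integral_mono) (auto simp: indicator_def)
  also have "\<dots> = ennreal (2 * pi)" by (rule nn_integral_gauss_hat1[OF c])
  finally have 1: "(\<integral>\<^sup>+y. ennreal (gauss_hat1 c (x - y)) * indicator {-r..r} y \<partial>lborel) \<le> ennreal (2 * pi)" .
  have "(\<integral>\<^sup>+y. ennreal (gauss_hat1 c (x - y)) * indicator {-r..r} y \<partial>lborel) \<le> (\<integral>\<^sup>+y. ennreal (sqrt (2 * pi / c)) * indicator {-r..r} y \<partial>lborel)"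
    by (intro nn_integral_mono mult_right_mono ennreal_leI gauss_hat1_le[OF c]) auto
  also have "\<dots> = ennreal (sqrt (2 * pi / c)) * ennreal (2 * r)"
    using r by (simp add: nn_integral_cmult_indicator)
  also have "\<dots> = ennreal (2 * r * sqrt (2 * pi / c))"
    using c r by (simp add: ennreal_mult[symmetric] mult.commute)
  finally show ?thesis using 1 by (simp add: min_def)
qed

text \<open>A Gaussian with a separate parameter for each coordinate: the time cutoff, the weight and the spatial
cutoff scale differently, yet form a single Gaussian on space-time.\<close>

definition gauss :: "('a::euclidean_space \<Rightarrow> real) \<Rightarrow> 'a \<Rightarrow> real" where
  "gauss c y = (\<Prod>b\<in>Basis. exp (- (c b * (y \<bullet> b)\<^sup>2 / 2)))"

definition gauss_hat :: "('a::euclidean_space \<Rightarrow> real) \<Rightarrow> 'a \<Rightarrow> real" where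
  "gauss_hat c v = (\<Prod>b\<in>Basis. gauss_hat1 (c b) (v \<bullet> b))"

lemma gauss_measurable [measurable]: "gauss c \<in> borel_measurable borel"
  unfolding gauss_def by measurable

lemma gauss_hat_measurable [measurable]: "gauss_hat c \<in> borel_measurable borel"
  unfolding gauss_hat_def by measurable

lemma gauss_nonneg: "0 \<le> gauss c y"
  by (simp add: gauss_def prod_nonneg)

lemma gauss_le_1: "(\<And>b. b \<in> Basis \<Longrightarrow> 0 \<le> c b) \<Longrightarrow> gauss c y \<le> 1"
  by (auto simp: gauss_def intro!: prod_le_1)

lemma gauss_hat_nonneg: "(\<And>b. b \<in> Basis \<Longrightarrow> 0 < c b) \<Longrightarrow> 0 \<le> gauss_hat c v"
  unfolding gauss_hat_def by (intro prod_nonneg) (auto intro: gauss_hat1_nonneg less_imp_le)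

lemma gauss_hat_minus: "gauss_hat c (- v) = gauss_hat c v"
  by (simp add: gauss_hat_def gauss_hat1_def)

lemma has_bochner_integral_lborel_prod:
  fixes f :: "'a::euclidean_space \<Rightarrow> real \<Rightarrow> complex"
  assumes "\<And>b. b \<in> Basis \<Longrightarrow> has_bochner_integral lborel (f b) (I b)"
  shows "has_bochner_integral lborel (\<lambda>x::'a. \<Prod>b\<in>Basis. f b (x \<bullet> b)) (\<Prod>b\<in>Basis. I b)"
proof -
  have i: "\<And>b. b \<in> Basis \<Longrightarrow> integrable lborel (f b)"
    using assms by (auto simp: has_bochner_integral_iff)
  have [measurable]: "f b \<in> borel_measurable borel" if "b \<in> Basis" for b
    using borel_measurable_integrable[OF i[OF that]] by simp
  have [simp]: "(\<Sum>i\<in>Basis. x i *\<^sub>R i) \<bullet> b = x b" if "b \<in> Basis" for x b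
    using that by simp
  have a: "integrable (\<Pi>\<^sub>M b\<in>Basis. lborel) (\<lambda>x. \<Prod>b\<in>Basis. f b (x b))"
    by (intro lborel_PiM.product_integrable_prod i) auto
  have b: "integral\<^sup>L (\<Pi>\<^sub>M b\<in>Basis. lborel) (\<lambda>x. \<Prod>b\<in>Basis. f b (x b)) = (\<Prod>b\<in>Basis. I b)"
    using assms by (simp add: lborel_PiM.product_integral_prod i has_bochner_integral_iff cong: prod.cong)
  show ?thesis
    using a b
    by (subst lborel_eq, subst has_bochner_integral_distr)
       (measurable, simp_all add: has_bochner_integral_iff cong: prod.cong)
qed

lemma gauss_fourier:
  assumes c: "\<And>b. b \<in> Basis \<Longrightarrow> 0 < c b"
  shows "has_bochner_integral lborel (\<lambda>y::'a::euclidean_space. exp (\<i> * of_real (y \<bullet> v)) * of_real (gauss c y))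
     (complex_of_real (gauss_hat c v))"
proof -
  have "has_bochner_integral lborel (\<lambda>x::'a. \<Prod>b\<in>Basis. (exp (\<i> * of_real ((x \<bullet> b) * (v \<bullet> b))) * of_real (exp (- (c b * (x \<bullet> b)\<^sup>2 / 2)))))
     (\<Prod>b\<in>Basis. complex_of_real (sqrt (2 * pi / c b) * exp (- ((v \<bullet> b)\<^sup>2 / (2 * c b)))))"
    by (rule has_bochner_integral_lborel_prod) (rule gaussian_1d[OF c])
  moreover have "(\<Prod>b\<in>Basis. (exp (\<i> * of_real ((x \<bullet> b) * (v \<bullet> b))) * of_real (exp (- (c b * (x \<bullet> b)\<^sup>2 / 2))))) =
     exp (\<i> * of_real (x \<bullet> v)) * of_real (gauss c x)" for x
  proof -
    have "(\<Prod>b\<in>Basis. exp (\<i> * of_real ((x \<bullet> b) * (v \<bullet> b)))) = exp (\<i> * complex_of_real (x \<bullet> v))"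
      by (subst exp_sum[symmetric]) (simp_all add: euclidean_inner[of x v] sum_distrib_left)
    then show ?thesis by (simp add: prod.distrib gauss_def)
  qed
  ultimately show ?thesis by (simp add: gauss_hat_def gauss_hat1_def)
qed

lemma gauss_integrable:
  assumes c: "\<And>b. b \<in> Basis \<Longrightarrow> 0 < c b"
  shows "integrable lborel (gauss c)"
proof -
  have "integrable lborel (\<lambda>y. exp (\<i> * of_real (y \<bullet> 0)) * complex_of_real (gauss c y))"
    using gauss_fourier[of c 0] c by (simp add: has_bochner_integral_iff)
  then have "integrable lborel (\<lambda>y. Re (exp (\<i> * of_real (y \<bullet> 0)) * complex_of_real (gauss c y)))"
    by (rule integrable_Re)
  then show ?thesis by simp
qed

lemma nn_integral_gauss_hat:
  fixes \<xi> :: "'a::euclidean_space"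
  assumes c: "\<And>b. b \<in> Basis \<Longrightarrow> 0 < c b"
  shows "(\<integral>\<^sup>+\<eta>. ennreal (gauss_hat c (\<xi> - \<eta>)) \<partial>lborel) = ennreal ((2 * pi) ^ DIM('a))"
proof -
  have "(\<integral>\<^sup>+\<eta>. ennreal (gauss_hat c (\<xi> - \<eta>)) \<partial>lborel) =
      (\<integral>\<^sup>+\<eta>. (\<Prod>b\<in>Basis. ennreal (gauss_hat1 (c b) (\<xi> \<bullet> b - \<eta> \<bullet> b))) \<partial>lborel)"
    unfolding gauss_hat_def
    by (subst prod_ennreal) (auto intro: gauss_hat1_nonneg less_imp_le c simp: inner_diff_left)
  also have "\<dots> = (\<Prod>b\<in>Basis. (\<integral>\<^sup>+y. ennreal (gauss_hat1 (c b) (\<xi> \<bullet> b - y)) \<partial>lborel))"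
    by (subst nn_integral_lborel_prod) auto
  also have "\<dots> = (\<Prod>b\<in>(Basis::'a set). ennreal (2 * pi))"
    by (intro prod.cong refl nn_integral_gauss_hat1 c)
  also have "\<dots> = ennreal ((2 * pi) ^ DIM('a))"
    by (simp add: ennreal_power)
  finally show ?thesis .
qed

lemma gauss_hat_scale:
  fixes z :: "'a::euclidean_space"
  assumes h: "0 < h"
  shows "h ^ DIM('a) * gauss_hat (\<lambda>_. h\<^sup>2) (h *\<^sub>R z) = gauss_hat (\<lambda>_. 1) z"
proof -
  have "h ^ DIM('a) * gauss_hat (\<lambda>_. h\<^sup>2) (h *\<^sub>R z) = (\<Prod>b\<in>Basis. h * (sqrt (2 * pi / h\<^sup>2) * exp (- ((h *\<^sub>R z \<bullet> b)\<^sup>2 / (2 * h\<^sup>2)))))"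
    by (simp add: gauss_hat_def gauss_hat1_def prod.distrib)
  also have "\<dots> = gauss_hat (\<lambda>_. 1) z"
    unfolding gauss_hat_def gauss_hat1_def using h by (intro prod.cong) (auto simp: real_sqrt_divide power_mult_distrib)
  finally show ?thesis .
qed

text \<open>The mass of the kernel at unit scale; with \<open>gauss_hat_scale\<close> it is an approximate identity.\<close>

lemma gauss_hat_integral:
  "has_bochner_integral lborel (gauss_hat (\<lambda>_::'a::euclidean_space. 1)) ((2 * pi) ^ DIM('a))"
proof (rule has_bochner_integral_nn_integral)
  have "(\<integral>\<^sup>+x. ennreal (gauss_hat (\<lambda>_. 1) (x::'a)) \<partial>lborel) = (\<integral>\<^sup>+x. ennreal (gauss_hat (\<lambda>_. 1) (0 - (x::'a))) \<partial>lborel)"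
    by (simp add: gauss_hat_minus)
  also have "\<dots> = ennreal ((2 * pi) ^ DIM('a))"
    by (rule nn_integral_gauss_hat) simp
  finally show "(\<integral>\<^sup>+x. ennreal (gauss_hat (\<lambda>_. 1) (x::'a)) \<partial>lborel) = ennreal ((2 * pi) ^ DIM('a))" .
qed (auto intro!: AE_I2 gauss_hat_nonneg)

lemma gauss_scaled_tendsto:
  assumes "h \<longlonglongrightarrow> 0"
  shows "(\<lambda>n. gauss (\<lambda>_. (h n)\<^sup>2) x) \<longlonglongrightarrow> 1"
proof -
  have "(\<lambda>n. gauss (\<lambda>_. (h n)\<^sup>2) x) \<longlonglongrightarrow> (\<Prod>b\<in>Basis. exp (- (0\<^sup>2 * (x \<bullet> b)\<^sup>2 / 2)))"
    unfolding gauss_def by (intro tendsto_intros assms) auto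
  then show ?thesis by simp
qed

section \<open>A Gaussian Schur test\<close>

lemma integrable_pair_bound:
  fixes F :: "'a::euclidean_space \<times> 'b::euclidean_space \<Rightarrow> complex" and f :: "'a \<Rightarrow> complex" and g :: "'b \<Rightarrow> complex"
  assumes [measurable]: "F \<in> borel_measurable (lborel \<Otimes>\<^sub>M lborel)"
    and f: "integrable lborel f" and g: "integrable lborel g"
    and le: "\<And>x y. cmod (F (x, y)) \<le> cmod (f x) * cmod (g y)"
  shows "integrable (lborel \<Otimes>\<^sub>M lborel) F"
proof (rule integrableI_bounded)
  have [measurable]: "f \<in> borel_measurable lborel" "g \<in> borel_measurable lborel"
    using f g by (auto intro: borel_measurable_integrable)
  have "(\<integral>\<^sup>+z. norm (F z) \<partial>(lborel \<Otimes>\<^sub>M lborel)) = (\<integral>\<^sup>+x. (\<integral>\<^sup>+y. norm (F (x, y)) \<partial>lborel) \<partial>lborel)"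
    by (rule lborel.nn_integral_fst[symmetric]) simp
  also have "\<dots> \<le> (\<integral>\<^sup>+x. (\<integral>\<^sup>+y. ennreal (norm (f x)) * ennreal (norm (g y)) \<partial>lborel) \<partial>lborel)"
    by (intro nn_integral_mono) (use le in \<open>simp add: ennreal_mult[symmetric] ennreal_leI\<close>)
  also have "\<dots> = (\<integral>\<^sup>+x. norm (f x) \<partial>lborel) * (\<integral>\<^sup>+y. norm (g y) \<partial>lborel)"
    by (simp add: nn_integral_cmult nn_integral_multc)
  also have "\<dots> < \<infinity>"
    using f g by (auto simp: integrable_iff_bounded ennreal_mult_less_top)
  finally show "(\<integral>\<^sup>+z. norm (F z) \<partial>(lborel \<Otimes>\<^sub>M lborel)) < \<infinity>" .
qed fact

lemma
  fixes f :: "'a::euclidean_space \<Rightarrow> complex" and g :: "'b::euclidean_space \<Rightarrow> complex"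
  assumes f: "integrable lborel f" and g: "integrable lborel g"
  shows integrable_pair_mult: "integrable (lborel \<Otimes>\<^sub>M lborel) (\<lambda>z. f (fst z) * g (snd z))"
    and integral_pair_mult: "(\<integral>z. f (fst z) * g (snd z) \<partial>(lborel \<Otimes>\<^sub>M lborel)) = (\<integral>x. f x \<partial>lborel) * (\<integral>y. g y \<partial>lborel)"
proof -
  have [measurable]: "f \<in> borel_measurable lborel" "g \<in> borel_measurable lborel"
    using f g by (auto intro: borel_measurable_integrable)
  show i: "integrable (lborel \<Otimes>\<^sub>M lborel) (\<lambda>z. f (fst z) * g (snd z))"
    by (rule integrable_pair_bound[OF _ f g]) (simp_all add: norm_mult)
  show "(\<integral>z. f (fst z) * g (snd z) \<partial>(lborel \<Otimes>\<^sub>M lborel)) = (\<integral>x. f x \<partial>lborel) * (\<integral>y. g y \<partial>lborel)"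
    using lborel_pair.integral_fst'[OF i] by simp
qed

text \<open>Expand the square as a double integral and integrate over \<open>y\<close> first. All oscillation is absorbed by
the Fourier transform of the Gaussian, which is nonnegative, so that absolute values can be taken inside afterwards
without loss.\<close>

lemma gaussian_TT_star:
  fixes f :: "'a::euclidean_space \<Rightarrow> complex" and p :: "'a \<Rightarrow> 'b::euclidean_space"
  assumes c: "\<And>b. b \<in> Basis \<Longrightarrow> 0 < c b"
    and f: "integrable lborel f" and p[measurable]: "p \<in> borel_measurable borel"
  shows "(\<integral>\<^sup>+y. ennreal (gauss c y * (cmod (\<integral>\<xi>. exp (\<i> * of_real (y \<bullet> p \<xi>)) * f \<xi> \<partial>lborel))\<^sup>2) \<partial>lborel)
     \<le> (\<integral>\<^sup>+\<xi>. (\<integral>\<^sup>+\<eta>. ennreal (cmod (f \<xi>) * cmod (f \<eta>) * gauss_hat c (p \<xi> - p \<eta>)) \<partial>lborel) \<partial>lborel)"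
proof -
  have [measurable]: "f \<in> borel_measurable lborel" "f \<in> borel_measurable borel"
    using borel_measurable_integrable[OF f] by auto
  have [measurable]: "cnj \<in> borel_measurable borel"
    by (intro borel_measurable_continuous_onI continuous_intros)
  define e where "e y \<xi> = exp (\<i> * of_real (y \<bullet> p \<xi>))" for y \<xi>
  define F where "F y = (\<integral>\<xi>. e y \<xi> * f \<xi> \<partial>lborel)" for y
  define h where "h z = f (fst z) * cnj (f (snd z))" for z :: "'a \<times> 'a"
  have [simp]: "cmod (e y \<xi>) = 1" for y \<xi> by (simp add: e_def)
  have ef: "integrable lborel (\<lambda>\<xi>. e y \<xi> * f \<xi>)" for y
    by (rule Bochner_Integration.integrable_bound[OF f]) (auto simp: norm_mult e_def)
  have h: "integrable lborel h"
    unfolding h_def lborel_prod[symmetric] using f by (intro integrable_pair_mult) auto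
  define K where "K y z = of_real (gauss c y) * (exp (\<i> * of_real (y \<bullet> (p (fst z) - p (snd z)))) * h z)" for y z
  have FF: "of_real (gauss c y * (cmod (F y))\<^sup>2) = (\<integral>z. K y z \<partial>lborel)" for y
  proof -
    have "complex_of_real ((cmod (F y))\<^sup>2) = F y * cnj (F y)"
      by (rule complex_norm_square)
    also have "cnj (F y) = (\<integral>\<xi>. cnj (e y \<xi> * f \<xi>) \<partial>lborel)"
      unfolding F_def by (rule Bochner_Integration.integral_cnj[symmetric])
    also have "F y * \<dots> = (\<integral>z. (e y (fst z) * f (fst z)) * cnj (e y (snd z) * f (snd z)) \<partial>(lborel \<Otimes>\<^sub>M lborel))"
      unfolding F_def using ef integrable_cnj[OF ef] by (subst integral_pair_mult) (auto simp del: complex_cnj_mult)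
    also have "\<dots> = (\<integral>z. exp (\<i> * of_real (y \<bullet> (p (fst z) - p (snd z)))) * h z \<partial>lborel)"
      unfolding lborel_prod
      by (intro Bochner_Integration.integral_cong) (simp_all add: e_def h_def exp_cnj inner_diff_right exp_diff right_diff_distrib exp_minus field_simps)
    finally show ?thesis by (simp add: K_def)
  qed
  have gi: "integrable lborel (\<lambda>y. complex_of_real (gauss c y))"
    using gauss_integrable[of c] c by simp
  have K: "integrable (lborel \<Otimes>\<^sub>M lborel) (case_prod K)"
  proof (rule integrable_pair_bound[OF _ gi h])
    show "case_prod K \<in> borel_measurable (lborel \<Otimes>\<^sub>M lborel)"
    proof -
      have "case_prod K \<in> borel_measurable (borel \<Otimes>\<^sub>M (borel \<Otimes>\<^sub>M borel))"
        unfolding K_def h_def by measurable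
      then show ?thesis by (simp add: lborel_prod borel_prod)
    qed
  qed (simp add: K_def norm_mult)
  have "(\<integral>\<^sup>+y. ennreal (gauss c y * (cmod (F y))\<^sup>2) \<partial>lborel) = ennreal (\<integral>y. gauss c y * (cmod (F y))\<^sup>2 \<partial>lborel)"
  proof (rule nn_integral_eq_integral)
    have "integrable lborel (\<lambda>y. complex_of_real (gauss c y * (cmod (F y))\<^sup>2))"
      unfolding FF by (rule lborel_pair.integrable_fst[OF K])
    then show "integrable lborel (\<lambda>y. gauss c y * (cmod (F y))\<^sup>2)"
      by (simp only: complex_of_real_integrable_eq)
  qed (simp add: gauss_nonneg)
  also have "(\<integral>y. gauss c y * (cmod (F y))\<^sup>2 \<partial>lborel) \<le> cmod (\<integral>y. complex_of_real (gauss c y * (cmod (F y))\<^sup>2) \<partial>lborel)"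
    by (simp del: of_real_mult of_real_power)
  also have "(\<integral>y. complex_of_real (gauss c y * (cmod (F y))\<^sup>2) \<partial>lborel) = (\<integral>z. (\<integral>y. K y z \<partial>lborel) \<partial>lborel)"
    unfolding FF by (rule lborel_pair.Fubini_integral[OF K, symmetric])
  also have "\<dots> = (\<integral>z. h z * of_real (gauss_hat c (p (fst z) - p (snd z))) \<partial>lborel)"
  proof (rule Bochner_Integration.integral_cong[OF refl])
    fix z
    have "(\<integral>y. K y z \<partial>lborel) = h z * (\<integral>y. exp (\<i> * of_real (y \<bullet> (p (fst z) - p (snd z)))) * of_real (gauss c y) \<partial>lborel)"
      unfolding integral_mult_right_zero[symmetric] by (intro Bochner_Integration.integral_cong) (auto simp: K_def)
    then show "(\<integral>y. K y z \<partial>lborel) = h z * of_real (gauss_hat c (p (fst z) - p (snd z)))"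
      using gauss_fourier[of c "p (fst z) - p (snd z)"] c by (simp add: has_bochner_integral_iff)
  qed
  also have "ennreal (cmod \<dots>) \<le> (\<integral>\<^sup>+z. cmod (h z * of_real (gauss_hat c (p (fst z) - p (snd z)))) \<partial>lborel)"
    by (cases "integrable lborel (\<lambda>z. h z * complex_of_real (gauss_hat c (p (fst z) - p (snd z))))")
       (auto intro: integral_norm_bound_ennreal simp: not_integrable_integral_eq)
  also have "\<dots> = (\<integral>\<^sup>+\<xi>. (\<integral>\<^sup>+\<eta>. cmod (h (\<xi>, \<eta>) * of_real (gauss_hat c (p \<xi> - p \<eta>))) \<partial>lborel) \<partial>lborel)"
    unfolding h_def by (subst lborel_prod[symmetric], subst lborel.nn_integral_fst[symmetric]) auto
  also have "\<dots> = (\<integral>\<^sup>+\<xi>. (\<integral>\<^sup>+\<eta>. ennreal (cmod (f \<xi>) * cmod (f \<eta>) * gauss_hat c (p \<xi> - p \<eta>)) \<partial>lborel) \<partial>lborel)"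
    by (simp add: h_def norm_mult gauss_hat_nonneg c)
  finally show ?thesis
    by (simp add: F_def e_def ennreal_leI)
qed

text \<open>Bound \<open>|g(\<xi>)| v(\<xi>) |g(\<eta>)| v(\<eta>)\<close> by half the sum of \<open>|g(\<xi>)|\<^sup>2 v(\<eta>)\<^sup>2\<close> and \<open>|g(\<eta>)|\<^sup>2 v(\<xi>)\<^sup>2\<close>; the
kernel is symmetric. Each amplitude is moved to the point where it is integrated against the kernel, so amplitudes that
are singular or unbounded are harmless as long as that integral is bounded.\<close>

lemma gaussian_schur:
  fixes g :: "'a::euclidean_space \<Rightarrow> complex" and p :: "'a \<Rightarrow> 'b::euclidean_space" and v :: "'a \<Rightarrow> real"
  assumes c: "\<And>b. b \<in> Basis \<Longrightarrow> 0 < c b"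
    and f: "integrable lborel (\<lambda>\<xi>. of_real (v \<xi>) * g \<xi>)" and p[measurable]: "p \<in> borel_measurable borel"
    and v[measurable]: "v \<in> borel_measurable borel" and g[measurable]: "g \<in> borel_measurable borel"
    and v0: "\<And>\<xi>. 0 \<le> v \<xi>"
  shows "(\<integral>\<^sup>+y. ennreal (gauss c y * (cmod (\<integral>\<xi>. exp (\<i> * of_real (y \<bullet> p \<xi>)) * (of_real (v \<xi>) * g \<xi>) \<partial>lborel))\<^sup>2) \<partial>lborel)
     \<le> (\<integral>\<^sup>+\<xi>. ennreal ((cmod (g \<xi>))\<^sup>2) * (\<integral>\<^sup>+\<eta>. ennreal ((v \<eta>)\<^sup>2 * gauss_hat c (p \<xi> - p \<eta>)) \<partial>lborel) \<partial>lborel)"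
proof -
  define k where "k \<xi> \<eta> = gauss_hat c (p \<xi> - p \<eta>)" for \<xi> \<eta>
  have k0: "0 \<le> k \<xi> \<eta>" for \<xi> \<eta> unfolding k_def by (rule gauss_hat_nonneg[OF c])
  have ks: "k \<eta> \<xi> = k \<xi> \<eta>" for \<xi> \<eta>
    unfolding k_def using gauss_hat_minus[of c "p \<xi> - p \<eta>"] by simp
  have [measurable]: "(\<lambda>z. k (fst z) (snd z)) \<in> borel_measurable (borel \<Otimes>\<^sub>M borel)"
    unfolding k_def by measurable
  define G where "G \<xi> \<eta> = ennreal ((cmod (g \<xi>))\<^sup>2 * ((v \<eta>)\<^sup>2 * k \<xi> \<eta>))" for \<xi> \<eta>
  have [measurable]: "(\<lambda>z. G (fst z) (snd z)) \<in> borel_measurable (borel \<Otimes>\<^sub>M borel)"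
    unfolding G_def by measurable
  have [measurable]: "case_prod G \<in> borel_measurable (lborel \<Otimes>\<^sub>M lborel)"
     "(\<lambda>(x, y). G y x) \<in> borel_measurable (lborel \<Otimes>\<^sub>M lborel)"
    unfolding G_def k_def by measurable
  have [measurable]: "G x \<in> borel_measurable lborel" "(\<lambda>y. G y x) \<in> borel_measurable lborel" for x
    unfolding G_def k_def by measurable
  have G2: "ennreal (cmod (of_real (v \<xi>) * g \<xi>) * cmod (of_real (v \<eta>) * g \<eta>) * k \<xi> \<eta>) \<le> (G \<xi> \<eta> + G \<eta> \<xi>) / 2" for \<xi> \<eta>
  proof -
    define a b where "a = cmod (g \<xi>) * v \<eta>" and "b = cmod (g \<eta>) * v \<xi>"
    have "a * b \<le> (a\<^sup>2 + b\<^sup>2) / 2"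
      using sum_squares_bound[of a b] by simp
    then have "a * b * k \<xi> \<eta> \<le> (a\<^sup>2 + b\<^sup>2) / 2 * k \<xi> \<eta>"
      by (rule mult_right_mono) (rule k0)
    then have "cmod (of_real (v \<xi>) * g \<xi>) * cmod (of_real (v \<eta>) * g \<eta>) * k \<xi> \<eta> \<le> ((cmod (g \<xi>))\<^sup>2 * ((v \<eta>)\<^sup>2 * k \<xi> \<eta>) + (cmod (g \<eta>))\<^sup>2 * ((v \<xi>)\<^sup>2 * k \<eta> \<xi>)) / 2"
      by (simp add: norm_mult v0 a_def b_def ks[of \<eta> \<xi>] power_mult_distrib algebra_simps)
    then have "ennreal (cmod (of_real (v \<xi>) * g \<xi>) * cmod (of_real (v \<eta>) * g \<eta>) * k \<xi> \<eta>) \<le> ennreal (((cmod (g \<xi>))\<^sup>2 * ((v \<eta>)\<^sup>2 * k \<xi> \<eta>) + (cmod (g \<eta>))\<^sup>2 * ((v \<xi>)\<^sup>2 * k \<eta> \<xi>)) / 2)"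
      by (rule ennreal_leI)
    also have "\<dots> = (G \<xi> \<eta> + G \<eta> \<xi>) / 2"
      using k0 by (simp add: G_def ennreal_plus[symmetric] divide_ennreal[symmetric] del: ennreal_plus)
    finally show ?thesis .
  qed
  have "(\<integral>\<^sup>+y. ennreal (gauss c y * (cmod (\<integral>\<xi>. exp (\<i> * of_real (y \<bullet> p \<xi>)) * (of_real (v \<xi>) * g \<xi>) \<partial>lborel))\<^sup>2) \<partial>lborel)
     \<le> (\<integral>\<^sup>+\<xi>. (\<integral>\<^sup>+\<eta>. ennreal (cmod (of_real (v \<xi>) * g \<xi>) * cmod (of_real (v \<eta>) * g \<eta>) * k \<xi> \<eta>) \<partial>lborel) \<partial>lborel)"
    unfolding k_def by (rule gaussian_TT_star[OF c f p])
  also have "\<dots> \<le> (\<integral>\<^sup>+\<xi>. (\<integral>\<^sup>+\<eta>. (G \<xi> \<eta> + G \<eta> \<xi>) / 2 \<partial>lborel) \<partial>lborel)"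
    by (intro nn_integral_mono G2)
  also have "\<dots> = ((\<integral>\<^sup>+\<xi>. (\<integral>\<^sup>+\<eta>. G \<xi> \<eta> \<partial>lborel) \<partial>lborel) + (\<integral>\<^sup>+\<xi>. (\<integral>\<^sup>+\<eta>. G \<eta> \<xi> \<partial>lborel) \<partial>lborel)) / 2"
    by (simp add: nn_integral_divide nn_integral_add)
  also have "(\<integral>\<^sup>+\<xi>. (\<integral>\<^sup>+\<eta>. G \<eta> \<xi> \<partial>lborel) \<partial>lborel) = (\<integral>\<^sup>+\<xi>. (\<integral>\<^sup>+\<eta>. G \<xi> \<eta> \<partial>lborel) \<partial>lborel)"
    by (rule lborel_pair.Fubini') (simp add: case_prod_beta)
  also have "((\<integral>\<^sup>+\<xi>. (\<integral>\<^sup>+\<eta>. G \<xi> \<eta> \<partial>lborel) \<partial>lborel) + (\<integral>\<^sup>+\<xi>. (\<integral>\<^sup>+\<eta>. G \<xi> \<eta> \<partial>lborel) \<partial>lborel)) / 2 = (\<integral>\<^sup>+\<xi>. (\<integral>\<^sup>+\<eta>. G \<xi> \<eta> \<partial>lborel) \<partial>lborel)"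
    by (simp add: mult_2[symmetric] mult.commute[of 2] ennreal_mult_divide_eq)
  also have "\<dots> = (\<integral>\<^sup>+\<xi>. ennreal ((cmod (g \<xi>))\<^sup>2) * (\<integral>\<^sup>+\<eta>. ennreal ((v \<eta>)\<^sup>2 * k \<xi> \<eta>) \<partial>lborel) \<partial>lborel)"
    unfolding G_def k_def
    by (intro nn_integral_cong) (subst nn_integral_cmult[symmetric], auto simp: ennreal_mult' intro!: nn_integral_cong)
  finally show ?thesis by (simp add: k_def)
qed

section \<open>Power weights\<close>

lemma nn_integral_powr_near_0:
  assumes "-1 < a" "0 \<le> T"
  shows "(\<integral>\<^sup>+t. ennreal (t powr a * indicator {0..T} t) \<partial>lborel) = ennreal (T powr (a + 1) / (a + 1))"
  using nn_integral_has_integral_lebesgue[OF _ has_integral_powr_from_0[OF assms]]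
  by (simp add: mult.commute indicator_def if_distrib cong: if_cong)

lemma nn_integral_powr_near_inf:
  assumes "a < -1" "0 < T"
  shows "(\<integral>\<^sup>+t. ennreal (t powr a * indicator {T..} t) \<partial>lborel) = ennreal (T powr (a + 1) / - (a + 1))"
proof -
  have "T powr (a + 1) / - (a + 1) = - (T powr (a + 1)) / (a + 1)"
    by (metis minus_divide_left minus_divide_right)
  then show ?thesis
    using nn_integral_has_integral_lebesgue[OF _ has_integral_powr_to_inf[OF assms]]
    by (simp only: mult.commute[of "indicator _ _"]) simp
qed

lemma nn_integral_even:
  fixes f :: "real \<Rightarrow> ennreal"
  assumes [measurable]: "f \<in> borel_measurable borel" and even: "\<And>x. f (- x) = f x"
  shows "(\<integral>\<^sup>+x. f x \<partial>lborel) = 2 * (\<integral>\<^sup>+x. f x * indicator {0<..} x \<partial>lborel)"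
proof -
  have 0: "AE x in lborel. x \<noteq> (0::real)"
    by (rule AE_lborel_singleton)
  have "(\<integral>\<^sup>+x. f x \<partial>lborel) = (\<integral>\<^sup>+x. f x * indicator {0<..} x + f x * indicator {..<0} x \<partial>lborel)"
    by (intro nn_integral_cong_AE, use 0 in eventually_elim) (auto simp: indicator_def)
  also have "\<dots> = (\<integral>\<^sup>+x. f x * indicator {0<..} x \<partial>lborel) + (\<integral>\<^sup>+x. f x * indicator {..<0} x \<partial>lborel)"
    by (rule nn_integral_add) auto
  also have "(\<integral>\<^sup>+x. f x * indicator {..<0} x \<partial>lborel) = (\<integral>\<^sup>+x. f x * indicator {0<..} x \<partial>lborel)"
    by (subst nn_integral_real_affine[where c="-1" and t=0]) (auto simp: even indicator_def intro!: nn_integral_cong)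
  finally show ?thesis by (simp add: mult_2)
qed

lemma nn_integral_powr_decay_1d:
  assumes p: "-1 < p" "p \<le> (0::real)"
  shows "(\<integral>\<^sup>+y. ennreal (\<bar>y\<bar> powr p / (1 + y\<^sup>2)) \<partial>lborel) < \<infinity>"
proof -
  have "(\<integral>\<^sup>+y. ennreal (\<bar>y\<bar> powr p / (1 + y\<^sup>2)) * indicator {0<..} y \<partial>lborel)
     \<le> (\<integral>\<^sup>+y. ennreal (y powr p * indicator {0..1} y) + ennreal (y powr (-2) * indicator {1..} y) \<partial>lborel)"
  proof (rule nn_integral_mono)
    fix y :: real
    have "y powr p / (1 + y\<^sup>2) \<le> y powr p" if "0 < y"
      using that by (simp add: divide_le_eq mult_le_cancel_left1 add_nonneg_pos)
    moreover have "y powr p / (1 + y\<^sup>2) \<le> y powr (-2)" if "1 < y"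
    proof -
      have "y powr p \<le> 1" using that p powr_mono[of p 0 y] by simp
      then have "y powr p / (1 + y\<^sup>2) \<le> 1 / y\<^sup>2"
        using that by (intro frac_le) auto
      also have "\<dots> = y powr (-2)" using that by (simp add: powr_minus divide_inverse)
      finally show ?thesis .
    qed
    ultimately show "ennreal (\<bar>y\<bar> powr p / (1 + y\<^sup>2)) * indicator {0<..} y \<le> ennreal (y powr p * indicator {0..1} y) + ennreal (y powr (-2) * indicator {1..} y)"
    proof (cases "0 < y \<and> y \<le> 1")
      case True
      then have "ennreal (\<bar>y\<bar> powr p / (1 + y\<^sup>2)) \<le> ennreal (y powr p * indicator {0..1} y)"
        using \<open>0 < y \<Longrightarrow> y powr p / (1 + y\<^sup>2) \<le> y powr p\<close> by (auto intro!: ennreal_leI)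
      with True show ?thesis by (auto intro: order.trans add_increasing2)
    next
      case False
      then show ?thesis
        using \<open>1 < y \<Longrightarrow> y powr p / (1 + y\<^sup>2) \<le> y powr (-2)\<close> by (auto simp: indicator_def intro!: ennreal_leI)
    qed
  qed
  also have "\<dots> = ennreal (1 / (p + 1)) + ennreal 1"
    using p by (subst nn_integral_add) (auto simp: nn_integral_powr_near_0 nn_integral_powr_near_inf)
  also have "\<dots> < \<infinity>" by simp
  finally show ?thesis
    by (subst nn_integral_even) (auto simp: ennreal_mult_less_top)
qed

lemma AE_coords_nonzero: "AE x in lborel. \<forall>b\<in>(Basis::'a::euclidean_space set). x \<bullet> b \<noteq> 0"
proof (subst AE_ball_countable, simp add: countable_finite, intro ballI)
  fix b :: 'a assume b: "b \<in> Basis"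
  then have "negligible {x. b \<bullet> x = 0}" by (intro negligible_hyperplane) auto
  then have "{x. b \<bullet> x = 0} \<in> null_sets lebesgue"
    by (simp add: negligible_iff_null_sets)
  then have "{x. b \<bullet> x = 0} \<in> null_sets lborel"
    by (subst (asm) null_sets_completion_iff) (auto intro!: borel_closed closed_hyperplane)
  then show "AE x in lborel. x \<bullet> b \<noteq> 0"
    by (intro AE_I'[of "{x. b \<bullet> x = 0}"]) (auto simp: inner_commute)
qed

lemma AE_norm_pos: "AE x in lborel. 0 < norm (x::'a::euclidean_space)"
  using AE_lborel_singleton[of "0::'a"] by eventually_elim simp

text \<open>Since \<open>(1 + |x|)\<^sup>2\<^sup>d\<close> dominates \<open>\<Prod>\<^sub>b (1 + x\<^sub>b\<^sup>2)\<close>, the integral is at most a product of integrals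
over the line.\<close>

lemma integrable_powr_decay:
  fixes S :: "'a::euclidean_space set"
  assumes S: "S \<subseteq> Basis" and p: "-1 < p" "p \<le> 0"
  shows "(\<integral>\<^sup>+x. ennreal ((\<Prod>b\<in>S. \<bar>x \<bullet> b\<bar> powr p) / (1 + norm x) ^ (2 * DIM('a))) \<partial>lborel) < \<infinity>"
proof -
  define f where "f b y = (if b \<in> S then \<bar>y\<bar> powr p / (1 + y\<^sup>2) else \<bar>y\<bar> powr 0 / (1 + y\<^sup>2))" for b :: 'a and y :: real
  have f0: "0 \<le> f b y" for b y by (auto simp: f_def intro!: divide_nonneg_pos add_pos_nonneg)
  have "(\<integral>\<^sup>+x. ennreal ((\<Prod>b\<in>S. \<bar>x \<bullet> b\<bar> powr p) / (1 + norm x) ^ (2 * DIM('a))) \<partial>lborel)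
     \<le> (\<integral>\<^sup>+x. (\<Prod>b\<in>Basis. ennreal (f b (x \<bullet> b))) \<partial>lborel)"
  proof (rule nn_integral_mono_AE, use AE_coords_nonzero in eventually_elim)
    case (elim x)
    have "(\<Prod>b\<in>(Basis::'a set). 1 + (x \<bullet> b)\<^sup>2) \<le> (\<Prod>b\<in>(Basis::'a set). (1 + norm x)\<^sup>2)"
    proof (rule prod_mono, safe)
      fix b :: 'a assume "b \<in> Basis"
      then have "\<bar>x \<bullet> b\<bar> \<le> norm x" by (rule Basis_le_norm)
      then have "(x \<bullet> b)\<^sup>2 \<le> (norm x)\<^sup>2" by (metis abs_norm_cancel abs_le_square_iff)
      then show "1 + (x \<bullet> b)\<^sup>2 \<le> (1 + norm x)\<^sup>2"
        using norm_ge_zero[of x] by (simp add: power2_sum add_increasing2)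
    qed (auto intro: add_nonneg_nonneg)
    also have "\<dots> = (1 + norm x) ^ (2 * DIM('a))"
      by (simp add: power_mult)
    finally have le: "(\<Prod>b\<in>(Basis::'a set). 1 + (x \<bullet> b)\<^sup>2) \<le> (1 + norm x) ^ (2 * DIM('a))" .
    have "(\<Prod>b\<in>S. \<bar>x \<bullet> b\<bar> powr p) = (\<Prod>b\<in>Basis. if b \<in> S then \<bar>x \<bullet> b\<bar> powr p else \<bar>x \<bullet> b\<bar> powr 0)"
      by (rule prod.mono_neutral_cong_left) (use S elim in auto)
    then have "(\<Prod>b\<in>S. \<bar>x \<bullet> b\<bar> powr p) / (1 + norm x) ^ (2 * DIM('a)) \<le>
       (\<Prod>b\<in>Basis. if b \<in> S then \<bar>x \<bullet> b\<bar> powr p else \<bar>x \<bullet> b\<bar> powr 0) / (\<Prod>b\<in>(Basis::'a set). 1 + (x \<bullet> b)\<^sup>2)"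
      using le by (intro frac_le) (auto intro!: prod_nonneg prod_pos add_pos_nonneg)
    also have "\<dots> = (\<Prod>b\<in>Basis. f b (x \<bullet> b))"
      unfolding prod_dividef[symmetric] f_def by (intro prod.cong) auto
    finally show ?case
      by (simp add: prod_ennreal f0 ennreal_leI)
  qed
  also have "\<dots> = (\<Prod>b\<in>Basis. (\<integral>\<^sup>+y. ennreal (f b y) \<partial>lborel))"
    by (subst nn_integral_lborel_prod) (auto simp: f_def)
  also have "\<dots> < \<infinity>"
  proof -
    have "(\<integral>\<^sup>+y. ennreal (f b y) \<partial>lborel) < \<infinity>" for b
    proof (cases "b \<in> S")
      case True
      then have "f b = (\<lambda>y. \<bar>y\<bar> powr p / (1 + y\<^sup>2))" by (simp add: f_def fun_eq_iff)
      then show ?thesis using nn_integral_powr_decay_1d[OF p] by simp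
    next
      case False
      then have "f b = (\<lambda>y. \<bar>y\<bar> powr 0 / (1 + y\<^sup>2))" by (simp add: f_def fun_eq_iff)
      then show ?thesis using nn_integral_powr_decay_1d[of 0] by simp
    qed
    then show ?thesis by (auto simp: less_top[symmetric] ennreal_prod_eq_top)
  qed
  finally show ?thesis .
qed

lemma integrable_decay: "integrable lborel (\<lambda>x::'a::euclidean_space. 1 / (1 + norm x) ^ (2 * DIM('a)))"
proof (rule integrableI_bounded)
  show "(\<integral>\<^sup>+x. norm (1 / (1 + norm (x::'a)) ^ (2 * DIM('a))) \<partial>lborel) < \<infinity>"
    using integrable_powr_decay[of "{}::'a set" 0] by (simp add: abs_of_nonneg)
qed simp

section \<open>Schwartz functions and Fourier inversion\<close>

lemma schwartz_partials:
  assumes "schwartz \<psi>" "bs \<in> lists Basis"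
  shows "schwartz (partials bs \<psi>)"
proof -
  have "partials cs (partials bs \<psi>) = partials (cs @ bs) \<psi>" for cs
    by (induction cs) auto
  with assms show ?thesis by (simp add: schwartz_def)
qed

lemma schwartz_differentiable: "schwartz \<psi> \<Longrightarrow> \<psi> differentiable (at x)"
  unfolding schwartz_def by (metis lists.Nil partials.simps(1))

lemma schwartz_measurable [measurable_dest]:
  assumes "schwartz \<psi>"
  shows "\<psi> \<in> borel_measurable borel"
  using schwartz_differentiable[OF assms]
  by (intro borel_measurable_continuous_onI continuous_at_imp_continuous_on ballI differentiable_imp_continuous_within) auto

lemma schwartz_decay:
  assumes "schwartz \<psi>"
  obtains B where "B \<ge> 0" "\<And>x. cmod (\<psi> x) \<le> B / (1 + norm x) ^ N"
proof -
  have "[] \<in> lists Basis" by simp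
  then obtain B0 B1 where B: "\<And>x. norm x ^ 0 * cmod (\<psi> x) \<le> B0" "\<And>x. norm x ^ N * cmod (\<psi> x) \<le> B1"
    using assms unfolding schwartz_def by (metis partials.simps(1))
  have "(1 + norm x) ^ N * cmod (\<psi> x) \<le> 2 ^ N * (B0 + B1)" for x
  proof -
    have "(1 + norm x) ^ N \<le> (2 * max 1 (norm x)) ^ N"
      by (intro power_mono) auto
    also have "\<dots> \<le> 2 ^ N * (1 + norm x ^ N)"
      by (auto simp: power_mult_distrib max_def)
    finally have "(1 + norm x) ^ N * cmod (\<psi> x) \<le> 2 ^ N * (1 + norm x ^ N) * cmod (\<psi> x)"
      by (rule mult_right_mono) auto
    also have "\<dots> = 2 ^ N * (norm x ^ 0 * cmod (\<psi> x) + norm x ^ N * cmod (\<psi> x))"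
      by (simp add: algebra_simps)
    also have "\<dots> \<le> 2 ^ N * (B0 + B1)"
      by (intro mult_left_mono add_mono B) auto
    finally show ?thesis .
  qed
  then have "cmod (\<psi> x) \<le> max 0 (2 ^ N * (B0 + B1)) / (1 + norm x) ^ N" for x
    by (subst pos_le_divide_eq) (auto simp: add_pos_nonneg mult.commute intro: max.coboundedI2)
  then show ?thesis by (intro that[of "max 0 (2 ^ N * (B0 + B1))"]) auto
qed

lemma decay_integrable:
  fixes f :: "'a::euclidean_space \<Rightarrow> complex"
  assumes "f \<in> borel_measurable borel" and le: "\<And>x. cmod (f x) \<le> B / (1 + norm x) ^ (2 * DIM('a))"
  shows "integrable lborel f"
proof (rule Bochner_Integration.integrable_bound)
  show "integrable lborel (\<lambda>x::'a. B * (1 / (1 + norm x) ^ (2 * DIM('a))))"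
    by (intro integrable_mult_right integrable_decay)
  show "AE x in lborel. norm (f x) \<le> norm (B * (1 / (1 + norm x) ^ (2 * DIM('a))))"
    by (intro AE_I2 order.trans[OF le]) (auto intro: divide_right_mono)
qed (use assms in simp)

lemma schwartz_integrable:
  assumes "schwartz \<psi>"
  shows "integrable lborel \<psi>"
  using schwartz_decay[OF assms] decay_integrable[OF schwartz_measurable[OF assms]] by metis

lemma fourier_integrable:
  fixes f :: "'a::euclidean_space \<Rightarrow> complex"
  assumes "integrable lborel f"
  shows "integrable lborel (\<lambda>x. exp (\<i> * of_real (x \<bullet> \<xi>)) * f x)" "integrable lborel (\<lambda>x. exp (- \<i> * of_real (x \<bullet> \<xi>)) * f x)"
  by (rule Bochner_Integration.integrable_bound[OF assms], use assms in \<open>auto simp: norm_mult\<close>)+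

lemma fourier_bound:
  assumes "integrable lborel f"
  shows "cmod (fourier f \<xi>) \<le> (\<integral>x. cmod (f x) \<partial>lborel)"
proof -
  have "cmod (fourier f \<xi>) \<le> (\<integral>x. cmod (exp (- \<i> * of_real (x \<bullet> \<xi>)) * f x) \<partial>lborel)"
    unfolding fourier_def by (rule integral_norm_bound)
  also have "\<dots> = (\<integral>x. cmod (f x) \<partial>lborel)"
    by (simp add: norm_mult)
  finally show ?thesis .
qed

lemma fourier_measurable:
  assumes [measurable]: "f \<in> borel_measurable lborel"
  shows "fourier f \<in> borel_measurable borel"
proof -
  have "(\<lambda>\<xi>. \<integral>x. exp (- \<i> * of_real (x \<bullet> \<xi>)) * f x \<partial>lborel) \<in> borel_measurable borel"
    by (rule lborel.borel_measurable_lebesgue_integral) measurable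
  then show ?thesis by (simp add: fourier_def[abs_def])
qed

lemma fourier_translate:
  fixes f :: "'a::euclidean_space \<Rightarrow> complex"
  assumes [measurable]: "f \<in> borel_measurable borel"
  shows "fourier (\<lambda>x. f (x + a)) \<xi> = exp (\<i> * of_real (a \<bullet> \<xi>)) * fourier f \<xi>"
proof -
  have "fourier f \<xi> = (\<integral>x. exp (- \<i> * of_real (x \<bullet> \<xi>)) * f x \<partial>distr lborel borel ((+) a))"
    by (simp add: fourier_def lborel_distr_plus)
  also have "\<dots> = (\<integral>x. exp (- \<i> * of_real ((a + x) \<bullet> \<xi>)) * f (a + x) \<partial>lborel)"
    by (rule integral_distr) auto
  also have "\<dots> = (\<integral>x. exp (- \<i> * of_real (a \<bullet> \<xi>)) * (exp (- \<i> * of_real (x \<bullet> \<xi>)) * f (x + a)) \<partial>lborel)"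
    by (intro Bochner_Integration.integral_cong) (auto simp: inner_add_left ring_distribs exp_add exp_diff exp_minus add.commute field_simps)
  also have "\<dots> = exp (- \<i> * of_real (a \<bullet> \<xi>)) * fourier (\<lambda>x. f (x + a)) \<xi>"
    unfolding fourier_def by (rule integral_mult_right_zero)
  finally show ?thesis by (simp add: exp_minus field_simps)
qed

text \<open>The majorant of the difference quotients in \<open>fourier_derivative\<close>. The factor \<open>2 ^ N\<close> comes from
\<open>1 + |x| \<le> 2 (1 + |x + t b|)\<close> for \<open>0 \<le> t \<le> 1\<close>.\<close>

lemma directional_difference_bound:
  fixes f :: "'a::euclidean_space \<Rightarrow> complex"
  assumes diff: "\<And>x. f differentiable (at x)" and b: "norm b = 1"
    and le: "\<And>x. cmod (frechet_derivative f (at x) b) \<le> B / (1 + norm x) ^ N"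
    and h: "0 < h" "h \<le> 1"
  shows "cmod ((f (x + h *\<^sub>R b) - f x) / of_real h) \<le> 2 ^ N * B / (1 + norm x) ^ N"
proof -
  define M where "M = 2 ^ N * B / (1 + norm x) ^ N"
  have B: "B \<ge> 0" using order.trans[OF norm_ge_zero le[of 0]] by simp
  have "norm (f (x + h *\<^sub>R b) - f (x + 0 *\<^sub>R b)) \<le> M * norm (h - 0)"
  proof (rule differentiable_bound[of "{0..h}" "\<lambda>t. f (x + t *\<^sub>R b)" "\<lambda>t s. frechet_derivative f (at (x + t *\<^sub>R b)) (s *\<^sub>R b)"])
    fix t assume t: "t \<in> {0..h}"
    have d: "(f has_derivative frechet_derivative f (at (x + t *\<^sub>R b))) (at (x + t *\<^sub>R b))"
      using diff frechet_derivative_works by blast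
    have "((\<lambda>t. x + t *\<^sub>R b) has_derivative (\<lambda>s. s *\<^sub>R b)) (at t within {0..h})"
      by (auto intro!: derivative_eq_intros)
    from has_derivative_compose[OF this d]
    show "((\<lambda>t. f (x + t *\<^sub>R b)) has_derivative (\<lambda>s. frechet_derivative f (at (x + t *\<^sub>R b)) (s *\<^sub>R b))) (at t within {0..h})" .
    have lin: "linear (frechet_derivative f (at (x + t *\<^sub>R b)))"
      using d has_derivative_linear by blast
    have "1 + norm x \<le> 2 * (1 + norm (x + t *\<^sub>R b))"
    proof -
      have "norm x \<le> norm (x + t *\<^sub>R b) + norm (t *\<^sub>R b)"
        using norm_triangle_ineq4[of "x + t *\<^sub>R b" "t *\<^sub>R b"] by simp
      moreover have "norm (t *\<^sub>R b) \<le> 1" using t h b by simp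
      ultimately show ?thesis using norm_ge_zero[of "x + t *\<^sub>R b"] by argo
    qed
    then have "(1 + norm x) ^ N \<le> (2 * (1 + norm (x + t *\<^sub>R b))) ^ N" by (rule power_mono) auto
    then have *: "(1 + norm x) ^ N \<le> 2 ^ N * (1 + norm (x + t *\<^sub>R b)) ^ N" by (simp only: power_mult_distrib)
    have "B / (1 + norm (x + t *\<^sub>R b)) ^ N \<le> M"
    proof -
      have "B / (1 + norm (x + t *\<^sub>R b)) ^ N = (2 ^ N * B) / (2 ^ N * (1 + norm (x + t *\<^sub>R b)) ^ N)"
        by simp
      also have "\<dots> \<le> M"
        unfolding M_def using B * by (intro divide_left_mono) (auto simp: add_pos_nonneg intro!: mult_pos_pos)
      finally show ?thesis .
    qed
    then have "cmod (frechet_derivative f (at (x + t *\<^sub>R b)) b) \<le> M"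
      using le order.trans by blast
    then show "onorm (\<lambda>s. frechet_derivative f (at (x + t *\<^sub>R b)) (s *\<^sub>R b)) \<le> M"
      by (intro onorm_le) (simp add: linear_cmul[OF lin] mult.commute[of M] mult_left_mono)
  qed (use h in auto)
  then show ?thesis using h by (simp add: M_def norm_divide divide_le_eq)
qed

text \<open>Translating \<open>f\<close> multiplies its transform by a character. The formula is the limit of this identity for
difference quotients, taken under the integral on one side and in the character on the other.\<close>

lemma fourier_derivative:
  fixes f :: "'a::euclidean_space \<Rightarrow> complex"
  assumes diff: "\<And>x. f differentiable (at x)" and b: "b \<in> Basis" and f: "integrable lborel f"
    and meas: "(\<lambda>x. frechet_derivative f (at x) b) \<in> borel_measurable borel"
    and le: "\<And>x. cmod (frechet_derivative f (at x) b) \<le> B / (1 + norm x) ^ (2 * DIM('a))"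
  shows "fourier (\<lambda>x. frechet_derivative f (at x) b) \<xi> = \<i> * of_real (b \<bullet> \<xi>) * fourier f \<xi>"
proof -
  have [measurable]: "f \<in> borel_measurable borel"
    using borel_measurable_integrable[OF f] by simp
  note meas[measurable]
  define h where "h n = 1 / real (Suc n)" for n
  have h: "0 < h n" "h n \<le> 1" for n by (auto simp: h_def)
  have h0: "h \<longlonglongrightarrow> 0" unfolding h_def by (rule LIMSEQ_Suc[OF lim_1_over_n])
  have fh: "filterlim h (at 0) sequentially"
    using h0 h(1) by (auto simp: filterlim_at intro!: always_eventually less_imp_neq[symmetric])
  define q where "q n x = (f (x + h n *\<^sub>R b) - f x) / of_real (h n)" for n x
  \<comment> \<open>The derivative along a real line as a limit of difference quotients with a complex denominator.\<close>
  have dl: "((\<lambda>t. (F t - F 0) / of_real t) \<longlongrightarrow> D) (at 0)" if "(F has_vector_derivative D) (at 0)" for F :: "real \<Rightarrow> complex" and D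
  proof -
    have "((\<lambda>t. norm (F (0 + t) - F 0 - t *\<^sub>R D) / norm t) \<longlongrightarrow> 0) (at 0)"
      using that by (simp add: has_vector_derivative_def has_derivative_at)
    moreover have "norm (F (0 + t) - F 0 - t *\<^sub>R D) / norm t = norm ((F t - F 0) / of_real t - D)" if "t \<noteq> 0" for t
    proof -
      have "(F t - F 0) / of_real t - D = (F t - F 0 - t *\<^sub>R D) / of_real t"
        using that by (simp add: scaleR_conv_of_real field_simps)
      then show ?thesis by (simp add: norm_divide)
    qed
    then have "eventually (\<lambda>t. norm (F (0 + t) - F 0 - t *\<^sub>R D) / norm t = norm ((F t - F 0) / of_real t - D)) (at 0)"
      by (simp add: eventually_at_filter)
    ultimately have "((\<lambda>t. norm ((F t - F 0) / of_real t - D)) \<longlongrightarrow> 0) (at 0)"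
      by (rule Lim_transform_eventually)
    then show ?thesis
      by (subst LIM_zero_iff[symmetric]) (simp only: tendsto_norm_zero_iff)
  qed
  have lim1: "(\<lambda>n. fourier (q n) \<xi>) \<longlonglongrightarrow> fourier (\<lambda>x. frechet_derivative f (at x) b) \<xi>"
    unfolding fourier_def
  proof (rule integral_dominated_convergence)
    show "integrable lborel (\<lambda>x::'a. (2 ^ (2 * DIM('a)) * B) * (1 / (1 + norm x) ^ (2 * DIM('a))))"
      by (intro integrable_mult_right integrable_decay)
    show "AE x in lborel. cmod (exp (- \<i> * of_real (x \<bullet> \<xi>)) * q n x) \<le> (2 ^ (2 * DIM('a)) * B) * (1 / (1 + norm x) ^ (2 * DIM('a)))" for n
    proof (rule AE_I2)
      fix x
      have "cmod (exp (- \<i> * of_real (x \<bullet> \<xi>)) * q n x) = cmod (q n x)" by (simp add: norm_mult)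
      then show "cmod (exp (- \<i> * of_real (x \<bullet> \<xi>)) * q n x) \<le> (2 ^ (2 * DIM('a)) * B) * (1 / (1 + norm x) ^ (2 * DIM('a)))"
        using directional_difference_bound[OF diff _ le h(1)[of n] h(2)[of n], where x=x] b by (simp add: q_def)
    qed
    show "AE x in lborel. (\<lambda>n. exp (- \<i> * of_real (x \<bullet> \<xi>)) * q n x) \<longlonglongrightarrow> exp (- \<i> * of_real (x \<bullet> \<xi>)) * frechet_derivative f (at x) b"
    proof (rule AE_I2, rule tendsto_mult[OF tendsto_const])
      fix x
      have d: "(f has_derivative frechet_derivative f (at x)) (at (x + 0 *\<^sub>R b))"
        using diff[of x] frechet_derivative_works by auto
      have "((\<lambda>t. x + t *\<^sub>R b) has_derivative (\<lambda>s. s *\<^sub>R b)) (at 0)"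
        by (auto intro!: derivative_eq_intros)
      from has_derivative_compose[OF this d]
      have "((\<lambda>t. f (x + t *\<^sub>R b)) has_vector_derivative frechet_derivative f (at x) b) (at 0)"
        using linear_cmul[OF has_derivative_linear[OF d]] by (simp add: has_vector_derivative_def)
      from filterlim_compose[OF dl[OF this] fh]
      show "(\<lambda>n. q n x) \<longlonglongrightarrow> frechet_derivative f (at x) b"
        by (simp add: q_def)
    qed
  qed (auto simp: q_def)
  have e1: "fourier (q n) \<xi> = (exp (\<i> * of_real (h n * (b \<bullet> \<xi>))) - 1) / of_real (h n) * fourier f \<xi>" for n
  proof -
    have i1: "integrable lborel (\<lambda>x. f (x + h n *\<^sub>R b))"
    proof -
      have "integrable (distr lborel borel ((+) (h n *\<^sub>R b))) f"
        using f by (simp add: lborel_distr_plus)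
      then show ?thesis by (subst (asm) integrable_distr_eq) (auto simp: add.commute)
    qed
    have "fourier (q n) \<xi> = (fourier (\<lambda>x. f (x + h n *\<^sub>R b)) \<xi> - fourier f \<xi>) / of_real (h n)"
    proof -
      have "fourier (q n) \<xi> = (\<integral>x. (exp (- \<i> * of_real (x \<bullet> \<xi>)) * f (x + h n *\<^sub>R b) - exp (- \<i> * of_real (x \<bullet> \<xi>)) * f x) / of_real (h n) \<partial>lborel)"
        unfolding fourier_def q_def by (intro Bochner_Integration.integral_cong refl) (simp add: right_diff_distrib)
      also have "\<dots> = (fourier (\<lambda>x. f (x + h n *\<^sub>R b)) \<xi> - fourier f \<xi>) / of_real (h n)"
        unfolding fourier_def integral_divide_zero
        by (subst Bochner_Integration.integral_diff[OF fourier_integrable(2)[OF i1] fourier_integrable(2)[OF f]]) (rule refl)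
      finally show ?thesis .
    qed
    then show ?thesis by (simp add: fourier_translate left_diff_distrib)
  qed
  have e2: "(\<lambda>n. (exp (\<i> * of_real (h n * (b \<bullet> \<xi>))) - 1) / of_real (h n)) \<longlonglongrightarrow> \<i> * of_real (b \<bullet> \<xi>)"
  proof -
    have "((\<lambda>t. exp (\<i> * of_real (t * (b \<bullet> \<xi>)))) has_vector_derivative \<i> * of_real (b \<bullet> \<xi>)) (at 0)"
    proof -
      have "((\<lambda>z. exp (\<i> * (z * of_real (b \<bullet> \<xi>)))) has_field_derivative \<i> * of_real (b \<bullet> \<xi>)) (at (of_real 0))"
        by (auto intro!: derivative_eq_intros)
      from has_vector_derivative_real_field[OF this] show ?thesis by simp
    qed
    from filterlim_compose[OF dl[OF this] fh] show ?thesis by simp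
  qed
  have "(\<lambda>n. fourier (q n) \<xi>) \<longlonglongrightarrow> \<i> * of_real (b \<bullet> \<xi>) * fourier f \<xi>"
    unfolding e1 by (rule tendsto_mult[OF e2 tendsto_const])
  with lim1 show ?thesis by (rule LIMSEQ_unique)
qed

lemma fourier_partials:
  fixes \<psi> :: "'a::euclidean_space \<Rightarrow> complex"
  assumes \<psi>: "schwartz \<psi>" and b: "b \<in> Basis"
  shows "fourier (partials (replicate k b) \<psi>) \<xi> = (\<i> * of_real (b \<bullet> \<xi>)) ^ k * fourier \<psi> \<xi>"
proof (induction k)
  case (Suc k)
  let ?f = "partials (replicate k b) \<psi>"
  have S: "schwartz (partials (replicate j b) \<psi>)" for j
    using schwartz_partials[OF \<psi>] b by (simp add: in_lists_conv_set)
  have S': "schwartz (\<lambda>x. frechet_derivative ?f (at x) b)"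
    using S[of "Suc k"] by simp
  obtain B where B: "\<And>x. cmod (frechet_derivative ?f (at x) b) \<le> B / (1 + norm x) ^ (2 * DIM('a))"
    using schwartz_decay[OF S'] by blast
  have "fourier (\<lambda>x. frechet_derivative ?f (at x) b) \<xi> = \<i> * of_real (b \<bullet> \<xi>) * fourier ?f \<xi>"
    by (rule fourier_derivative[OF schwartz_differentiable[OF S] b schwartz_integrable[OF S] schwartz_measurable[OF S'] B])
  then show ?case using Suc by simp
qed simp

text \<open>Powers of one coordinate of \<open>\<xi>\<close> come from derivatives in that direction, and a power of the norm is
controlled by the power of the largest coordinate.\<close>

lemma schwartz_fourier_decay:
  fixes \<psi> :: "'a::euclidean_space \<Rightarrow> complex"
  assumes \<psi>: "schwartz \<psi>"
  obtains B where "B \<ge> 0" "\<And>\<xi>. cmod (fourier \<psi> \<xi>) \<le> B / (1 + norm \<xi>) ^ N"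
proof -
  define C where "C b = (\<integral>x. cmod (partials (replicate N b) \<psi> x) \<partial>lborel)" for b
  define C0 where "C0 = (\<integral>x. cmod (\<psi> x) \<partial>lborel)"
  have C: "\<bar>\<xi> \<bullet> b\<bar> ^ N * cmod (fourier \<psi> \<xi>) \<le> C b" if b: "b \<in> Basis" for b \<xi>
  proof -
    have "schwartz (partials (replicate N b) \<psi>)"
      using schwartz_partials[OF \<psi>] b by (simp add: in_lists_conv_set)
    from fourier_bound[OF schwartz_integrable[OF this], of \<xi>] show ?thesis
      by (simp add: fourier_partials[OF \<psi> b] C_def norm_mult norm_power inner_commute power_mult_distrib)
  qed
  have C0: "cmod (fourier \<psi> \<xi>) \<le> C0" for \<xi>
    unfolding C0_def by (rule fourier_bound[OF schwartz_integrable[OF \<psi>]])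
  have nn: "0 \<le> C b" "0 \<le> C0" for b by (auto simp: C_def C0_def)
  define B where "B = real (DIM('a) + 1) ^ N * (C0 + (\<Sum>b\<in>(Basis::'a set). C b))"
  have "cmod (fourier \<psi> \<xi>) \<le> B / (1 + norm \<xi>) ^ N" for \<xi>
  proof -
    define M where "M = Max (insert 1 ((\<lambda>b. \<bar>\<xi> \<bullet> b\<bar>) ` Basis))"
    have M: "\<bar>\<xi> \<bullet> b\<bar> \<le> M" if "b \<in> Basis" for b unfolding M_def using that by (intro Max_ge) auto
    have M1: "1 \<le> M" unfolding M_def by (intro Max_ge) auto
    have Min: "M \<in> insert 1 ((\<lambda>b. \<bar>\<xi> \<bullet> b\<bar>) ` Basis)" unfolding M_def by (intro Max_in) auto
    have "norm \<xi> \<le> (\<Sum>b\<in>Basis. \<bar>\<xi> \<bullet> b\<bar>)" by (rule norm_le_l1)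
    also have "\<dots> \<le> (\<Sum>b\<in>(Basis::'a set). M)" by (intro sum_mono M)
    finally have "1 + norm \<xi> \<le> real (DIM('a) + 1) * M" using M1 by (simp add: algebra_simps)
    then have "(1 + norm \<xi>) ^ N \<le> (real (DIM('a) + 1) * M) ^ N" by (intro power_mono) auto
    then have "(1 + norm \<xi>) ^ N * cmod (fourier \<psi> \<xi>) \<le> (real (DIM('a) + 1) * M) ^ N * cmod (fourier \<psi> \<xi>)"
      by (rule mult_right_mono) auto
    also have "\<dots> = real (DIM('a) + 1) ^ N * (M ^ N * cmod (fourier \<psi> \<xi>))"
      by (simp only: power_mult_distrib mult.assoc)
    also have "M ^ N * cmod (fourier \<psi> \<xi>) \<le> C0 + (\<Sum>b\<in>(Basis::'a set). C b)"
    proof (cases "M = 1")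
      case True
      then show ?thesis using C0[of \<xi>] nn by (auto intro!: add_increasing2 sum_nonneg)
    next
      case False
      then obtain b where b: "b \<in> Basis" "M = \<bar>\<xi> \<bullet> b\<bar>" using Min by auto
      have "M ^ N * cmod (fourier \<psi> \<xi>) \<le> C b" unfolding b(2) by (rule C[OF b(1)])
      also have "\<dots> \<le> (\<Sum>b\<in>(Basis::'a set). C b)" by (rule member_le_sum[OF b(1)]) (auto simp: nn)
      finally show ?thesis using nn by linarith
    qed
    finally show ?thesis
      unfolding B_def by (subst pos_le_divide_eq) (auto simp: add_pos_nonneg mult_left_mono mult.commute[of "cmod _"])
  qed
  moreover have "B \<ge> 0" using nn by (auto simp: B_def intro!: mult_nonneg_nonneg add_nonneg_nonneg sum_nonneg)
  ultimately show ?thesis using that by blast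
qed

lemma schwartz_fourier_measurable:
  assumes "schwartz \<psi>"
  shows "fourier \<psi> \<in> borel_measurable borel"
  by (rule fourier_measurable[OF borel_measurable_integrable[OF schwartz_integrable[OF assms]]])

lemma schwartz_fourier_integrable:
  assumes "schwartz \<psi>"
  shows "integrable lborel (fourier \<psi>)"
  using schwartz_fourier_decay[OF assms] decay_integrable[OF schwartz_fourier_measurable[OF assms]] by metis

lemma integral_affine:
  fixes f :: "'a::euclidean_space \<Rightarrow> complex"
  assumes [measurable]: "f \<in> borel_measurable borel" and h: "h \<noteq> 0"
  shows "(\<integral>y. f y \<partial>lborel) = \<bar>h\<bar> ^ DIM('a) *\<^sub>R (\<integral>z. f (t + h *\<^sub>R z) \<partial>lborel)"
  by (subst lborel_affine[OF h, of t]) (simp add: integral_density integral_distr)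

text \<open>Insert a Gaussian of width \<open>1 / h\<close>. By Fubini and a change of variable the integral becomes the average
of \<open>\<psi>(\<xi> + h z)\<close> over a fixed Gaussian in \<open>z\<close>; let \<open>h\<close> tend to \<open>0\<close> on both sides.\<close>

theorem fourier_inversion:
  fixes \<psi> :: "'a::euclidean_space \<Rightarrow> complex"
  assumes \<psi>: "schwartz \<psi>"
  shows "(\<integral>x. exp (\<i> * of_real (x \<bullet> \<xi>)) * fourier \<psi> x \<partial>lborel) = of_real ((2 * pi) ^ DIM('a)) * \<psi> \<xi>"
proof -
  note [measurable] = schwartz_measurable[OF \<psi>] schwartz_fourier_measurable[OF \<psi>]
  define h where "h n = 1 / real (Suc n)" for n
  have h: "0 < h n" for n by (auto simp: h_def)
  have h0: "h \<longlonglongrightarrow> 0" unfolding h_def by (rule LIMSEQ_Suc[OF lim_1_over_n])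
  define c where "c n = (\<lambda>_::'a. (h n)\<^sup>2)" for n
  have c: "0 < c n b" for n b using h[of n] by (simp add: c_def)
  define A where "A n = (\<integral>x. of_real (gauss (c n) x) * (exp (\<i> * of_real (x \<bullet> \<xi>)) * fourier \<psi> x) \<partial>lborel)" for n
  have fi: "integrable lborel (\<lambda>x. exp (\<i> * of_real (x \<bullet> \<xi>)) * fourier \<psi> x)"
    by (rule fourier_integrable[OF schwartz_fourier_integrable[OF \<psi>]])
  have lim1: "A \<longlonglongrightarrow> (\<integral>x. exp (\<i> * of_real (x \<bullet> \<xi>)) * fourier \<psi> x \<partial>lborel)"
    unfolding A_def
  proof (rule integral_dominated_convergence)
    show "integrable lborel (\<lambda>x. cmod (exp (\<i> * of_real (x \<bullet> \<xi>)) * fourier \<psi> x))"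
      using fi by (rule integrable_norm)
    show "AE x in lborel. (\<lambda>n. of_real (gauss (c n) x) * (exp (\<i> * of_real (x \<bullet> \<xi>)) * fourier \<psi> x)) \<longlonglongrightarrow> exp (\<i> * of_real (x \<bullet> \<xi>)) * fourier \<psi> x"
    proof (rule AE_I2)
      fix x
      have "(\<lambda>n. of_real (gauss (c n) x) * (exp (\<i> * of_real (x \<bullet> \<xi>)) * fourier \<psi> x)) \<longlonglongrightarrow> of_real 1 * (exp (\<i> * of_real (x \<bullet> \<xi>)) * fourier \<psi> x)"
        unfolding c_def by (rule tendsto_mult[OF tendsto_of_real[OF gauss_scaled_tendsto[OF h0]] tendsto_const])
      then show "(\<lambda>n. of_real (gauss (c n) x) * (exp (\<i> * of_real (x \<bullet> \<xi>)) * fourier \<psi> x)) \<longlonglongrightarrow> exp (\<i> * of_real (x \<bullet> \<xi>)) * fourier \<psi> x"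
        by simp
    qed
    show "AE x in lborel. norm (of_real (gauss (c n) x) * (exp (\<i> * of_real (x \<bullet> \<xi>)) * fourier \<psi> x)) \<le> cmod (exp (\<i> * of_real (x \<bullet> \<xi>)) * fourier \<psi> x)" for n
      by (intro AE_I2) (simp add: norm_mult gauss_nonneg gauss_le_1 c[THEN less_imp_le] mult_left_le_one_le)
  qed auto
  have A: "A n = (\<integral>z. \<psi> (\<xi> + h n *\<^sub>R z) * of_real (gauss_hat (\<lambda>_. 1) z) \<partial>lborel)" for n
  proof -
    define K where "K x y = of_real (gauss (c n) x) * (exp (\<i> * of_real (x \<bullet> (\<xi> - y))) * \<psi> y)" for x y
    have [measurable]: "case_prod K \<in> borel_measurable (lborel \<Otimes>\<^sub>M lborel)" unfolding K_def by measurable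
    have gi: "integrable lborel (\<lambda>y. complex_of_real (gauss (c n) y))"
      using gauss_integrable[of "c n"] c by simp
    have K: "integrable (lborel \<Otimes>\<^sub>M lborel) (case_prod K)"
      by (rule integrable_pair_bound[OF _ gi schwartz_integrable[OF \<psi>]]) (auto simp: K_def norm_mult)
    have "of_real (gauss (c n) x) * (exp (\<i> * of_real (x \<bullet> \<xi>)) * fourier \<psi> x) = (\<integral>y. K x y \<partial>lborel)" for x
      unfolding fourier_def K_def integral_mult_right_zero[symmetric]
      by (intro Bochner_Integration.integral_cong refl)
         (simp add: inner_diff_right right_diff_distrib exp_diff exp_minus inner_commute[of x] field_simps)
    then have "A n = (\<integral>x. (\<integral>y. K x y \<partial>lborel) \<partial>lborel)"
      unfolding A_def by simp
    also have "\<dots> = (\<integral>y. (\<integral>x. K x y \<partial>lborel) \<partial>lborel)"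
      by (rule lborel_pair.Fubini_integral[OF K, symmetric])
    also have "\<dots> = (\<integral>y. \<psi> y * of_real (gauss_hat (c n) (\<xi> - y)) \<partial>lborel)"
    proof (rule Bochner_Integration.integral_cong[OF refl])
      fix y
      have "(\<integral>x. K x y \<partial>lborel) = \<psi> y * (\<integral>x. exp (\<i> * of_real (x \<bullet> (\<xi> - y))) * of_real (gauss (c n) x) \<partial>lborel)"
        unfolding integral_mult_right_zero[symmetric] by (intro Bochner_Integration.integral_cong) (auto simp: K_def)
      then show "(\<integral>x. K x y \<partial>lborel) = \<psi> y * of_real (gauss_hat (c n) (\<xi> - y))"
        using gauss_fourier[of "c n" "\<xi> - y"] c by (simp add: has_bochner_integral_iff)
    qed
    also have "\<dots> = \<bar>h n\<bar> ^ DIM('a) *\<^sub>R (\<integral>z. \<psi> (\<xi> + h n *\<^sub>R z) * of_real (gauss_hat (c n) (\<xi> - (\<xi> + h n *\<^sub>R z))) \<partial>lborel)"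
      by (rule integral_affine) (use h[of n] in auto)
    also have "\<dots> = (\<integral>z. \<psi> (\<xi> + h n *\<^sub>R z) * of_real (h n ^ DIM('a) * gauss_hat (c n) (h n *\<^sub>R z)) \<partial>lborel)"
      unfolding integral_scaleR_right[symmetric] using h[of n]
      by (intro Bochner_Integration.integral_cong refl) (simp add: gauss_hat_minus scaleR_conv_of_real)
    finally show ?thesis unfolding c_def gauss_hat_scale[OF h] .
  qed
  obtain B where B: "\<And>x. cmod (\<psi> x) \<le> B / (1 + norm x) ^ 0" using schwartz_decay[OF \<psi>] by blast
  have lim2: "A \<longlonglongrightarrow> (\<integral>z. \<psi> \<xi> * of_real (gauss_hat (\<lambda>_::'a. 1) z) \<partial>lborel)"
    unfolding A
  proof (rule integral_dominated_convergence)
    show "integrable lborel (\<lambda>z::'a. B * gauss_hat (\<lambda>_. 1) z)"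
      using gauss_hat_integral by (intro integrable_mult_right) (auto simp: has_bochner_integral_iff)
    show "AE z in lborel. (\<lambda>n. \<psi> (\<xi> + h n *\<^sub>R z) * complex_of_real (gauss_hat (\<lambda>_. 1) z)) \<longlonglongrightarrow> \<psi> \<xi> * of_real (gauss_hat (\<lambda>_. 1) z)"
    proof (rule AE_I2, rule tendsto_mult[OF _ tendsto_const])
      fix z :: 'a
      have "isCont \<psi> \<xi>"
        using schwartz_differentiable[OF \<psi>] by (intro differentiable_imp_continuous_within) auto
      moreover have "(\<lambda>n. \<xi> + h n *\<^sub>R z) \<longlonglongrightarrow> \<xi> + 0 *\<^sub>R z"
        by (intro tendsto_intros h0)
      ultimately show "(\<lambda>n. \<psi> (\<xi> + h n *\<^sub>R z)) \<longlonglongrightarrow> \<psi> \<xi>"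
        by (intro isCont_tendsto_compose[of \<xi> \<psi>]) auto
    qed
    show "AE z in lborel. norm (\<psi> (\<xi> + h n *\<^sub>R z) * complex_of_real (gauss_hat (\<lambda>_. 1) z)) \<le> B * gauss_hat (\<lambda>_. 1) z" for n
      using B by (intro AE_I2) (auto simp: norm_mult gauss_hat_nonneg intro!: mult_right_mono)
  qed auto
  have "(\<integral>x. exp (\<i> * of_real (x \<bullet> \<xi>)) * fourier \<psi> x \<partial>lborel) = (\<integral>z. \<psi> \<xi> * of_real (gauss_hat (\<lambda>_::'a. 1) z) \<partial>lborel)"
    by (rule LIMSEQ_unique[OF lim1 lim2])
  also have "\<dots> = \<psi> \<xi> * of_real (\<integral>z. gauss_hat (\<lambda>_::'a. 1) z \<partial>lborel)"
    by (simp del: of_real_power)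
  also have "\<dots> = of_real ((2 * pi) ^ DIM('a)) * \<psi> \<xi>"
    using gauss_hat_integral[where 'a='a] by (simp add: has_bochner_integral_iff)
  finally show ?thesis .
qed

lemma fourier_pairing:
  fixes f \<psi> :: "'a::euclidean_space \<Rightarrow> complex"
  assumes f: "integrable lborel f" and \<psi>: "integrable lborel \<psi>"
  shows "(\<integral>x. f x * fourier \<psi> x \<partial>lborel) = (\<integral>\<xi>. fourier f \<xi> * \<psi> \<xi> \<partial>lborel)"
proof -
  have [measurable]: "f \<in> borel_measurable lborel" "\<psi> \<in> borel_measurable lborel"
    using f \<psi> by (auto intro: borel_measurable_integrable)
  define K where "K x \<xi> = exp (- \<i> * of_real (x \<bullet> \<xi>)) * (f x * \<psi> \<xi>)" for x \<xi>
  have K: "integrable (lborel \<Otimes>\<^sub>M lborel) (case_prod K)"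
    by (rule integrable_pair_bound[OF _ f \<psi>]) (unfold K_def, measurable, simp add: norm_mult)
  have "(\<integral>x. f x * fourier \<psi> x \<partial>lborel) = (\<integral>x. (\<integral>\<xi>. K x \<xi> \<partial>lborel) \<partial>lborel)"
    unfolding fourier_def integral_mult_right_zero[symmetric] K_def
    by (intro Bochner_Integration.integral_cong refl) (simp add: inner_commute mult_ac)
  also have "\<dots> = (\<integral>\<xi>. (\<integral>x. K x \<xi> \<partial>lborel) \<partial>lborel)"
    by (rule lborel_pair.Fubini_integral[OF K, symmetric])
  also have "\<dots> = (\<integral>\<xi>. fourier f \<xi> * \<psi> \<xi> \<partial>lborel)"
    unfolding fourier_def integral_mult_left_zero[symmetric] K_def
    by (intro Bochner_Integration.integral_cong refl) (simp add: mult_ac)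
  finally show ?thesis .
qed

text \<open>The inverse Fourier integral of integrable data, tested against the transform of a Schwartz function:
this identifies the multiplier images below.\<close>

lemma inverse_fourier_pairing:
  fixes G \<psi> :: "'a::euclidean_space \<Rightarrow> complex"
  assumes G: "integrable lborel G" and \<psi>: "schwartz \<psi>"
  shows "(\<integral>x. (\<integral>\<xi>. exp (\<i> * of_real (x \<bullet> \<xi>)) * G \<xi> \<partial>lborel) * fourier \<psi> x \<partial>lborel) = of_real ((2 * pi) ^ DIM('a)) * (\<integral>\<xi>. G \<xi> * \<psi> \<xi> \<partial>lborel)"
proof -
  have [measurable]: "G \<in> borel_measurable lborel" "fourier \<psi> \<in> borel_measurable lborel"
    using G schwartz_fourier_measurable[OF \<psi>] by (auto intro: borel_measurable_integrable)
  define K where "K x \<xi> = exp (\<i> * of_real (x \<bullet> \<xi>)) * (fourier \<psi> x * G \<xi>)" for x \<xi>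
  have K: "integrable (lborel \<Otimes>\<^sub>M lborel) (case_prod K)"
    by (rule integrable_pair_bound[OF _ schwartz_fourier_integrable[OF \<psi>] G]) (unfold K_def, measurable, simp add: norm_mult)
  have "(\<integral>x. (\<integral>\<xi>. exp (\<i> * of_real (x \<bullet> \<xi>)) * G \<xi> \<partial>lborel) * fourier \<psi> x \<partial>lborel) = (\<integral>x. (\<integral>\<xi>. K x \<xi> \<partial>lborel) \<partial>lborel)"
    unfolding integral_mult_left_zero[symmetric] K_def
    by (intro Bochner_Integration.integral_cong refl) (simp add: mult_ac)
  also have "\<dots> = (\<integral>\<xi>. (\<integral>x. K x \<xi> \<partial>lborel) \<partial>lborel)"
    by (rule lborel_pair.Fubini_integral[OF K, symmetric])
  also have "\<dots> = (\<integral>\<xi>. of_real ((2 * pi) ^ DIM('a)) * (G \<xi> * \<psi> \<xi>) \<partial>lborel)"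
  proof (rule Bochner_Integration.integral_cong[OF refl])
    fix \<xi>
    have "(\<integral>x. K x \<xi> \<partial>lborel) = (\<integral>x. exp (\<i> * of_real (x \<bullet> \<xi>)) * fourier \<psi> x \<partial>lborel) * G \<xi>"
      unfolding integral_mult_left_zero[symmetric] K_def by (intro Bochner_Integration.integral_cong refl) (simp add: mult_ac)
    then show "(\<integral>x. K x \<xi> \<partial>lborel) = of_real ((2 * pi) ^ DIM('a)) * (G \<xi> * \<psi> \<xi>)"
      unfolding fourier_inversion[OF \<psi>] by (simp only: mult_ac)
  qed
  also have "\<dots> = of_real ((2 * pi) ^ DIM('a)) * (\<integral>\<xi>. G \<xi> * \<psi> \<xi> \<partial>lborel)"
    by (rule integral_mult_right_zero)
  finally show ?thesis .
qed

text \<open>Stated for any rapidly decreasing function, since it is applied both to Schwartz functions and to their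
transforms, which are only known to decrease rapidly.\<close>

lemma decay_weighted_L2:
  fixes g :: "'a::euclidean_space \<Rightarrow> complex"
  assumes dec: "\<And>N. \<exists>B\<ge>0. \<forall>x. cmod (g x) \<le> B / (1 + norm x) ^ N" and p: "0 \<le> p"
  shows "(\<integral>\<^sup>+x. ennreal ((norm x powr p * cmod (g x))\<^sup>2) \<partial>lborel) < \<infinity>"
proof -
  define k where "k = nat \<lceil>p\<rceil>"
  have k: "p \<le> real k" unfolding k_def by (rule real_nat_ceiling_ge)
  obtain B where B: "0 \<le> B" "\<And>x. cmod (g x) \<le> B / (1 + norm x) ^ (k + DIM('a))" using dec by blast
  have "(\<integral>\<^sup>+x. ennreal ((norm x powr p * cmod (g x))\<^sup>2) \<partial>lborel) \<le> (\<integral>\<^sup>+x. ennreal (norm (B\<^sup>2 * (1 / (1 + norm (x::'a)) ^ (2 * DIM('a))))) \<partial>lborel)"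
  proof (intro nn_integral_mono ennreal_leI)
    fix x :: 'a
    have "norm x powr p \<le> (1 + norm x) powr p" using p by (intro powr_mono2) auto
    also have "\<dots> \<le> (1 + norm x) powr real k" using k by (intro powr_mono) auto
    also have "\<dots> = (1 + norm x) ^ k" by (rule powr_realpow) (simp add: add_pos_nonneg)
    finally have "norm x powr p * cmod (g x) \<le> (1 + norm x) ^ k * (B / (1 + norm x) ^ (k + DIM('a)))"
      using B by (intro mult_mono) auto
    also have "\<dots> = B / (1 + norm x) ^ DIM('a)"
    proof -
      have "(1 + norm x) ^ k \<noteq> 0" by (simp add: add_pos_nonneg less_imp_neq[symmetric])
      then show ?thesis by (simp add: power_add)
    qed
    finally have "(norm x powr p * cmod (g x))\<^sup>2 \<le> (B / (1 + norm x) ^ DIM('a))\<^sup>2"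
      by (intro power_mono) auto
    also have "\<dots> = B\<^sup>2 * (1 / (1 + norm x) ^ (2 * DIM('a)))"
      by (simp add: power_divide power_mult[symmetric] mult.commute)
    finally show "(norm x powr p * cmod (g x))\<^sup>2 \<le> norm (B\<^sup>2 * (1 / (1 + norm x) ^ (2 * DIM('a))))"
      by simp
  qed
  also have "\<dots> < \<infinity>"
    using integrable_mult_right[OF integrable_decay, of "B\<^sup>2"] unfolding integrable_iff_bounded by blast
  finally show ?thesis .
qed

lemma schwartz_weighted_L2:
  fixes \<psi> :: "'a::euclidean_space \<Rightarrow> complex"
  assumes \<psi>: "schwartz \<psi>" and p: "0 \<le> p"
  shows "(\<integral>\<^sup>+x. ennreal ((norm x powr p * cmod (\<psi> x))\<^sup>2) \<partial>lborel) < \<infinity>"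
    "(\<integral>\<^sup>+x. ennreal ((norm x powr p * cmod (fourier \<psi> x))\<^sup>2) \<partial>lborel) < \<infinity>"
  by (rule decay_weighted_L2[OF _ p], meson schwartz_decay[OF \<psi>] schwartz_fourier_decay[OF \<psi>])+

lemma schwartz_L2:
  fixes \<psi> :: "'a::euclidean_space \<Rightarrow> complex"
  assumes \<psi>: "schwartz \<psi>"
  shows "L2_sq lborel \<psi> < \<infinity>" "L2_sq lborel (fourier \<psi>) < \<infinity>"
proof -
  have "L2_sq lborel f = (\<integral>\<^sup>+x. ennreal ((norm x powr 0 * cmod (f x))\<^sup>2) \<partial>lborel)" for f :: "'a \<Rightarrow> complex"
    using AE_norm_pos by (intro nn_integral_cong_AE, eventually_elim) simp
  then show "L2_sq lborel \<psi> < \<infinity>" "L2_sq lborel (fourier \<psi>) < \<infinity>"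
    using schwartz_weighted_L2[OF \<psi>, of 0] by simp_all
qed

section \<open>The Fourier transform of a square integrable function\<close>

text \<open>The Schur test with amplitude \<open>1\<close>: the kernel has mass \<open>(2 * pi) ^ DIM('a)\<close> whatever the width of the
Gaussian, and Fatou's lemma removes the Gaussian.\<close>

lemma plancherel_le:
  fixes f :: "'a::euclidean_space \<Rightarrow> complex"
  assumes [measurable]: "f \<in> borel_measurable borel" and f: "integrable lborel f"
  shows "L2_sq lborel (fourier f) \<le> ennreal ((2 * pi) ^ DIM('a)) * L2_sq lborel f"
proof -
  define h where "h n = 1 / real (Suc n)" for n
  have h: "0 < h n" for n by (auto simp: h_def)
  have h0: "h \<longlonglongrightarrow> 0" unfolding h_def by (rule LIMSEQ_Suc[OF lim_1_over_n])
  define c where "c n = (\<lambda>_::'a. (h n)\<^sup>2)" for n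
  have c: "0 < c n b" for n b using h[of n] by (simp add: c_def)
  have [measurable]: "fourier f \<in> borel_measurable borel" by (rule fourier_measurable) simp
  have F: "fourier f y = (\<integral>x. exp (\<i> * of_real (y \<bullet> - x)) * (of_real 1 * f x) \<partial>lborel)" for y
    unfolding fourier_def by (intro Bochner_Integration.integral_cong refl) (simp add: inner_commute)
  have le: "(\<integral>\<^sup>+y. ennreal (gauss (c n) y * (cmod (fourier f y))\<^sup>2) \<partial>lborel) \<le> ennreal ((2 * pi) ^ DIM('a)) * L2_sq lborel f" for n
  proof -
    have "(\<integral>\<^sup>+y. ennreal (gauss (c n) y * (cmod (fourier f y))\<^sup>2) \<partial>lborel)
      \<le> (\<integral>\<^sup>+x. ennreal ((cmod (f x))\<^sup>2) * (\<integral>\<^sup>+y. ennreal (1\<^sup>2 * gauss_hat (c n) (- x - - y)) \<partial>lborel) \<partial>lborel)"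
      unfolding F by (rule gaussian_schur[where p=uminus and v="\<lambda>_. 1"]) (use c f in auto)
    also have "\<dots> = (\<integral>\<^sup>+x. ennreal ((cmod (f x))\<^sup>2) * ennreal ((2 * pi) ^ DIM('a)) \<partial>lborel)"
    proof (intro nn_integral_cong arg_cong2[where f="(*)"] refl)
      fix x :: 'a
      have "gauss_hat (c n) (- x - - y) = gauss_hat (c n) (x - y)" for y
        using gauss_hat_minus[of "c n" "x - y"] by (simp add: algebra_simps)
      then show "(\<integral>\<^sup>+y. ennreal (1\<^sup>2 * gauss_hat (c n) (- x - - y)) \<partial>lborel) = ennreal ((2 * pi) ^ DIM('a))"
        using nn_integral_gauss_hat[of "c n" x] c by simp
    qed
    also have "\<dots> = ennreal ((2 * pi) ^ DIM('a)) * L2_sq lborel f"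
      by (subst nn_integral_multc) (auto simp: mult.commute)
    finally show ?thesis .
  qed
  have "L2_sq lborel (fourier f) = (\<integral>\<^sup>+y. liminf (\<lambda>n. ennreal (gauss (c n) y * (cmod (fourier f y))\<^sup>2)) \<partial>lborel)"
  proof (rule nn_integral_cong)
    fix y :: 'a
    have "(\<lambda>n. ennreal (gauss (c n) y * (cmod (fourier f y))\<^sup>2)) \<longlonglongrightarrow> ennreal (1 * (cmod (fourier f y))\<^sup>2)"
      unfolding c_def by (intro tendsto_ennrealI tendsto_mult gauss_scaled_tendsto[OF h0] tendsto_const)
    then show "ennreal ((cmod (fourier f y))\<^sup>2) = liminf (\<lambda>n. ennreal (gauss (c n) y * (cmod (fourier f y))\<^sup>2))"
      by (intro lim_imp_Liminf[symmetric]) auto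
  qed
  also have "\<dots> \<le> liminf (\<lambda>n. \<integral>\<^sup>+y. ennreal (gauss (c n) y * (cmod (fourier f y))\<^sup>2) \<partial>lborel)"
    by (rule nn_integral_liminf) measurable
  also have "\<dots> \<le> ennreal ((2 * pi) ^ DIM('a)) * L2_sq lborel f"
    by (rule Liminf_le) (use le in \<open>auto intro!: always_eventually\<close>)
  finally show ?thesis .
qed

lemma L2_tempered:
  fixes f :: "'a::euclidean_space \<Rightarrow> complex"
  assumes f[measurable]: "f \<in> borel_measurable borel" and L2: "L2_sq lborel f < \<infinity>"
  shows "tempered f"
  unfolding tempered_def
  by (intro conjI allI impI L2_mult_integrable) (use schwartz_measurable schwartz_L2 L2 in auto)

text \<open>The transforms of the truncations of \<open>\<phi>\<close> to balls form a Cauchy sequence by \<open>plancherel_le\<close>, and the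
defining identity of the distributional transform survives the limit on both sides. The factor \<open>4\<close> comes from
estimating the limit \<open>g\<close> through \<open>(g - G 0) + G 0\<close>.\<close>

theorem L2_fourier_exists:
  fixes \<phi> :: "'a::euclidean_space \<Rightarrow> complex"
  assumes \<phi>m[measurable]: "\<phi> \<in> borel_measurable borel" and L2: "L2_sq lborel \<phi> < \<infinity>"
  obtains g where "g \<in> borel_measurable borel" "has_fourier_transform \<phi> g"
    "L2_sq lborel g \<le> ennreal (4 * (2 * pi) ^ DIM('a)) * L2_sq lborel \<phi>"
proof -
  define Q where "Q = L2_sq lborel \<phi>"
  define c where "c = (2 * pi) ^ DIM('a)"
  have c: "0 < c" by (simp add: c_def)
  define A where "A k = cball (0::'a) (real k)" for k
  have [measurable]: "A k \<in> sets borel" for k by (simp add: A_def)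
  define \<Phi> where "\<Phi> k x = \<phi> x * indicator (A k) x" for k x
  have [measurable]: "\<Phi> k \<in> borel_measurable borel" for k unfolding \<Phi>_def by measurable
  define G where "G k = fourier (\<Phi> k)" for k
  have \<Phi>i: "integrable lborel (\<Phi> k)" for k
    unfolding \<Phi>_def by (rule L2_bounded_set_integrable[OF \<phi>m _ L2]) (auto simp: A_def)
  have [measurable]: "G k \<in> borel_measurable borel" for k unfolding G_def by (rule fourier_measurable) simp
  define e where "e k = (\<integral>\<^sup>+x. ennreal ((cmod (\<phi> x))\<^sup>2) * indicator (- A k) x \<partial>lborel)" for k
  have e0: "e \<longlonglongrightarrow> 0" unfolding e_def
  proof (rule tail_tendsto_0)
    show "incseq A" by (auto simp: incseq_def A_def)
    show "(\<Union>n. A n) = UNIV" by (auto simp: A_def real_arch_simple)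
  qed (use L2 in auto)
  have eQ: "e k \<le> Q" for k unfolding e_def Q_def by (intro nn_integral_mono) (auto simp: indicator_def)
  have Q: "Q < \<infinity>" using L2 by (simp add: Q_def)
  have tail: "L2_sq lborel (\<lambda>x. \<Phi> l x - \<Phi> k x) \<le> e k" if "k \<le> l" for k l
    unfolding e_def \<Phi>_def using that by (intro nn_integral_mono) (auto simp: indicator_def A_def)
  have tail2: "L2_sq lborel (\<lambda>x. \<Phi> k x - \<phi> x) \<le> e k" for k
    unfolding e_def \<Phi>_def by (intro nn_integral_mono) (auto simp: indicator_def)
  have cauchy: "L2_sq lborel (\<lambda>y. G l y - G k y) \<le> ennreal c * e k" if "k \<le> l" for k l
  proof -
    have "G l y - G k y = fourier (\<lambda>x. \<Phi> l x - \<Phi> k x) y" for y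
      unfolding G_def fourier_def
      by (subst Bochner_Integration.integral_diff[symmetric]) (use fourier_integrable(2)[OF \<Phi>i] in \<open>auto simp: algebra_simps\<close>)
    then have "L2_sq lborel (\<lambda>y. G l y - G k y) \<le> ennreal c * L2_sq lborel (\<lambda>x. \<Phi> l x - \<Phi> k x)"
      using plancherel_le[of "\<lambda>x. \<Phi> l x - \<Phi> k x"] \<Phi>i by (simp add: c_def)
    also have "\<dots> \<le> ennreal c * e k" by (intro mult_left_mono tail that) auto
    finally show ?thesis .
  qed
  have ce0: "(\<lambda>k. ennreal c * e k) \<longlonglongrightarrow> 0"
    using ennreal_tendsto_cmult[OF _ e0, of "ennreal c"] by simp
  obtain g where [measurable]: "g \<in> borel_measurable lborel" and g: "\<And>k. L2_sq lborel (\<lambda>y. g y - G k y) \<le> ennreal c * e k"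
    using L2_complete[of G lborel "\<lambda>k. ennreal c * e k"] cauchy ce0 by auto
  have gm[measurable]: "g \<in> borel_measurable borel" using \<open>g \<in> borel_measurable lborel\<close> by simp
  have bound: "L2_sq lborel g \<le> ennreal (4 * c) * Q"
  proof -
    have "L2_sq lborel (G 0) \<le> ennreal c * L2_sq lborel (\<Phi> 0)"
      unfolding G_def c_def by (rule plancherel_le[OF _ \<Phi>i]) measurable
    also have "\<dots> \<le> ennreal c * Q"
      unfolding Q_def \<Phi>_def by (intro mult_left_mono nn_integral_mono) (auto simp: indicator_def)
    finally have G0: "L2_sq lborel (G 0) \<le> ennreal c * Q" .
    have g0: "L2_sq lborel (\<lambda>y. g y - G 0 y) \<le> ennreal c * Q"
      using g[of 0] mult_left_mono[OF eQ[of 0], of "ennreal c"] by (auto intro: order.trans)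
    have "L2_sq lborel g \<le> 2 * (ennreal c * Q) + 2 * (ennreal c * Q)"
      by (rule order.trans[OF L2_sum_le[of g lborel "G 0"]]) (auto intro!: add_mono mult_left_mono g0 G0)
    also have "\<dots> = ennreal (4 * c) * Q"
      using c by (simp add: ennreal_mult mult.assoc distrib_right[symmetric])
    finally show ?thesis .
  qed
  have gL2: "L2_sq lborel g < \<infinity>"
    using bound Q by (auto intro!: le_less_trans[OF bound] simp: ennreal_mult_less_top)
  have "has_fourier_transform \<phi> g"
    unfolding has_fourier_transform_def
  proof (intro conjI allI impI L2_tempered \<phi>m L2 gm gL2)
    fix \<psi> :: "'a \<Rightarrow> complex" assume \<psi>: "schwartz \<psi>"
    note [measurable] = schwartz_measurable[OF \<psi>] schwartz_fourier_measurable[OF \<psi>]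
    have l1: "(\<lambda>k. \<integral>x. \<Phi> k x * fourier \<psi> x \<partial>lborel) \<longlonglongrightarrow> (\<integral>x. \<phi> x * fourier \<psi> x \<partial>lborel)"
    proof (rule weighted_pairing_tendsto(2)[where W="\<lambda>_. 1" and D=e])
      show "integrable lborel (\<lambda>x. \<Phi> k x * fourier \<psi> x)" for k
      proof (rule L2_mult_integrable)
        have "L2_sq lborel (\<Phi> k) \<le> Q"
          unfolding Q_def \<Phi>_def by (intro nn_integral_mono) (auto simp: indicator_def)
        then show "L2_sq lborel (\<Phi> k) < \<infinity>" using Q by (rule le_less_trans)
      qed (use schwartz_L2[OF \<psi>] in auto)
      show "e n < \<infinity>" for n using eQ Q by (rule le_less_trans)
    qed (use schwartz_L2[OF \<psi>] e0 tail2 in auto)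
    have l2: "(\<lambda>k. \<integral>x. G k x * \<psi> x \<partial>lborel) \<longlonglongrightarrow> (\<integral>x. g x * \<psi> x \<partial>lborel)"
    proof (rule weighted_pairing_tendsto(2)[where W="\<lambda>_. 1" and D="\<lambda>k. ennreal c * e k"])
      show "integrable lborel (\<lambda>x. G k x * \<psi> x)" for k
      proof (rule L2_mult_integrable)
        have "L2_sq lborel (G k) \<le> ennreal c * L2_sq lborel (\<Phi> k)"
          unfolding G_def c_def by (rule plancherel_le[OF _ \<Phi>i]) measurable
        also have "\<dots> \<le> ennreal c * Q"
          unfolding Q_def \<Phi>_def by (intro mult_left_mono nn_integral_mono) (auto simp: indicator_def)
        also have "\<dots> < \<infinity>" using Q by (simp add: ennreal_mult_less_top)
        finally show "L2_sq lborel (G k) < \<infinity>" .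
      qed (use schwartz_L2[OF \<psi>] in auto)
      show "ennreal c * e n < \<infinity>" for n using le_less_trans[OF eQ Q] by (simp add: ennreal_mult_less_top)
      show "(\<integral>\<^sup>+x. ennreal ((1 * cmod (G n x - g x))\<^sup>2) \<partial>lborel) \<le> ennreal c * e n" for n
        using g[of n] by (simp add: norm_minus_commute)
    qed (use schwartz_L2[OF \<psi>] ce0 in auto)
    have "(\<integral>x. \<Phi> k x * fourier \<psi> x \<partial>lborel) = (\<integral>x. G k x * \<psi> x \<partial>lborel)" for k
      unfolding G_def by (rule fourier_pairing[OF \<Phi>i schwartz_integrable[OF \<psi>]])
    then show "(\<integral>x. \<phi> x * fourier \<psi> x \<partial>lborel) = (\<integral>\<xi>. g \<xi> * \<psi> \<xi> \<partial>lborel)"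
      using LIMSEQ_unique[OF l1] l2 by simp
  qed
  then show ?thesis using that[of g] gm bound by (simp add: c_def Q_def)
qed

section \<open>The radial kernel estimate\<close>

lemma nn_integral_exhaust_le:
  assumes [measurable]: "F \<in> borel_measurable M" "\<And>k. A k \<in> sets M" and inc: "incseq A"
    and le: "\<And>k::nat. (\<integral>\<^sup>+x. F x * indicator (A k) x \<partial>M) \<le> B"
  shows "(\<integral>\<^sup>+x. F x * indicator (\<Union>k. A k) x \<partial>M) \<le> B"
proof -
  have "(\<integral>\<^sup>+x. F x * indicator (\<Union>k. A k) x \<partial>M) = emeasure (density M F) (\<Union>k. A k)"
    by (subst emeasure_density) auto
  also have "\<dots> = (SUP k. emeasure (density M F) (A k))"
    by (rule SUP_emeasure_incseq[symmetric]) (use inc in auto)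
  also have "\<dots> = (SUP k. \<integral>\<^sup>+x. F x * indicator (A k) x \<partial>M)"
    by (simp add: emeasure_density)
  also have "\<dots> \<le> B" by (rule SUP_least) (rule le)
  finally show ?thesis .
qed

text \<open>The substitution \<open>l = (A + t\<^sup>2)\<^sup>m\<^sup>/\<^sup>2\<close>. It is made on compact subintervals of the half-line, because for
\<open>A = 0\<close> its derivative may be singular at \<open>0\<close>.\<close>

lemma radial_substitution_le:
  fixes \<Psi> :: "real \<Rightarrow> ennreal"
  assumes [measurable]: "\<Psi> \<in> borel_measurable borel" and A: "0 \<le> A" and m: "0 < m"
  shows "(\<integral>\<^sup>+t. \<Psi> ((A + t\<^sup>2) powr (m / 2)) * ennreal (m * (A + t\<^sup>2) powr (m / 2 - 1) * t) * indicator {0<..} t \<partial>lborel)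
     \<le> (\<integral>\<^sup>+l. \<Psi> l * indicator {0<..} l \<partial>lborel)"
proof -
  define g where "g t = (A + t\<^sup>2) powr (m / 2)" for t
  define g' where "g' t = m * (A + t\<^sup>2) powr (m / 2 - 1) * t" for t
  define I where "I k = {1 / real (Suc k)..real (Suc (Suc k))}" for k
  have pos: "0 < A + t\<^sup>2" if "0 < t" for t using A that by (simp add: add_nonneg_pos)
  have Ipos: "0 < t" if "t \<in> I k" for t k
    using that by (auto simp: I_def intro: less_le_trans[rotated])
  have U: "(\<Union>k. I k) = {0<..}"
  proof (intro equalityI subsetI)
    fix t :: real assume "t \<in> {0<..}"
    then have t: "0 < t" by simp
    obtain k where k: "1 / t < real k" "t < real k"
      using reals_Archimedean2[of "max (1 / t) t"] by auto
    then have "1 / real (Suc k) \<le> t" using t by (simp add: field_simps)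
    then show "t \<in> (\<Union>k. I k)" using k by (auto simp: I_def intro!: exI[of _ k])
  qed (use Ipos in auto)
  have "(\<integral>\<^sup>+t. \<Psi> (g t) * ennreal (g' t) * indicator (I k) t \<partial>lborel) \<le> (\<integral>\<^sup>+l. \<Psi> l * indicator {0<..} l \<partial>lborel)" for k
  proof -
    have "(\<integral>\<^sup>+t. (\<Psi> (g t) * indicator {0<..} (g t)) * ennreal (g' t) * indicator (I k) t \<partial>lborel)
       = (\<integral>\<^sup>+l. (\<Psi> l * indicator {0<..} l) * indicator {g (1 / real (Suc k))..g (real (Suc (Suc k)))} l \<partial>lborel)"
      unfolding I_def
    proof (rule nn_integral_substitution_aux[symmetric])
      fix t assume "t \<in> {1 / real (Suc k)..real (Suc (Suc k))}"
      then have t: "0 < t" using Ipos[of t k] by (simp add: I_def)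
      show "(g has_real_derivative g' t) (at t)"
        unfolding g_def g'_def using pos[OF t]
        by (auto intro!: derivative_eq_intros simp: powr_diff field_simps)
      show "0 \<le> g' t" using t m by (simp add: g'_def)
    next
      show "continuous_on {1 / real (Suc k)..real (Suc (Suc k))} g'"
        unfolding g'_def using pos Ipos[unfolded I_def]
        by (intro continuous_intros) (metis less_irrefl)+
      have "1 / real (Suc k) \<le> 1" by simp
      also have "1 < real (Suc (Suc k))" by simp
      finally show "1 / real (Suc k) < real (Suc (Suc k))" .
    qed auto
    also have "\<dots> \<le> (\<integral>\<^sup>+l. \<Psi> l * indicator {0<..} l \<partial>lborel)"
      by (intro nn_integral_mono) (auto simp: indicator_def)
    also have "(\<integral>\<^sup>+t. (\<Psi> (g t) * indicator {0<..} (g t)) * ennreal (g' t) * indicator (I k) t \<partial>lborel)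
       = (\<integral>\<^sup>+t. \<Psi> (g t) * ennreal (g' t) * indicator (I k) t \<partial>lborel)"
    proof (intro nn_integral_cong)
      fix t
      have "A + t\<^sup>2 \<noteq> 0" if "t \<in> I k" using pos[OF Ipos[OF that]] by linarith
      then show "(\<Psi> (g t) * indicator {0<..} (g t)) * ennreal (g' t) * indicator (I k) t = \<Psi> (g t) * ennreal (g' t) * indicator (I k) t"
        by (auto simp: indicator_def g_def)
    qed
    finally show ?thesis .
  qed
  then have "(\<integral>\<^sup>+t. \<Psi> (g t) * ennreal (g' t) * indicator (\<Union>k. I k) t \<partial>lborel) \<le> (\<integral>\<^sup>+l. \<Psi> l * indicator {0<..} l \<partial>lborel)"
  proof (rule nn_integral_exhaust_le[rotated 3])
    show "incseq I"
      unfolding I_def by (intro monoI) (auto simp: atLeastatMost_subset_iff intro!: divide_left_mono)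
  qed (auto simp: g_def g'_def I_def)
  then show ?thesis by (simp add: U g_def g'_def)
qed

text \<open>Here \<open>t\<close> is the largest of the \<open>N = card I + 1\<close> coordinates, so \<open>|y|\<^sup>2 + t\<^sup>2 \<le> N t\<^sup>2\<close>, and this bounds the
Jacobian of \<open>l = (|y|\<^sup>2 + t\<^sup>2)\<^sup>m\<^sup>/\<^sup>2\<close> from below; hence the factor \<open>sqrt N / m\<close>. The factor \<open>2\<close> accounts for both signs of
\<open>t\<close>. On the right the condition \<open>|y\<^sub>i| \<le> |t|\<close> has been relaxed to \<open>|y\<^sub>i| \<le> l\<^sup>1\<^sup>/\<^sup>m\<close>, which no longer involves \<open>t\<close>.\<close>

lemma chart_substitution_le:
  fixes \<Phi> :: "real \<Rightarrow> ennreal" and y :: "'i \<Rightarrow> real"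
  assumes [measurable]: "\<Phi> \<in> borel_measurable borel" and I: "finite I" and m: "0 < m"
  shows "(\<integral>\<^sup>+t. \<Phi> (((\<Sum>i\<in>I. (y i)\<^sup>2) + t\<^sup>2) powr (m / 2)) * ennreal (((\<Sum>i\<in>I. (y i)\<^sup>2) + t\<^sup>2) powr (m / 2 - s))
            * (\<Prod>i\<in>I. indicator {-\<bar>t\<bar>..\<bar>t\<bar>} (y i)) \<partial>lborel)
     \<le> ennreal (2 * sqrt (card I + 1) / m) *
        (\<integral>\<^sup>+l. \<Phi> l * ennreal (l powr ((1 - 2 * s) / m)) * (\<Prod>i\<in>I. indicator {-(l powr (1 / m))..l powr (1 / m)} (y i)) * indicator {0<..} l \<partial>lborel)"
proof -
  define A where "A = (\<Sum>i\<in>I. (y i)\<^sup>2)"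
  define N where "N = real (card I + 1)"
  have A: "0 \<le> A" unfolding A_def by (intro sum_nonneg) auto
  have N: "0 < N" by (simp add: N_def)
  \<comment> \<open>As a function of the radius the product of indicators is the indicator of a closed half-line.\<close>
  define P where "P r = (\<Prod>i\<in>I. indicator {-r..r} (y i) :: ennreal)" for r
  have P: "P r = indicator {r. \<forall>i\<in>I. \<bar>y i\<bar> \<le> r} r" for r
    using I by (auto simp: P_def indicator_def prod_zero_iff abs_le_iff minus_le_iff)
  have [measurable]: "P \<in> borel_measurable borel"
  proof -
    have "P = (\<lambda>r. \<Prod>i\<in>I. indicator {r. \<bar>y i\<bar> \<le> r} r)"
      unfolding P_def by (auto simp: indicator_def abs_le_iff minus_le_iff intro!: prod.cong)
    then show ?thesis by simp
  qed
  define \<Psi> where "\<Psi> l = \<Phi> l * ennreal (l powr ((1 - 2 * s) / m)) * P (l powr (1 / m))" for l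
  have [measurable]: "\<Psi> \<in> borel_measurable borel" unfolding \<Psi>_def by measurable
  let ?L = "\<lambda>t. \<Phi> ((A + t\<^sup>2) powr (m / 2)) * ennreal ((A + t\<^sup>2) powr (m / 2 - s)) * P \<bar>t\<bar>"
  have even: "(\<integral>\<^sup>+t. ?L t \<partial>lborel) = 2 * (\<integral>\<^sup>+t. ?L t * indicator {0<..} t \<partial>lborel)"
    by (rule nn_integral_even) auto
  have "(\<integral>\<^sup>+t. ?L t * indicator {0<..} t \<partial>lborel) \<le> (\<integral>\<^sup>+t. ennreal (sqrt N / m) * (\<Psi> ((A + t\<^sup>2) powr (m / 2)) * ennreal (m * (A + t\<^sup>2) powr (m / 2 - 1) * t) * indicator {0<..} t) \<partial>lborel)"
  proof (rule nn_integral_mono)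
    fix t :: real
    show "?L t * indicator {0<..} t \<le> ennreal (sqrt N / m) * (\<Psi> ((A + t\<^sup>2) powr (m / 2)) * ennreal (m * (A + t\<^sup>2) powr (m / 2 - 1) * t) * indicator {0<..} t)"
    proof (cases "0 < t \<and> (\<forall>i\<in>I. \<bar>y i\<bar> \<le> t)")
      case False
      then show ?thesis by (auto simp: P indicator_def)
    next
      case True
      then have t: "0 < t" by simp
      define R where "R = A + t\<^sup>2"
      have R: "0 < R" using A t by (simp add: R_def add_nonneg_pos)
      have tR: "t\<^sup>2 \<le> R" using A by (simp add: R_def)
      have "A \<le> (\<Sum>i\<in>I. t\<^sup>2)"
        unfolding A_def using True by (intro sum_mono) (metis abs_ge_zero abs_of_pos abs_le_square_iff)
      then have RN: "R \<le> N * t\<^sup>2" by (simp add: R_def N_def algebra_simps)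
      have r: "(R powr (m / 2)) powr (1 / m) = sqrt R"
        using m R by (simp add: powr_powr powr_half_sqrt)
      have "t \<le> sqrt R" using tR t by (simp add: real_le_rsqrt)
      then have P1: "P t = 1" "P (sqrt R) = 1" using True by (force simp: P indicator_def)+
      have "sqrt R \<le> sqrt N * t" using RN t N real_sqrt_le_mono[OF RN] by (simp add: real_sqrt_mult)
      then have "1 \<le> sqrt N * t / sqrt R" using R by simp
      then have "R powr (m / 2 - s) \<le> R powr (m / 2 - s) * (sqrt N * t / sqrt R)"
        using mult_left_mono[of 1 "sqrt N * t / sqrt R" "R powr (m / 2 - s)"] by simp
      also have "\<dots> = sqrt N / m * ((R powr (m / 2)) powr ((1 - 2 * s) / m) * (m * R powr (m / 2 - 1) * t))"
      proof -
        have e: "(R powr (m / 2)) powr ((1 - 2 * s) / m) = R powr ((1 - 2 * s) / 2)"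
          using m by (simp add: powr_powr)
        have "R powr ((1 - 2 * s) / 2) * R powr (m / 2 - 1) = R powr (m / 2 - s - 1 / 2)"
          by (simp add: powr_add[symmetric] field_simps)
        also have "\<dots> = R powr (m / 2 - s) / sqrt R"
          using R by (simp add: powr_diff powr_half_sqrt)
        finally show ?thesis unfolding e using m by (simp add: field_simps)
      qed
      finally have le: "R powr (m / 2 - s) \<le> sqrt N / m * ((R powr (m / 2)) powr ((1 - 2 * s) / m) * (m * R powr (m / 2 - 1) * t))" .
      have "?L t * indicator {0<..} t = \<Phi> (R powr (m / 2)) * ennreal (R powr (m / 2 - s))"
        using t by (simp add: P1 R_def)
      also have "\<dots> \<le> \<Phi> (R powr (m / 2)) * ennreal (sqrt N / m * ((R powr (m / 2)) powr ((1 - 2 * s) / m) * (m * R powr (m / 2 - 1) * t)))"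
        by (intro mult_left_mono ennreal_leI le) auto
      also have "\<dots> = ennreal (sqrt N / m) * (\<Psi> (R powr (m / 2)) * ennreal (m * R powr (m / 2 - 1) * t) * indicator {0<..} t)"
      proof -
        define d where "d = m * R powr (m / 2 - 1) * t"
        have "0 \<le> d" using t m by (simp add: d_def)
        then have "ennreal (sqrt N / m * ((R powr (m / 2)) powr ((1 - 2 * s) / m) * d)) = ennreal (sqrt N / m) * (ennreal ((R powr (m / 2)) powr ((1 - 2 * s) / m)) * ennreal d)"
          using m N by (subst ennreal_mult, simp, simp, subst ennreal_mult, simp_all)
        then show ?thesis unfolding d_def[symmetric] using t by (simp add: \<Psi>_def r P1 mult_ac)
      qed
      finally show ?thesis unfolding R_def .
    qed
  qed
  also have "\<dots> = ennreal (sqrt N / m) * (\<integral>\<^sup>+t. \<Psi> ((A + t\<^sup>2) powr (m / 2)) * ennreal (m * (A + t\<^sup>2) powr (m / 2 - 1) * t) * indicator {0<..} t \<partial>lborel)"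
    by (rule nn_integral_cmult) measurable
  also have "\<dots> \<le> ennreal (sqrt N / m) * (\<integral>\<^sup>+l. \<Psi> l * indicator {0<..} l \<partial>lborel)"
    by (rule mult_left_mono[OF radial_substitution_le[OF _ A m]]) auto
  finally have "(\<integral>\<^sup>+t. ?L t \<partial>lborel) \<le> 2 * (ennreal (sqrt N / m) * (\<integral>\<^sup>+l. \<Psi> l * indicator {0<..} l \<partial>lborel))"
    unfolding even by (rule mult_left_mono) simp
  also have "\<dots> = ennreal (2 * sqrt N / m) * (\<integral>\<^sup>+l. \<Psi> l * indicator {0<..} l \<partial>lborel)"
  proof -
    have "ennreal (2 * sqrt N / m) = 2 * ennreal (sqrt N / m)"
      using m N by (simp add: ennreal_mult[symmetric] flip: ennreal_numeral times_divide_eq_right)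
    then show ?thesis by (simp add: mult.assoc)
  qed
  finally show ?thesis by (simp add: A_def P_def \<Psi>_def N_def)
qed

text \<open>Split at \<open>\<tau> = r\<^sup>2\<close>, where the two entries of the minimum are comparable. Below, the power \<open>s - 3 / 2\<close> is
integrable at \<open>0\<close> since \<open>s > 1 / 2\<close>; above, the power \<open>s - 1 - (k + 1) / 2\<close> is integrable at infinity since
\<open>s < (k + 1) / 2\<close>. The hypotheses on \<open>\<alpha>\<close> enter here.\<close>

lemma gaussian_scale_integral_le:
  assumes s: "1 / 2 < s" "s < real (Suc k) / 2"
  obtains C :: real where "0 \<le> C"
    "\<And>r. 0 < r \<Longrightarrow> (\<integral>\<^sup>+\<tau>. ennreal (\<tau> powr (s - 1) * sqrt (2 * pi / \<tau>)) * ennreal (min (2 * pi) (2 * r * sqrt (2 * pi / \<tau>))) ^ k * indicator {0<..} \<tau> \<partial>lborel)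
       \<le> ennreal (C * r powr (2 * s - 1))"
proof
  \<comment> \<open>The exponents of \<open>\<tau>\<close> for \<open>\<tau> \<le> r\<^sup>2\<close> and for \<open>\<tau> > r\<^sup>2\<close>.\<close>
  define a where "a = s - 3 / 2"
  define b where "b = s - 1 - real (Suc k) / 2"
  have a: "-1 < a" and b: "b < -1" using s by (auto simp: a_def b_def)
  define c1 where "c1 = sqrt (2 * pi) * (2 * pi) ^ k"
  define c2 where "c2 = sqrt (2 * pi) * (2 * sqrt (2 * pi)) ^ k"
  have c: "0 \<le> c1" "0 \<le> c2" by (auto simp: c1_def c2_def)
  define C where "C = c1 / (a + 1) + c2 / - (b + 1)"
  show "0 \<le> C" 
  proof -
    have "0 \<le> c1 / (a + 1)" using a c by (intro divide_nonneg_nonneg) linarith+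
    moreover have "0 \<le> c2 / - (b + 1)" using b c by (intro divide_nonneg_nonneg) linarith+
    ultimately show ?thesis unfolding C_def by linarith
  qed
  fix r :: real assume r: "0 < r"
  define X where "X = (r\<^sup>2) powr (a + 1) / (a + 1)"
  define Y where "Y = (r\<^sup>2) powr (b + 1) / - (b + 1)"
  have X: "0 \<le> X" unfolding X_def using a by (intro divide_nonneg_nonneg powr_ge_zero) linarith
  have Y: "0 \<le> Y" unfolding Y_def using b by (intro divide_nonneg_nonneg powr_ge_zero) linarith
  let ?f = "\<lambda>\<tau>. ennreal (\<tau> powr (s - 1) * sqrt (2 * pi / \<tau>)) * ennreal (min (2 * pi) (2 * r * sqrt (2 * pi / \<tau>))) ^ k * indicator {0<..} \<tau>"
  have sq: "\<tau> powr (s - 1) * sqrt (2 * pi / \<tau>) = sqrt (2 * pi) * \<tau> powr a" if "0 < \<tau>" for \<tau>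
  proof -
    have "a = s - 1 - 1 / 2" by (simp add: a_def)
    then have "\<tau> powr a = \<tau> powr (s - 1) / \<tau> powr (1 / 2)" by (simp only: powr_diff)
    then show ?thesis using that by (simp add: real_sqrt_divide powr_half_sqrt)
  qed
  have "(\<integral>\<^sup>+\<tau>. ?f \<tau> \<partial>lborel) \<le> (\<integral>\<^sup>+\<tau>. ennreal c1 * ennreal (\<tau> powr a * indicator {0..r\<^sup>2} \<tau>) + ennreal (c2 * r ^ k) * ennreal (\<tau> powr b * indicator {r\<^sup>2..} \<tau>) \<partial>lborel)"
  proof (rule nn_integral_mono)
    fix \<tau> :: real
    show "?f \<tau> \<le> ennreal c1 * ennreal (\<tau> powr a * indicator {0..r\<^sup>2} \<tau>) + ennreal (c2 * r ^ k) * ennreal (\<tau> powr b * indicator {r\<^sup>2..} \<tau>)"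
    proof (cases "0 < \<tau>")
      case False then show ?thesis by simp
    next
      case pos: True
      have f: "?f \<tau> = ennreal (sqrt (2 * pi) * \<tau> powr a * min (2 * pi) (2 * r * sqrt (2 * pi / \<tau>)) ^ k)"
        using pos r by (simp add: sq ennreal_power ennreal_mult[symmetric])
      show ?thesis
      proof (cases "\<tau> \<le> r\<^sup>2")
        case True
        have "min (2 * pi) (2 * r * sqrt (2 * pi / \<tau>)) ^ k \<le> (2 * pi) ^ k"
          using pos r by (intro power_mono) auto
        then have "sqrt (2 * pi) * \<tau> powr a * min (2 * pi) (2 * r * sqrt (2 * pi / \<tau>)) ^ k \<le> sqrt (2 * pi) * \<tau> powr a * (2 * pi) ^ k"
          by (intro mult_left_mono) auto
        also have "\<dots> = c1 * (\<tau> powr a * indicator {0..r\<^sup>2} \<tau>)"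
          using True pos by (simp add: c1_def)
        finally have "?f \<tau> \<le> ennreal c1 * ennreal (\<tau> powr a * indicator {0..r\<^sup>2} \<tau>)"
          unfolding f using c by (simp add: ennreal_mult[symmetric] ennreal_leI)
        then show ?thesis by (intro add_increasing2) auto
      next
        case False
        have e: "\<tau> powr b = \<tau> powr a * (1 / sqrt \<tau>) ^ k"
        proof -
          have i: "1 / sqrt \<tau> = \<tau> powr (- (1 / 2))"
            using pos by (simp add: powr_minus powr_half_sqrt inverse_eq_divide)
          have "(1 / sqrt \<tau>) ^ k = \<tau> powr (real k * - (1 / 2))"
            unfolding i using pos by (subst powr_power) auto
          moreover have "b = a + real k * - (1 / 2)" by (simp add: a_def b_def field_simps)
          ultimately show ?thesis by (simp only: powr_add)
        qed
        have "min (2 * pi) (2 * r * sqrt (2 * pi / \<tau>)) ^ k \<le> (2 * r * sqrt (2 * pi / \<tau>)) ^ k"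
          using pos r by (intro power_mono) auto
        also have "\<dots> = (2 * sqrt (2 * pi)) ^ k * r ^ k * (1 / sqrt \<tau>) ^ k"
        proof -
          have "2 * r * sqrt (2 * pi / \<tau>) = (2 * sqrt (2 * pi)) * r * (1 / sqrt \<tau>)"
            by (simp add: real_sqrt_divide)
          then show ?thesis by (simp only: power_mult_distrib)
        qed
        finally have "sqrt (2 * pi) * \<tau> powr a * min (2 * pi) (2 * r * sqrt (2 * pi / \<tau>)) ^ k \<le> sqrt (2 * pi) * \<tau> powr a * ((2 * sqrt (2 * pi)) ^ k * r ^ k * (1 / sqrt \<tau>) ^ k)"
          by (intro mult_left_mono) auto
        also have "\<dots> = c2 * r ^ k * (\<tau> powr b * indicator {r\<^sup>2..} \<tau>)"
          using False by (simp add: c2_def e)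
        finally have "?f \<tau> \<le> ennreal (c2 * r ^ k) * ennreal (\<tau> powr b * indicator {r\<^sup>2..} \<tau>)"
          unfolding f using c r by (simp add: ennreal_mult[symmetric] ennreal_leI)
        then show ?thesis by (intro add_increasing) auto
      qed
    qed
  qed
  also have "\<dots> = ennreal c1 * ennreal X + ennreal (c2 * r ^ k) * ennreal Y"
    unfolding X_def Y_def using a b r
    by (subst nn_integral_add) (auto simp: nn_integral_cmult nn_integral_powr_near_0 nn_integral_powr_near_inf)
  also have "\<dots> = ennreal (c1 * X + c2 * r ^ k * Y)"
    using X Y c r by (simp add: ennreal_mult[symmetric] ennreal_plus[symmetric] del: ennreal_plus)
  also have "c1 * X + c2 * r ^ k * Y = C * r powr (2 * s - 1)"
  proof -
    have "r\<^sup>2 = r powr 2" using r by simp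
    then have r2: "(r\<^sup>2) powr x = r powr (2 * x)" for x
      by (simp only: powr_powr)
    have e1: "(r\<^sup>2) powr (a + 1) = r powr (2 * s - 1)" unfolding r2 a_def by (simp add: algebra_simps)
    have "r ^ k * (r\<^sup>2) powr (b + 1) = r powr (real k + 2 * (b + 1))"
      by (simp only: r2 powr_add[of r "real k"] powr_realpow[OF r])
    also have "real k + 2 * (b + 1) = 2 * s - 1" unfolding b_def by (simp add: algebra_simps)
    finally have e2: "r ^ k * (r\<^sup>2) powr (b + 1) = r powr (2 * s - 1)" .
    have "c2 * r ^ k * Y = c2 * (r ^ k * (r\<^sup>2) powr (b + 1)) / - (b + 1)"
      unfolding Y_def by (simp only: times_divide_eq_right mult.assoc)
    also have "\<dots> = c2 / - (b + 1) * r powr (2 * s - 1)"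
      unfolding e2 by (simp only: times_divide_eq_left)
    finally show ?thesis unfolding X_def e1 C_def by (simp only: times_divide_eq_left times_divide_eq_right ring_distribs)
  qed
  finally show "(\<integral>\<^sup>+\<tau>. ?f \<tau> \<partial>lborel) \<le> ennreal (C * r powr (2 * s - 1))" .
qed

lemma largest_coordinate_measurable:
  fixes I J :: "'i set"
  assumes "I \<subseteq> J" "j \<in> J"
  shows "(\<lambda>y. \<Prod>i\<in>I. indicator {-\<bar>y j\<bar>..\<bar>y j\<bar>} (y i) :: ennreal) \<in> borel_measurable (lborel_on J)"
proof (rule borel_measurable_prod_ennreal)
  fix i assume "i \<in> I"
  then have a: "(\<lambda>y. \<bar>y i\<bar>) \<in> borel_measurable (lborel_on J)"
    and b: "(\<lambda>y. \<bar>y j\<bar>) \<in> borel_measurable (lborel_on J)"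
    using assms measurable_component_singleton[of _ J "\<lambda>_. lborel :: real measure"] by auto
  have iv: "x \<in> {-r..r} \<longleftrightarrow> \<bar>x\<bar> \<le> r" for x r :: real by auto
  show "(\<lambda>y. indicator {-\<bar>y j\<bar>..\<bar>y j\<bar>} (y i) :: ennreal) \<in> borel_measurable (lborel_on J)"
    by (rule borel_measurable_indicator') (use borel_measurable_le[OF a b] in \<open>simp only: iv\<close>)
qed

text \<open>One chart at a fixed scale \<open>\<tau>\<close>: the coordinate \<open>j\<close> is the largest and is traded for \<open>l\<close>, its Gaussian
being bounded by its maximum; the remaining coordinates are then integrated out one by one.\<close>

lemma radial_kernel_chart_bound:
  fixes H :: "real \<Rightarrow> ennreal" and x :: "'i \<Rightarrow> real" and I :: "'i set"
  assumes [measurable]: "H \<in> borel_measurable borel" and I[simp]: "finite I" "j \<notin> I" and m: "0 < m" and \<tau>: "0 < \<tau>"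
  shows "(\<integral>\<^sup>+y. H (c + \<sigma> * (\<Sum>i\<in>insert j I. (y i)\<^sup>2) powr (m / 2)) * ennreal ((\<Sum>i\<in>insert j I. (y i)\<^sup>2) powr (m / 2 - s))
       * (\<Prod>i\<in>insert j I. ennreal (gauss_hat1 \<tau> (x i - y i))) * (\<Prod>i\<in>I. indicator {-\<bar>y j\<bar>..\<bar>y j\<bar>} (y i)) \<partial>lborel_on (insert j I))
    \<le> ennreal (2 * sqrt (card I + 1) / m) * (\<integral>\<^sup>+l. H (c + \<sigma> * l) * ennreal (l powr ((1 - 2 * s) / m)) * indicator {0<..} l *
          (ennreal (sqrt (2 * pi / \<tau>)) * ennreal (min (2 * pi) (2 * l powr (1 / m) * sqrt (2 * pi / \<tau>))) ^ card I) \<partial>lborel)"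
proof -
  let ?\<Phi> = "\<lambda>R. H (c + \<sigma> * R powr (m / 2)) * ennreal (R powr (m / 2 - s))"
  let ?r = "\<lambda>y t. (\<Sum>i\<in>I. (y i)\<^sup>2) + t\<^sup>2"
  let ?\<mu> = "\<lambda>l. ennreal (min (2 * pi) (2 * l powr (1 / m) * sqrt (2 * pi / \<tau>)))"
  define K where "K = ennreal (2 * sqrt (card I + 1) / m)"
  define q where "q = ennreal (sqrt (2 * pi / \<tau>))"
  define G where "G y = (\<Prod>i\<in>I. ennreal (gauss_hat1 \<tau> (x i - y i)))" for y
  define h where "h l = H (c + \<sigma> * l) * ennreal (l powr ((1 - 2 * s) / m)) * indicator {0<..} l" for l
  define J where "J l y = (\<Prod>i\<in>I. indicator {-(l powr (1 / m))..l powr (1 / m)} (y i) :: ennreal)" for l and y :: "'i \<Rightarrow> real"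
  have [measurable]: "h \<in> borel_measurable borel" unfolding h_def by measurable
  have [measurable]: "G \<in> borel_measurable (lborel_on I)" unfolding G_def by measurable
  have Jm: "(\<lambda>z. J (snd z) (fst z)) \<in> borel_measurable (lborel_on I \<Otimes>\<^sub>M lborel)"
  proof -
    have "(\<lambda>z. J (snd z) (fst z)) = (\<lambda>z. \<Prod>i\<in>I. indicator {z. \<bar>fst z i\<bar> \<le> snd z powr (1 / m)} z :: ennreal)"
      unfolding J_def by (intro ext prod.cong) (auto simp: indicator_def)
    moreover have "(\<lambda>z. \<Prod>i\<in>I. indicator {z. \<bar>fst z i\<bar> \<le> snd z powr (1 / m)} z :: ennreal) \<in> borel_measurable (lborel_on I \<Otimes>\<^sub>M (lborel :: real measure))"
      by measurable
    ultimately show ?thesis by simp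
  qed
  have [measurable]: "(\<lambda>(y, l). J l y) \<in> borel_measurable (lborel_on I \<Otimes>\<^sub>M lborel)"
    using Jm by (simp add: case_prod_beta)
  have [measurable]: "(\<lambda>l. J l y) \<in> borel_measurable lborel" if "y \<in> space (lborel_on I)" for y
    using measurable_compose[OF measurable_Pair1'[OF that] Jm] by simp
  have [measurable]: "(\<lambda>y. J l y) \<in> borel_measurable (lborel_on I)" for l
    using measurable_compose[OF measurable_Pair2'[of l] Jm] by simp
  interpret P: pair_sigma_finite "lborel_on I" lborel
    by (intro pair_sigma_finite.intro lborel_PiM.sigma_finite I lborel.sigma_finite_measure_axioms)
  have up: "(\<Sum>i\<in>insert j I. ((y(j := t)) i)\<^sup>2) = (\<Sum>i\<in>I. (y i)\<^sup>2) + t\<^sup>2"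
     "(\<Prod>i\<in>insert j I. ennreal (gauss_hat1 \<tau> (x i - (y(j := t)) i))) = ennreal (gauss_hat1 \<tau> (x j - t)) * G y"
     "(\<Prod>i\<in>I. indicator {-\<bar>(y(j := t)) j\<bar>..\<bar>(y(j := t)) j\<bar>} ((y(j := t)) i) :: ennreal) = (\<Prod>i\<in>I. indicator {-\<bar>t\<bar>..\<bar>t\<bar>} (y i))"
    for y and t :: real
  proof -
    have ne: "i \<noteq> j" if "i \<in> I" for i using that I by auto
    show "(\<Sum>i\<in>insert j I. ((y(j := t)) i)\<^sup>2) = (\<Sum>i\<in>I. (y i)\<^sup>2) + t\<^sup>2"
      by (subst sum.insert) (auto simp: ne add.commute intro!: sum.cong)
    show "(\<Prod>i\<in>insert j I. ennreal (gauss_hat1 \<tau> (x i - (y(j := t)) i))) = ennreal (gauss_hat1 \<tau> (x j - t)) * G y"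
      by (subst prod.insert) (auto simp: ne G_def intro!: prod.cong)
    show "(\<Prod>i\<in>I. indicator {-\<bar>(y(j := t)) j\<bar>..\<bar>(y(j := t)) j\<bar>} ((y(j := t)) i) :: ennreal) = (\<Prod>i\<in>I. indicator {-\<bar>t\<bar>..\<bar>t\<bar>} (y i))"
      by (auto simp: ne intro!: prod.cong)
  qed
  have step: "(\<integral>\<^sup>+t. ?\<Phi> (?r y t)
       * (ennreal (gauss_hat1 \<tau> (x j - t)) * G y) * (\<Prod>i\<in>I. indicator {-\<bar>t\<bar>..\<bar>t\<bar>} (y i)) \<partial>lborel)
     \<le> G y * q * (K * (\<integral>\<^sup>+l. h l * J l y \<partial>lborel))" (is "?l \<le> _") if "y \<in> space (lborel_on I)" for y
  proof -
    define P where "P r = (\<Prod>i\<in>I. indicator {-r..r} (y i) :: ennreal)" for r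
    have [measurable]: "P \<in> borel_measurable borel"
    proof -
      have "P = (\<lambda>r. \<Prod>i\<in>I. indicator {r. \<bar>y i\<bar> \<le> r} r)"
        unfolding P_def by (auto simp: indicator_def abs_le_iff minus_le_iff intro!: prod.cong)
      then show ?thesis by simp
    qed
    have "?l \<le> (\<integral>\<^sup>+t. (G y * q) * (?\<Phi> (?r y t)
            * P \<bar>t\<bar>) \<partial>lborel)"
    proof (rule nn_integral_mono)
      fix t
      have "ennreal (gauss_hat1 \<tau> (x j - t)) \<le> q" unfolding q_def by (intro ennreal_leI gauss_hat1_le \<tau>)
      from mult_left_mono[OF this, of "G y * (?\<Phi> (?r y t)
            * P \<bar>t\<bar>)"]
      show "?\<Phi> (?r y t)
       * (ennreal (gauss_hat1 \<tau> (x j - t)) * G y) * (\<Prod>i\<in>I. indicator {-\<bar>t\<bar>..\<bar>t\<bar>} (y i))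
        \<le> (G y * q) * (?\<Phi> (?r y t)
            * P \<bar>t\<bar>)"
        by (simp add: mult_ac P_def)
    qed
    also have "\<dots> = (G y * q) * (\<integral>\<^sup>+t. (?\<Phi> (?r y t)
            * P \<bar>t\<bar>) \<partial>lborel)"
      by (rule nn_integral_cmult) measurable
    also have "\<dots> \<le> (G y * q) * (K * (\<integral>\<^sup>+l. h l * J l y \<partial>lborel))"
    proof (rule mult_left_mono)
      have "(\<integral>\<^sup>+t. (?\<Phi> (?r y t)
            * P \<bar>t\<bar>) \<partial>lborel) \<le> K * (\<integral>\<^sup>+l. H (c + \<sigma> * l) * ennreal (l powr ((1 - 2 * s) / m)) * J l y * indicator {0<..} l \<partial>lborel)"
        unfolding P_def J_def K_def
        by (rule chart_substitution_le[of "\<lambda>l. H (c + \<sigma> * l)", OF _ I(1) m]) measurable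
      also have "(\<integral>\<^sup>+l. H (c + \<sigma> * l) * ennreal (l powr ((1 - 2 * s) / m)) * J l y * indicator {0<..} l \<partial>lborel) = (\<integral>\<^sup>+l. h l * J l y \<partial>lborel)"
        by (intro nn_integral_cong) (simp add: h_def mult_ac)
      finally show "(\<integral>\<^sup>+t. (?\<Phi> (?r y t)
            * P \<bar>t\<bar>) \<partial>lborel) \<le> K * (\<integral>\<^sup>+l. h l * J l y \<partial>lborel)" .
    qed simp
    finally show ?thesis .
  qed
  have "(\<integral>\<^sup>+y. ?\<Phi> (\<Sum>i\<in>insert j I. (y i)\<^sup>2)
       * (\<Prod>i\<in>insert j I. ennreal (gauss_hat1 \<tau> (x i - y i))) * (\<Prod>i\<in>I. indicator {-\<bar>y j\<bar>..\<bar>y j\<bar>} (y i)) \<partial>lborel_on (insert j I))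
     = (\<integral>\<^sup>+y. (\<integral>\<^sup>+t. ?\<Phi> (?r y t)
       * (ennreal (gauss_hat1 \<tau> (x j - t)) * G y) * (\<Prod>i\<in>I. indicator {-\<bar>t\<bar>..\<bar>t\<bar>} (y i)) \<partial>lborel) \<partial>lborel_on I)"
  proof (subst lborel_PiM.product_nn_integral_insert[OF I])
    have [measurable]: "(\<lambda>y. \<Prod>i\<in>I. indicator {-\<bar>y j\<bar>..\<bar>y j\<bar>} (y i) :: ennreal) \<in> borel_measurable (lborel_on (insert j I))"
      by (rule largest_coordinate_measurable) auto
    show "(\<lambda>y. ?\<Phi> (\<Sum>i\<in>insert j I. (y i)\<^sup>2)
       * (\<Prod>i\<in>insert j I. ennreal (gauss_hat1 \<tau> (x i - y i))) * (\<Prod>i\<in>I. indicator {-\<bar>y j\<bar>..\<bar>y j\<bar>} (y i))) \<in> borel_measurable (lborel_on (insert j I))"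
      by measurable
  qed (simp only: up)
  also have "\<dots> \<le> (\<integral>\<^sup>+y. G y * q * (K * (\<integral>\<^sup>+l. h l * J l y \<partial>lborel)) \<partial>lborel_on I)"
    by (intro nn_integral_mono step)
  also have "\<dots> = (\<integral>\<^sup>+y. (\<integral>\<^sup>+l. K * (h l * (q * (G y * J l y))) \<partial>lborel) \<partial>lborel_on I)"
  proof (rule nn_integral_cong)
    fix y assume y: "y \<in> space (lborel_on I)"
    have "G y * q * (K * (\<integral>\<^sup>+l. h l * J l y \<partial>lborel)) = (G y * q * K) * (\<integral>\<^sup>+l. h l * J l y \<partial>lborel)"
      by (simp add: mult_ac)
    also have "\<dots> = (\<integral>\<^sup>+l. (G y * q * K) * (h l * J l y) \<partial>lborel)"
      using y by (intro nn_integral_cmult[symmetric]) measurable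
    finally show "G y * q * (K * (\<integral>\<^sup>+l. h l * J l y \<partial>lborel)) = (\<integral>\<^sup>+l. K * (h l * (q * (G y * J l y))) \<partial>lborel)"
      by (simp add: mult_ac)
  qed
  also have "\<dots> = (\<integral>\<^sup>+l. (\<integral>\<^sup>+y. K * (h l * (q * (G y * J l y))) \<partial>lborel_on I) \<partial>lborel)"
    by (rule P.Fubini'[symmetric]) measurable
  also have "\<dots> = (\<integral>\<^sup>+l. K * (h l * (q * (\<integral>\<^sup>+y. G y * J l y \<partial>lborel_on I))) \<partial>lborel)"
    by (intro nn_integral_cong) (simp add: nn_integral_cmult)
  also have "\<dots> \<le> (\<integral>\<^sup>+l. K * (h l * (q * ?\<mu> l ^ card I)) \<partial>lborel)"
  proof (intro nn_integral_mono mult_left_mono)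
    fix l
    have "(\<integral>\<^sup>+y. G y * J l y \<partial>lborel_on I) = (\<integral>\<^sup>+y. (\<Prod>i\<in>I. ennreal (gauss_hat1 \<tau> (x i - y i)) * indicator {-(l powr (1 / m))..l powr (1 / m)} (y i)) \<partial>lborel_on I)"
      by (simp add: G_def J_def prod.distrib)
    also have "\<dots> = (\<Prod>i\<in>I. \<integral>\<^sup>+w. ennreal (gauss_hat1 \<tau> (x i - w)) * indicator {-(l powr (1 / m))..l powr (1 / m)} w \<partial>lborel)"
      by (rule lborel_PiM.product_nn_integral_prod[OF I(1)]) measurable
    also have "\<dots> \<le> (\<Prod>i\<in>I. ?\<mu> l)"
      using I(1)
    proof (induction I rule: finite_induct)
      case (insert i I)
      then show ?case by (simp add: mult_mono nn_integral_gauss_hat1_interval \<tau>)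
    qed simp
    finally show "(\<integral>\<^sup>+y. G y * J l y \<partial>lborel_on I) \<le> ?\<mu> l ^ card I"
      by simp
  qed auto
  also have "\<dots> = K * (\<integral>\<^sup>+l. h l * (q * ?\<mu> l ^ card I) \<partial>lborel)"
    by (rule nn_integral_cmult) measurable
  finally show ?thesis unfolding K_def h_def q_def .
qed

text \<open>The Schur integral over \<open>card S\<close> coordinates for the phase \<open>|y|\<^sup>m\<close>, with the time cutoff generalised to a
function \<open>H\<close> and with \<open>c\<close> standing for everything in the phase difference that does not depend on \<open>y\<close>.\<close>

definition radial_kernel ::
  "'i set \<Rightarrow> real \<Rightarrow> real \<Rightarrow> (real \<Rightarrow> ennreal) \<Rightarrow> real \<Rightarrow> real \<Rightarrow> ('i \<Rightarrow> real) \<Rightarrow> ennreal" where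
  "radial_kernel S m s H c \<sigma> x =
     (\<integral>\<^sup>+\<tau>. ennreal (\<tau> powr (s - 1)) *
        (\<integral>\<^sup>+y. H (c + \<sigma> * (\<Sum>i\<in>S. (y i)\<^sup>2) powr (m / 2)) * ennreal ((\<Sum>i\<in>S. (y i)\<^sup>2) powr (m / 2 - s))
           * (\<Prod>i\<in>S. ennreal (gauss_hat1 \<tau> (x i - y i))) \<partial>lborel_on S) * indicator {0<..} \<tau> \<partial>lborel)"

text \<open>The charts, one for each choice of the largest coordinate, cover the space. In each of them the integral
over \<open>\<tau>\<close> produces \<open>r\<^sup>2\<^sup>s\<^sup>-\<^sup>1\<close> with \<open>r = l\<^sup>1\<^sup>/\<^sup>m\<close>, which cancels the factor \<open>l\<^sup>(\<^sup>1\<^sup>-\<^sup>2\<^sup>s\<^sup>)\<^sup>/\<^sup>m\<close> of the substitution, and what is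
left is the integral of \<open>H\<close>. In particular the bound does not see \<open>c\<close> and \<open>x\<close>.\<close>

lemma radial_kernel_bound:
  fixes S :: "'i set"
  assumes S: "finite S" and s: "1 / 2 < s" "s < real (card S) / 2" and m: "0 < m"
  obtains C :: real where "0 \<le> C"
    "\<And>(H :: real \<Rightarrow> ennreal) x c \<sigma>. H \<in> borel_measurable borel \<Longrightarrow> \<bar>\<sigma>\<bar> = 1 \<Longrightarrow>
      radial_kernel S m s H c \<sigma> x \<le> ennreal C * (\<integral>\<^sup>+l. H l \<partial>lborel)"
proof -
  obtain k where k: "card S = Suc k" using s by (cases "card S") auto
  have ne: "S \<noteq> {}" using k by auto
  obtain C0 where C0: "0 \<le> C0" and tau:
    "\<And>r. 0 < r \<Longrightarrow> (\<integral>\<^sup>+\<tau>. ennreal (\<tau> powr (s - 1) * sqrt (2 * pi / \<tau>)) * ennreal (min (2 * pi) (2 * r * sqrt (2 * pi / \<tau>))) ^ k * indicator {0<..} \<tau> \<partial>lborel)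
       \<le> ennreal (C0 * r powr (2 * s - 1))"
    using gaussian_scale_integral_le[of s k] s unfolding k by blast
  define K where "K = 2 * sqrt (real (Suc k)) / m"
  have K: "0 \<le> K" using m by (simp add: K_def)
  \<comment> \<open>There are \<open>Suc k\<close> charts; \<open>K\<close> is the constant of \<open>chart_substitution_le\<close>.\<close>
  define C where "C = real (Suc k) * K * C0"
  show ?thesis
  proof (rule that[of C])
    show "0 \<le> C" using K C0 by (simp add: C_def)
    fix H :: "real \<Rightarrow> ennreal" and x :: "'i \<Rightarrow> real" and c \<sigma> :: real
    assume [measurable]: "H \<in> borel_measurable borel" and \<sigma>: "\<bar>\<sigma>\<bar> = 1"
    define F where "F \<tau> y = H (c + \<sigma> * (\<Sum>i\<in>S. (y i)\<^sup>2) powr (m / 2)) * ennreal ((\<Sum>i\<in>S. (y i)\<^sup>2) powr (m / 2 - s))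
       * (\<Prod>i\<in>S. ennreal (gauss_hat1 \<tau> (x i - y i)))" for \<tau> y
    define R where "R j y = (\<Prod>i\<in>S - {j}. indicator {-\<bar>y j\<bar>..\<bar>y j\<bar>} (y i) :: ennreal)" for j and y :: "'i \<Rightarrow> real"
    define h where "h l = H (c + \<sigma> * l) * ennreal (l powr ((1 - 2 * s) / m)) * indicator {0<..} l" for l
    define e where "e l \<tau> = ennreal (min (2 * pi) (2 * l powr (1 / m) * sqrt (2 * pi / \<tau>))) ^ k" for l \<tau>
    have [measurable]: "h \<in> borel_measurable borel" unfolding h_def by measurable
    have [measurable]: "(\<lambda>l. e l \<tau>) \<in> borel_measurable borel" "(\<lambda>\<tau>. e l \<tau>) \<in> borel_measurable borel"
       "(\<lambda>(\<tau>, l). e l \<tau>) \<in> borel_measurable (lborel \<Otimes>\<^sub>M lborel)" for l \<tau> unfolding e_def by measurable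
    have [measurable]: "F \<tau> \<in> borel_measurable (lborel_on S)" for \<tau> unfolding F_def by measurable
    have [measurable]: "R j \<in> borel_measurable (lborel_on S)" if "j \<in> S" for j
      using that S unfolding R_def by (intro largest_coordinate_measurable) auto
    have inner: "(\<integral>\<^sup>+y. F \<tau> y \<partial>lborel_on S) \<le> ennreal (real (Suc k) * K) * (\<integral>\<^sup>+l. h l * (ennreal (sqrt (2 * pi / \<tau>)) * e l \<tau>) \<partial>lborel)"
      if \<tau>: "0 < \<tau>" for \<tau>
    proof -
      have "(\<integral>\<^sup>+y. F \<tau> y \<partial>lborel_on S) \<le> (\<integral>\<^sup>+y. (\<Sum>j\<in>S. F \<tau> y * R j y) \<partial>lborel_on S)"
      proof (rule nn_integral_mono)
        fix y :: "'i \<Rightarrow> real"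
        obtain j where j: "j \<in> S" "\<And>i. i \<in> S \<Longrightarrow> \<bar>y i\<bar> \<le> \<bar>y j\<bar>"
        proof -
          have "Max ((\<lambda>i. \<bar>y i\<bar>) ` S) \<in> (\<lambda>i. \<bar>y i\<bar>) ` S" using S ne by (intro Max_in) auto
          then obtain j where "j \<in> S" "Max ((\<lambda>i. \<bar>y i\<bar>) ` S) = \<bar>y j\<bar>" by auto
          then show ?thesis using that[of j] S by (metis Max_ge finite_imageI imageI)
        qed
        have "R j y = 1" unfolding R_def using j(2) by (intro prod.neutral) (auto simp: indicator_def abs_le_iff minus_le_iff)
        then have "F \<tau> y = F \<tau> y * R j y" by simp
        also have "\<dots> \<le> (\<Sum>j\<in>S. F \<tau> y * R j y)" by (rule member_le_sum[OF j(1)]) (use S in auto)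
        finally show "F \<tau> y \<le> (\<Sum>j\<in>S. F \<tau> y * R j y)" .
      qed
      also have "\<dots> = (\<Sum>j\<in>S. \<integral>\<^sup>+y. F \<tau> y * R j y \<partial>lborel_on S)"
        by (rule nn_integral_sum) measurable
      also have "\<dots> \<le> (\<Sum>j\<in>S. ennreal K * (\<integral>\<^sup>+l. h l * (ennreal (sqrt (2 * pi / \<tau>)) * e l \<tau>) \<partial>lborel))"
      proof (rule sum_mono)
        fix j assume j: "j \<in> S"
        have i: "insert j (S - {j}) = S" "card (S - {j}) = k" using j S k by auto
        show "(\<integral>\<^sup>+y. F \<tau> y * R j y \<partial>lborel_on S) \<le> ennreal K * (\<integral>\<^sup>+l. h l * (ennreal (sqrt (2 * pi / \<tau>)) * e l \<tau>) \<partial>lborel)"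
          using radial_kernel_chart_bound[of H "S - {j}" j m \<tau> c \<sigma> s x] S m \<tau>
          unfolding i F_def R_def K_def h_def e_def by (simp add: add.commute)
      qed
      also have "\<dots> = ennreal (real (Suc k) * K) * (\<integral>\<^sup>+l. h l * (ennreal (sqrt (2 * pi / \<tau>)) * e l \<tau>) \<partial>lborel)"
      proof -
        have "ennreal (real (Suc k) * K) = of_nat (Suc k) * ennreal K"
          using K by (simp only: ennreal_mult of_nat_0_le_iff ennreal_of_nat_eq_real_of_nat)
        then show ?thesis by (simp only: sum_constant k mult.assoc)
      qed
      finally show ?thesis .
    qed
    define T where "T \<tau> = ennreal (\<tau> powr (s - 1) * sqrt (2 * pi / \<tau>)) * indicator {0<..} \<tau>" for \<tau>
    have [measurable]: "T \<in> borel_measurable borel" unfolding T_def by measurable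
    have "(\<integral>\<^sup>+\<tau>. ennreal (\<tau> powr (s - 1)) * (\<integral>\<^sup>+y. F \<tau> y \<partial>lborel_on S) * indicator {0<..} \<tau> \<partial>lborel)
      \<le> (\<integral>\<^sup>+\<tau>. ennreal (real (Suc k) * K) * (\<integral>\<^sup>+l. h l * (T \<tau> * e l \<tau>) \<partial>lborel) \<partial>lborel)"
    proof (rule nn_integral_mono)
      fix \<tau> :: real
      show "ennreal (\<tau> powr (s - 1)) * (\<integral>\<^sup>+y. F \<tau> y \<partial>lborel_on S) * indicator {0<..} \<tau> \<le> ennreal (real (Suc k) * K) * (\<integral>\<^sup>+l. h l * (T \<tau> * e l \<tau>) \<partial>lborel)"
      proof (cases "0 < \<tau>")
        case True
        have "(\<integral>\<^sup>+l. h l * (T \<tau> * e l \<tau>) \<partial>lborel) = (\<integral>\<^sup>+l. ennreal (\<tau> powr (s - 1)) * (h l * (ennreal (sqrt (2 * pi / \<tau>)) * e l \<tau>)) \<partial>lborel)"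
          using True by (intro nn_integral_cong) (simp add: T_def ennreal_mult mult_ac)
        also have "\<dots> = ennreal (\<tau> powr (s - 1)) * (\<integral>\<^sup>+l. (h l * (ennreal (sqrt (2 * pi / \<tau>)) * e l \<tau>)) \<partial>lborel)"
          by (rule nn_integral_cmult) measurable
        finally have eq: "(\<integral>\<^sup>+l. h l * (T \<tau> * e l \<tau>) \<partial>lborel) = ennreal (\<tau> powr (s - 1)) * (\<integral>\<^sup>+l. (h l * (ennreal (sqrt (2 * pi / \<tau>)) * e l \<tau>)) \<partial>lborel)" .
        show ?thesis
          using mult_left_mono[OF inner[OF True], of "ennreal (\<tau> powr (s - 1))"] True unfolding eq
          by (simp add: mult.left_commute)
      qed simp
    qed
    also have "\<dots> = ennreal (real (Suc k) * K) * (\<integral>\<^sup>+\<tau>. (\<integral>\<^sup>+l. h l * (T \<tau> * e l \<tau>) \<partial>lborel) \<partial>lborel)"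
      by (rule nn_integral_cmult) measurable
    also have "(\<integral>\<^sup>+\<tau>. (\<integral>\<^sup>+l. h l * (T \<tau> * e l \<tau>) \<partial>lborel) \<partial>lborel) = (\<integral>\<^sup>+l. (\<integral>\<^sup>+\<tau>. h l * (T \<tau> * e l \<tau>) \<partial>lborel) \<partial>lborel)"
      by (rule lborel_pair.Fubini') measurable
    also have "\<dots> \<le> (\<integral>\<^sup>+l. ennreal C0 * H (c + \<sigma> * l) \<partial>lborel)"
    proof (rule nn_integral_mono)
      fix l :: real
      show "(\<integral>\<^sup>+\<tau>. h l * (T \<tau> * e l \<tau>) \<partial>lborel) \<le> ennreal C0 * H (c + \<sigma> * l)"
      proof (cases "0 < l")
        case True
        have r: "0 < l powr (1 / m)" using True by simp
        have "(\<integral>\<^sup>+\<tau>. h l * (T \<tau> * e l \<tau>) \<partial>lborel) = h l * (\<integral>\<^sup>+\<tau>. T \<tau> * e l \<tau> \<partial>lborel)"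
          by (rule nn_integral_cmult) measurable
        also have "\<dots> \<le> h l * ennreal (C0 * (l powr (1 / m)) powr (2 * s - 1))"
          using tau[OF r] by (intro mult_left_mono) (simp_all add: T_def e_def mult_ac)
        also have "h l * ennreal (C0 * (l powr (1 / m)) powr (2 * s - 1)) = H (c + \<sigma> * l) * ennreal (l powr ((1 - 2 * s) / m) * (C0 * (l powr (1 / m)) powr (2 * s - 1)))"
          using True C0 by (simp add: h_def ennreal_mult mult.assoc)
        also have "l powr ((1 - 2 * s) / m) * (C0 * (l powr (1 / m)) powr (2 * s - 1)) = C0"
        proof -
          have "(l powr (1 / m)) powr (2 * s - 1) = l powr (- ((1 - 2 * s) / m))"
            by (simp add: powr_powr minus_divide_left)
          then show ?thesis using True by (simp add: powr_minus)
        qed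
        finally show ?thesis by (simp add: mult.commute)
      qed (simp add: h_def)
    qed
    also have "(\<integral>\<^sup>+l. ennreal C0 * H (c + \<sigma> * l) \<partial>lborel) = ennreal C0 * (\<integral>\<^sup>+l. H l \<partial>lborel)"
    proof -
      have "(\<integral>\<^sup>+l. H l \<partial>lborel) = (\<integral>\<^sup>+l. H (c + \<sigma> * l) \<partial>lborel)"
        using \<sigma> by (subst nn_integral_real_affine[where c=\<sigma> and t=c]) auto
      then show ?thesis by (simp add: nn_integral_cmult)
    qed
    finally have "(\<integral>\<^sup>+\<tau>. ennreal (\<tau> powr (s - 1)) * (\<integral>\<^sup>+y. F \<tau> y \<partial>lborel_on S) * indicator {0<..} \<tau> \<partial>lborel)
      \<le> ennreal (real (Suc k) * K) * (ennreal C0 * (\<integral>\<^sup>+l. H l \<partial>lborel))"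
      by (simp add: mult_left_mono)
    also have "\<dots> = ennreal C * (\<integral>\<^sup>+l. H l \<partial>lborel)"
      using K C0 unfolding C_def by (subst (2) ennreal_mult) (auto simp: mult.assoc)
    finally show "radial_kernel S m s H c \<sigma> x \<le> ennreal C * (\<integral>\<^sup>+l. H l \<partial>lborel)"
      unfolding radial_kernel_def F_def .
  qed
qed

section \<open>Phases that are radial in a group of coordinates\<close>

definition rsq :: "'a::euclidean_space set \<Rightarrow> 'a \<Rightarrow> real" where
  "rsq S x = (\<Sum>b\<in>S. (x \<bullet> b)\<^sup>2)"

lemma rsq_measurable [measurable]: "rsq S \<in> borel_measurable borel"
  unfolding rsq_def by measurable

lemma rsq_nonneg: "0 \<le> rsq S x"
  unfolding rsq_def by (intro sum_nonneg) auto

lemma rsq_Basis: "rsq Basis x = (norm x)\<^sup>2"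
  unfolding rsq_def by (subst power2_norm_eq_inner, subst euclidean_inner) (simp only: power2_eq_square)

lemma rsq_le_norm:
  assumes "S \<subseteq> Basis"
  shows "rsq S x \<le> (norm x)\<^sup>2"
proof -
  have "rsq S x \<le> (\<Sum>b\<in>Basis. (x \<bullet> b)\<^sup>2)"
    unfolding rsq_def using assms by (intro sum_mono2) auto
  also have "\<dots> = (norm x)\<^sup>2"
    unfolding rsq_Basis[symmetric] rsq_def ..
  finally show ?thesis .
qed

lemma norm_powr_rsq: "norm x powr p = rsq Basis x powr (p / 2)" for x :: "'a::euclidean_space"
proof (cases "x = 0")
  case False
  have "rsq Basis x = (norm x)\<^sup>2" by (rule rsq_Basis)
  also have "\<dots> = norm x powr 2" using False by simp
  finally show ?thesis by (simp only: powr_powr) simp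
qed (simp add: rsq_def)

text \<open>For negative \<open>a\<close>, \<open>rsq S \<xi>\<close> is at least the square of each of the \<open>N = card S\<close> coordinates, so
\<open>(rsq S \<xi>)\<^sup>a\<close> is at most the product of \<open>|\<xi>\<^sub>b|\<^sup>2\<^sup>a\<^sup>/\<^sup>N\<close> over \<open>b \<in> S\<close>, and the exponents exceed \<open>-1\<close>.\<close>

lemma amplitude_schwartz_L2:
  fixes S :: "'a::euclidean_space set" and \<psi> :: "'a \<Rightarrow> complex"
  assumes S: "S \<subseteq> Basis" and a: "- (real (card S) / 2) < a" and \<psi>: "schwartz \<psi>"
  shows "(\<integral>\<^sup>+\<xi>. ennreal ((rsq S \<xi> powr (a / 2) * cmod (\<psi> \<xi>))\<^sup>2) \<partial>lborel) < \<infinity>"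
proof (cases "0 \<le> a")
  case True
  have "(\<integral>\<^sup>+\<xi>. ennreal ((rsq S \<xi> powr (a / 2) * cmod (\<psi> \<xi>))\<^sup>2) \<partial>lborel) \<le> (\<integral>\<^sup>+\<xi>. ennreal ((norm \<xi> powr a * cmod (\<psi> \<xi>))\<^sup>2) \<partial>lborel)"
  proof (intro nn_integral_mono ennreal_leI power_mono mult_right_mono)
    fix \<xi> :: 'a
    have "rsq S \<xi> powr (a / 2) \<le> ((norm \<xi>)\<^sup>2) powr (a / 2)"
      using True by (intro powr_mono2 rsq_le_norm S rsq_nonneg) auto
    also have "\<dots> = norm \<xi> powr a"
    proof (cases "\<xi> = 0")
      case False
      then have "(norm \<xi>)\<^sup>2 = norm \<xi> powr 2" by simp
      then show ?thesis by (simp only: powr_powr) simp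
    qed simp
    finally show "rsq S \<xi> powr (a / 2) \<le> norm \<xi> powr a" .
  qed auto
  also have "\<dots> < \<infinity>" by (rule schwartz_weighted_L2(1)[OF \<psi> True])
  finally show ?thesis .
next
  case False
  define N where "N = card S"
  have N: "0 < N" using a False by (cases "card S") (auto simp: N_def)
  have fS: "finite S" by (rule finite_subset[OF S finite_Basis])
  define p where "p = 2 * a / real N"
  have p: "-1 < p" "p \<le> 0" using a False N by (auto simp: p_def N_def field_simps)
  obtain B where B: "0 \<le> B" "\<And>x. cmod (\<psi> x) \<le> B / (1 + norm x) ^ DIM('a)" using schwartz_decay[OF \<psi>] by blast
  let ?f = "\<lambda>\<xi>::'a. (\<Prod>b\<in>S. \<bar>\<xi> \<bullet> b\<bar> powr p) / (1 + norm \<xi>) ^ (2 * DIM('a))"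
  have "(\<integral>\<^sup>+\<xi>. ennreal ((rsq S \<xi> powr (a / 2) * cmod (\<psi> \<xi>))\<^sup>2) \<partial>lborel) \<le> (\<integral>\<^sup>+\<xi>. ennreal (B\<^sup>2) * ennreal (?f \<xi>) \<partial>lborel)"
  proof (rule nn_integral_mono_AE, use AE_coords_nonzero in eventually_elim)
    case (elim \<xi>)
    have "S \<noteq> {}" using N by (auto simp: N_def)
    then have pos: "0 < rsq S \<xi>"
      unfolding rsq_def using elim S fS by (intro sum_pos) auto
    have "(rsq S \<xi> powr (a / 2))\<^sup>2 = rsq S \<xi> powr a"
      by (simp add: power2_eq_square powr_add[symmetric])
    also have "\<dots> = (\<Prod>b\<in>S. sqrt (rsq S \<xi>) powr p)"
    proof -
      have "(\<Prod>b\<in>S. sqrt (rsq S \<xi>) powr p) = (sqrt (rsq S \<xi>) powr p) ^ N" by (simp add: N_def)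
      also have "\<dots> = sqrt (rsq S \<xi>) powr (real N * p)" using N pos by (subst powr_power) auto
      also have "\<dots> = (rsq S \<xi> powr (1 / 2)) powr (2 * a)" using N pos by (simp add: p_def powr_half_sqrt)
      also have "\<dots> = rsq S \<xi> powr a" by (simp only: powr_powr) simp
      finally show ?thesis by simp
    qed
    also have "\<dots> \<le> (\<Prod>b\<in>S. \<bar>\<xi> \<bullet> b\<bar> powr p)"
    proof (rule prod_mono, safe)
      fix b assume b: "b \<in> S"
      have "(\<xi> \<bullet> b)\<^sup>2 \<le> rsq S \<xi>" unfolding rsq_def by (rule member_le_sum[OF b]) (use fS in auto)
      then have "\<bar>\<xi> \<bullet> b\<bar> \<le> sqrt (rsq S \<xi>)" by (metis real_sqrt_abs real_sqrt_le_iff)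
      moreover have "0 < \<bar>\<xi> \<bullet> b\<bar>" using elim b S by auto
      ultimately show "sqrt (rsq S \<xi>) powr p \<le> \<bar>\<xi> \<bullet> b\<bar> powr p" using p by (intro powr_mono2') auto
    qed simp
    finally have 1: "(rsq S \<xi> powr (a / 2))\<^sup>2 \<le> (\<Prod>b\<in>S. \<bar>\<xi> \<bullet> b\<bar> powr p)" .
    have "(cmod (\<psi> \<xi>))\<^sup>2 \<le> (B / (1 + norm \<xi>) ^ DIM('a))\<^sup>2" by (intro power_mono B) auto
    also have "\<dots> = B\<^sup>2 / (1 + norm \<xi>) ^ (2 * DIM('a))"
      by (simp add: power_divide power_mult[symmetric] mult.commute)
    finally have 2: "(cmod (\<psi> \<xi>))\<^sup>2 \<le> B\<^sup>2 / (1 + norm \<xi>) ^ (2 * DIM('a))" .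
    have "(rsq S \<xi> powr (a / 2) * cmod (\<psi> \<xi>))\<^sup>2 \<le> (\<Prod>b\<in>S. \<bar>\<xi> \<bullet> b\<bar> powr p) * (B\<^sup>2 / (1 + norm \<xi>) ^ (2 * DIM('a)))"
      unfolding power_mult_distrib by (intro mult_mono 1 2 prod_nonneg) auto
    also have "\<dots> = B\<^sup>2 * ?f \<xi>" by simp
    finally show ?case by (simp only: ennreal_mult'[symmetric] zero_le_power2 ennreal_leI)
  qed
  also have "\<dots> = ennreal (B\<^sup>2) * (\<integral>\<^sup>+\<xi>. ennreal (?f \<xi>) \<partial>lborel)"
    by (rule nn_integral_cmult) measurable
  also have "\<dots> < \<infinity>" using integrable_powr_decay[OF S p] by (simp add: ennreal_mult_less_top)
  finally show ?thesis .
qed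

text \<open>The phase \<open>|\<xi>|\<^sup>m\<close> is the case \<open>S = Basis\<close>, \<open>\<beta> = 0\<close>, \<open>\<sigma> = 1\<close>; the phase \<open>|\<xi>\<^sub>k|\<^sup>m - |\<xi>'|\<^sup>m\<close> is the case in
which \<open>S\<close> omits the \<open>k\<close>-th basis vector, \<open>\<beta>(\<xi>) = |\<xi>\<^sub>k|\<^sup>m\<close> and \<open>\<sigma> = - 1\<close>.\<close>

definition radial_phase :: "'a::euclidean_space set \<Rightarrow> real \<Rightarrow> ('a \<Rightarrow> real) \<Rightarrow> bool" where
  "radial_phase S m q \<longleftrightarrow>
     (\<exists>\<beta> \<sigma>. \<beta> \<in> borel_measurable borel \<and> (\<forall>x y. (\<forall>b\<in>Basis - S. x \<bullet> b = y \<bullet> b) \<longrightarrow> \<beta> x = \<beta> y) \<and>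
        \<bar>\<sigma>\<bar> = 1 \<and> q = (\<lambda>\<xi>. \<beta> \<xi> + \<sigma> * rsq S \<xi> powr (m / 2)))"

lemma radial_phase_measurable: "radial_phase S m q \<Longrightarrow> q \<in> borel_measurable borel"
  unfolding radial_phase_def by (elim exE conjE) simp

text \<open>The integral left over by the Schur test: \<open>\<epsilon>\<close> is the parameter of the time cutoff, \<open>\<delta>\<close> that of the cutoff in the
coordinates outside \<open>S\<close>, and \<open>c\<close> will be \<open>q \<xi>\<close>.\<close>

definition phase_kernel ::
  "'a::euclidean_space set \<Rightarrow> real \<Rightarrow> real \<Rightarrow> ('a \<Rightarrow> real) \<Rightarrow> real \<Rightarrow> real \<Rightarrow> real \<Rightarrow> 'a \<Rightarrow> ennreal" where
  "phase_kernel S m s q \<epsilon> \<delta> c \<xi> =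
     (\<integral>\<^sup>+\<tau>. ennreal (\<tau> powr (s - 1)) *
        (\<integral>\<^sup>+\<eta>. ennreal (rsq S \<eta> powr (m / 2 - s)) * ennreal (gauss_hat1 \<epsilon> (c - q \<eta>))
           * ennreal (gauss_hat (\<lambda>b. if b \<in> S then \<tau> else \<delta>) (\<xi> - \<eta>)) \<partial>lborel) * indicator {0<..} \<tau> \<partial>lborel)"

text \<open>For fixed coordinates outside \<open>S\<close> the function \<open>\<beta>\<close> is a constant, which \<open>radial_kernel_bound\<close> tolerates.
The Gaussians in the coordinates outside \<open>S\<close> contribute \<open>2 * pi\<close> each.\<close>

lemma phase_kernel_bound:
  fixes S :: "'a::euclidean_space set"
  assumes S: "S \<subseteq> Basis" and s: "1 / 2 < s" "s < real (card S) / 2" and m: "0 < m"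
  obtains C :: real where "0 \<le> C"
    "\<And>(q :: 'a \<Rightarrow> real) \<epsilon> \<delta> c \<xi>. radial_phase S m q \<Longrightarrow> 0 < \<epsilon> \<Longrightarrow> 0 < \<delta> \<Longrightarrow> phase_kernel S m s q \<epsilon> \<delta> c \<xi> \<le> ennreal C"
proof -
  have fS: "finite S" by (rule finite_subset[OF S finite_Basis])
  define I where "I = Basis - S"
  have I: "finite I" "I \<inter> S = {}" "I \<union> S = Basis" using S by (auto simp: I_def)
  obtain C0 where C0: "0 \<le> C0" and core:
    "\<And>(H :: real \<Rightarrow> ennreal) x c \<sigma>. H \<in> borel_measurable borel \<Longrightarrow> \<bar>\<sigma>\<bar> = 1 \<Longrightarrow>
      radial_kernel S m s H c \<sigma> x \<le> ennreal C0 * (\<integral>\<^sup>+l. H l \<partial>lborel)"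
    using radial_kernel_bound[OF fS s m] by blast
  define C where "C = C0 * (2 * pi) * (2 * pi) ^ card I"
  show ?thesis
  proof (rule that[of C])
    show "0 \<le> C" using C0 by (simp add: C_def)
    fix q :: "'a \<Rightarrow> real" and \<epsilon> \<delta> c :: real and \<xi> :: 'a
    assume q: "radial_phase S m q" and \<epsilon>: "0 < \<epsilon>" and \<delta>: "0 < \<delta>"
    obtain \<beta> \<sigma> where \<beta>m [measurable]: "\<beta> \<in> borel_measurable borel" and \<beta>: "\<forall>x y. (\<forall>b\<in>Basis - S. x \<bullet> b = y \<bullet> b) \<longrightarrow> \<beta> x = \<beta> y"
      and \<sigma>: "\<bar>\<sigma>\<bar> = 1" and q_eq: "q = (\<lambda>\<xi>. \<beta> \<xi> + \<sigma> * rsq S \<xi> powr (m / 2))"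
      using q unfolding radial_phase_def by blast
    note [measurable] = radial_phase_measurable[OF q]
    let ?\<eta> = "\<lambda>u w. (\<Sum>b\<in>Basis. merge I S (u, w) b *\<^sub>R b)"
    let ?R = "\<lambda>\<tau> b' w. ennreal (gauss_hat1 \<epsilon> ((c - b') + (- \<sigma>) * (\<Sum>b\<in>S. (w b)\<^sup>2) powr (m / 2)))
        * ennreal ((\<Sum>b\<in>S. (w b)\<^sup>2) powr (m / 2 - s)) * (\<Prod>b\<in>S. ennreal (gauss_hat1 \<tau> (\<xi> \<bullet> b - w b)))"
    define f where "f \<tau> \<eta> = ennreal (rsq S \<eta> powr (m / 2 - s)) * ennreal (gauss_hat1 \<epsilon> (c - q \<eta>))
         * ennreal (gauss_hat (\<lambda>b. if b \<in> S then \<tau> else \<delta>) (\<xi> - \<eta>))" for \<tau> \<eta>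
    have [measurable]: "f \<tau> \<in> borel_measurable borel" for \<tau> unfolding f_def by measurable
    define \<beta>' where "\<beta>' u = \<beta> (\<Sum>b\<in>I. u b *\<^sub>R b)" for u
    have [measurable]: "\<beta>' \<in> borel_measurable (lborel_on I)" unfolding \<beta>'_def by measurable
    define G where "G u = (\<Prod>b\<in>I. ennreal (gauss_hat1 \<delta> (\<xi> \<bullet> b - u b)))" for u
    have [measurable]: "G \<in> borel_measurable (lborel_on I)" unfolding G_def by measurable
    define W where "W \<tau> u = (\<integral>\<^sup>+w. ?R \<tau> (\<beta>' u) w \<partial>lborel_on S)" for \<tau> u
    interpret PS: sigma_finite_measure "lborel_on S"
      by (rule lborel_PiM.sigma_finite[OF fS])
    interpret PI: sigma_finite_measure "lborel_on I"
      by (rule lborel_PiM.sigma_finite[OF I(1)])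
    interpret P: pair_sigma_finite lborel "lborel_on I" ..
    have [measurable]: "(\<lambda>z. W (fst z) (snd z)) \<in> borel_measurable (lborel \<Otimes>\<^sub>M lborel_on I)"
      unfolding W_def by measurable
    have [measurable]: "(\<lambda>(\<tau>, u). W \<tau> u) \<in> borel_measurable (lborel \<Otimes>\<^sub>M lborel_on I)"
      unfolding W_def by measurable
    have W1 [measurable]: "W \<tau> \<in> borel_measurable (lborel_on I)" for \<tau>
      unfolding W_def by measurable
    have split: "(\<integral>\<^sup>+\<eta>. f \<tau> \<eta> \<partial>lborel) = (\<integral>\<^sup>+u. G u * W \<tau> u \<partial>lborel_on I)" if \<tau>: "0 < \<tau>" for \<tau>
    proof -
      have "(\<integral>\<^sup>+\<eta>. f \<tau> \<eta> \<partial>lborel) = (\<integral>\<^sup>+y. f \<tau> (\<Sum>b\<in>Basis. y b *\<^sub>R b) \<partial>lborel_on (I \<union> S))"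
        unfolding I(3) by (subst lborel_eq) (subst nn_integral_distr, auto)
      also have "\<dots> = (\<integral>\<^sup>+u. (\<integral>\<^sup>+w. f \<tau> (?\<eta> u w) \<partial>lborel_on S) \<partial>lborel_on I)"
        by (rule lborel_PiM.product_nn_integral_fold[OF I(2) I(1) fS]) (unfold I(3), measurable)
      also have "\<dots> = (\<integral>\<^sup>+u. G u * W \<tau> u \<partial>lborel_on I)"
      proof (rule nn_integral_cong)
        fix u :: "'a \<Rightarrow> real"
        have "(\<integral>\<^sup>+w. f \<tau> (?\<eta> u w) \<partial>lborel_on S)
          = (\<integral>\<^sup>+w. G u * (?R \<tau> (\<beta>' u) w) \<partial>lborel_on S)"
        proof (rule nn_integral_cong)
          fix w :: "'a \<Rightarrow> real"
          define \<eta> where "\<eta> = (?\<eta> u w)"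
          have \<eta>b: "\<eta> \<bullet> b = merge I S (u, w) b" if "b \<in> Basis" for b using that by (simp add: \<eta>_def)
          have \<eta>S: "\<eta> \<bullet> b = w b" if "b \<in> S" for b using that S I by (subst \<eta>b) (auto simp: merge_def)
          have \<eta>I: "\<eta> \<bullet> b = u b" if "b \<in> I" for b using that S I by (subst \<eta>b) (auto simp: merge_def)
          have 1: "rsq S \<eta> = (\<Sum>b\<in>S. (w b)\<^sup>2)" unfolding rsq_def by (intro sum.cong) (auto simp: \<eta>S)
          have 2: "\<beta> \<eta> = \<beta>' u"
            unfolding \<beta>'_def
          proof (rule \<beta>[rule_format])
            fix b assume b: "b \<in> Basis - S"
            have "(\<Sum>i\<in>I. u i *\<^sub>R i) \<bullet> b = (\<Sum>i\<in>I. u i * (if i = b then 1 else 0))"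
              using b unfolding inner_sum_left by (intro sum.cong) (auto simp: I_def inner_Basis)
            also have "\<dots> = u b" using b I(1) by (simp add: I_def if_distrib cong: if_cong)
            finally show "\<eta> \<bullet> b = (\<Sum>i\<in>I. u i *\<^sub>R i) \<bullet> b" using \<eta>I[of b] b by (simp add: I_def)
          qed
          have "gauss_hat (\<lambda>b. if b \<in> S then \<tau> else \<delta>) (\<xi> - \<eta>) = (\<Prod>b\<in>I \<union> S. gauss_hat1 (if b \<in> S then \<tau> else \<delta>) ((\<xi> - \<eta>) \<bullet> b))"
            unfolding gauss_hat_def I(3) ..
          also have "\<dots> = (\<Prod>b\<in>I. gauss_hat1 \<delta> (\<xi> \<bullet> b - u b)) * (\<Prod>b\<in>S. gauss_hat1 \<tau> (\<xi> \<bullet> b - w b))"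
            using I by (subst prod.union_disjoint) (auto simp: fS inner_diff_left \<eta>I \<eta>S intro!: arg_cong2[where f="(*)"] prod.cong)
          finally have "ennreal (gauss_hat (\<lambda>b. if b \<in> S then \<tau> else \<delta>) (\<xi> - \<eta>)) = G u * (\<Prod>b\<in>S. ennreal (gauss_hat1 \<tau> (\<xi> \<bullet> b - w b)))"
            using \<tau> \<delta> by (simp add: G_def prod_ennreal ennreal_mult gauss_hat1_nonneg prod_nonneg)
          then show "f \<tau> (?\<eta> u w) = G u * (?R \<tau> (\<beta>' u) w)"
            unfolding \<eta>_def[symmetric] f_def q_eq 1 2 by (simp add: mult_ac diff_diff_eq)
        qed
        also have "\<dots> = G u * W \<tau> u"
          unfolding W_def by (rule nn_integral_cmult) measurable
        finally show "(\<integral>\<^sup>+w. f \<tau> (?\<eta> u w) \<partial>lborel_on S) = G u * W \<tau> u" .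
      qed
      finally show ?thesis .
    qed
    have "(\<integral>\<^sup>+\<tau>. ennreal (\<tau> powr (s - 1)) * (\<integral>\<^sup>+\<eta>. f \<tau> \<eta> \<partial>lborel) * indicator {0<..} \<tau> \<partial>lborel)
       = (\<integral>\<^sup>+\<tau>. (\<integral>\<^sup>+u. G u * (ennreal (\<tau> powr (s - 1)) * W \<tau> u * indicator {0<..} \<tau>) \<partial>lborel_on I) \<partial>lborel)"
    proof (rule nn_integral_cong)
      fix \<tau> :: real
      have "(\<integral>\<^sup>+u. G u * (ennreal (\<tau> powr (s - 1)) * W \<tau> u * indicator {0<..} \<tau>) \<partial>lborel_on I) = (\<integral>\<^sup>+u. (ennreal (\<tau> powr (s - 1)) * indicator {0<..} \<tau>) * (G u * W \<tau> u) \<partial>lborel_on I)"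
        by (simp add: mult_ac)
      also have "\<dots> = (ennreal (\<tau> powr (s - 1)) * indicator {0<..} \<tau>) * (\<integral>\<^sup>+u. G u * W \<tau> u \<partial>lborel_on I)"
        by (rule nn_integral_cmult) measurable
      finally show "ennreal (\<tau> powr (s - 1)) * (\<integral>\<^sup>+\<eta>. f \<tau> \<eta> \<partial>lborel) * indicator {0<..} \<tau> = (\<integral>\<^sup>+u. G u * (ennreal (\<tau> powr (s - 1)) * W \<tau> u * indicator {0<..} \<tau>) \<partial>lborel_on I)"
        using split[of \<tau>] by (cases "0 < \<tau>") (simp_all add: mult_ac)
    qed
    also have "\<dots> = (\<integral>\<^sup>+u. (\<integral>\<^sup>+\<tau>. G u * (ennreal (\<tau> powr (s - 1)) * W \<tau> u * indicator {0<..} \<tau>) \<partial>lborel) \<partial>lborel_on I)"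
      by (rule P.Fubini'[symmetric]) measurable
    also have "\<dots> \<le> (\<integral>\<^sup>+u. G u * ennreal (C0 * (2 * pi)) \<partial>lborel_on I)"
    proof (rule nn_integral_mono)
      fix u assume u: "u \<in> space (lborel_on I)"
      have [measurable]: "(\<lambda>\<tau>. W \<tau> u) \<in> borel_measurable lborel"
        using u unfolding W_def by measurable
      have "(\<integral>\<^sup>+\<tau>. G u * (ennreal (\<tau> powr (s - 1)) * W \<tau> u * indicator {0<..} \<tau>) \<partial>lborel) = G u * (\<integral>\<^sup>+\<tau>. ennreal (\<tau> powr (s - 1)) * W \<tau> u * indicator {0<..} \<tau> \<partial>lborel)"
        by (rule nn_integral_cmult) measurable
      also have "(\<integral>\<^sup>+\<tau>. ennreal (\<tau> powr (s - 1)) * W \<tau> u * indicator {0<..} \<tau> \<partial>lborel) \<le> ennreal C0 * (\<integral>\<^sup>+l. ennreal (gauss_hat1 \<epsilon> l) \<partial>lborel)"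
        using core[where H="\<lambda>l. ennreal (gauss_hat1 \<epsilon> l)" and c="c - \<beta>' u" and \<sigma>="- \<sigma>" and x="\<lambda>b. \<xi> \<bullet> b"] \<sigma>
        unfolding radial_kernel_def W_def by simp
      also have "(\<integral>\<^sup>+l. ennreal (gauss_hat1 \<epsilon> l) \<partial>lborel) = ennreal (2 * pi)"
        using nn_integral_gauss_hat1[OF \<epsilon>, of 0] by (simp add: gauss_hat1_def)
      finally show "(\<integral>\<^sup>+\<tau>. G u * (ennreal (\<tau> powr (s - 1)) * W \<tau> u * indicator {0<..} \<tau>) \<partial>lborel) \<le> G u * ennreal (C0 * (2 * pi))"
        using C0 by (simp add: ennreal_mult mult_left_mono)
    qed
    also have "\<dots> = (\<integral>\<^sup>+u. G u \<partial>lborel_on I) * ennreal (C0 * (2 * pi))"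
      by (rule nn_integral_multc) measurable
    also have "(\<integral>\<^sup>+u. G u \<partial>lborel_on I) = (\<Prod>b\<in>I. \<integral>\<^sup>+y. ennreal (gauss_hat1 \<delta> (\<xi> \<bullet> b - y)) \<partial>lborel)"
      unfolding G_def by (rule lborel_PiM.product_nn_integral_prod[OF I(1)]) measurable
    also have "\<dots> = ennreal ((2 * pi) ^ card I)"
      by (simp add: nn_integral_gauss_hat1[OF \<delta>] ennreal_power)
    also have "ennreal ((2 * pi) ^ card I) * ennreal (C0 * (2 * pi)) = ennreal C"
      using C0 by (simp add: C_def ennreal_mult[symmetric] mult_ac)
    finally show "phase_kernel S m s q \<epsilon> \<delta> c \<xi> \<le> ennreal C"
      unfolding phase_kernel_def f_def .
  qed
qed

section \<open>The estimate for integrable Fourier data\<close>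

text \<open>For \<open>\<tau> \<le> \<rho>\<^sup>-\<^sup>2\<close> the Gaussian is at least \<open>exp (- 1 / 2)\<close>, and \<open>\<tau>\<^sup>s\<^sup>-\<^sup>1\<close> has integral \<open>\<rho>\<^sup>-\<^sup>2\<^sup>s / s\<close> over this range.
At \<open>\<rho> = 0\<close> the left side is \<open>0\<close> by the convention for \<open>powr\<close>.\<close>

lemma weight_le_gaussians:
  fixes \<rho> s :: real
  assumes s: "0 < s" and \<rho>: "0 \<le> \<rho>"
  shows "ennreal (\<rho> powr (- 2 * s)) \<le> ennreal (s * exp (1 / 2)) * (\<integral>\<^sup>+\<tau>. ennreal (\<tau> powr (s - 1)) * ennreal (exp (- (\<tau> * \<rho>\<^sup>2 / 2))) * indicator {0<..} \<tau> \<partial>lborel)"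
proof (cases "0 < \<rho>")
  case False
  with \<rho> show ?thesis by simp
next
  case True
  define T where "T = 1 / \<rho>\<^sup>2"
  have T: "0 < T" using True by (simp add: T_def)
  have "ennreal (exp (- (1 / 2))) * ennreal (T powr s / s) = (\<integral>\<^sup>+\<tau>. ennreal (exp (- (1 / 2))) * ennreal (\<tau> powr (s - 1) * indicator {0..T} \<tau>) \<partial>lborel)"
    using nn_integral_powr_near_0[of "s - 1" T] s T by (simp add: nn_integral_cmult)
  also have "\<dots> \<le> (\<integral>\<^sup>+\<tau>. ennreal (\<tau> powr (s - 1)) * ennreal (exp (- (\<tau> * \<rho>\<^sup>2 / 2))) * indicator {0<..} \<tau> \<partial>lborel)"
  proof (rule nn_integral_mono_AE, use AE_lborel_singleton[of 0] in eventually_elim)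
    case (elim \<tau>)
    show ?case
    proof (cases "0 < \<tau> \<and> \<tau> \<le> T")
      case t: True
      then have "\<tau> * \<rho>\<^sup>2 \<le> 1" using True by (simp add: T_def field_simps)
      then have "exp (- (1 / 2)) \<le> exp (- (\<tau> * \<rho>\<^sup>2 / 2))" by simp
      then have "ennreal (exp (- (1 / 2))) * ennreal (\<tau> powr (s - 1)) \<le> ennreal (\<tau> powr (s - 1)) * ennreal (exp (- (\<tau> * \<rho>\<^sup>2 / 2)))"
        by (subst mult.commute) (intro mult_left_mono ennreal_leI, auto)
      with t show ?thesis by simp
    qed (use elim in \<open>auto simp: indicator_def\<close>)
  qed
  finally have "ennreal (s * exp (1 / 2)) * (ennreal (exp (- (1 / 2))) * ennreal (T powr s / s)) \<le> ennreal (s * exp (1 / 2)) * (\<integral>\<^sup>+\<tau>. ennreal (\<tau> powr (s - 1)) * ennreal (exp (- (\<tau> * \<rho>\<^sup>2 / 2))) * indicator {0<..} \<tau> \<partial>lborel)"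
    by (rule mult_left_mono) simp
  moreover have "ennreal (s * exp (1 / 2)) * (ennreal (exp (- (1 / 2))) * ennreal (T powr s / s)) = ennreal (\<rho> powr (- 2 * s))"
  proof -
    have "exp (1 / 2) * exp (- (1 / 2)) = (1::real)" by (simp add: exp_minus)
    then have "s * exp (1 / 2) * (exp (- (1 / 2)) * (T powr s / s)) = T powr s" using s by (simp add: field_simps)
    also have "T powr s = \<rho> powr (- 2 * s)"
    proof -
      have "T = \<rho> powr (-2)" using True by (simp add: T_def powr_minus divide_inverse)
      then show ?thesis by (simp add: powr_powr)
    qed
    finally show ?thesis using s by (simp add: ennreal_mult[symmetric])
  qed
  ultimately show ?thesis by simp
qed

text \<open>The basis of space-time consists of the vectors \<open>(1, 0)\<close> and \<open>(0, b)\<close>; the former is recognised by its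
second component.\<close>

definition pair_weight :: "real \<Rightarrow> ('a::euclidean_space \<Rightarrow> real) \<Rightarrow> real \<times> 'a \<Rightarrow> real" where
  "pair_weight \<epsilon> w = (\<lambda>(a, b). if b = 0 then \<epsilon> else w b)"

lemma prod_Basis_pair:
  fixes F :: "real \<times> 'a::euclidean_space \<Rightarrow> real"
  shows "(\<Prod>b\<in>Basis. F b) = F (1, 0) * (\<Prod>b\<in>Basis. F (0, b))"
proof -
  have "(\<lambda>u::real. (u, 0::'a)) ` Basis \<inter> (\<lambda>u. (0, u)) ` Basis = {}" by (auto simp: nonzero_Basis)
  then show ?thesis
    unfolding Basis_prod_def by (subst prod.union_disjoint) (auto simp: prod.reindex inj_on_def)
qed

lemma gauss_hat_pair: "gauss_hat (pair_weight \<epsilon> w) (r, x) = gauss_hat1 \<epsilon> r * gauss_hat w x"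
  unfolding gauss_hat_def prod_Basis_pair
  by (auto simp: pair_weight_def nonzero_Basis intro!: arg_cong2[where f="(*)"] prod.cong)

lemma gauss_pair: "gauss (pair_weight \<epsilon> w) (t, x) = exp (- (\<epsilon> * t\<^sup>2 / 2)) * gauss w x"
  unfolding gauss_def prod_Basis_pair
  by (auto simp: pair_weight_def nonzero_Basis intro!: arg_cong2[where f="(*)"] prod.cong)

lemma gauss_ge:
  assumes "\<And>b. b \<in> Basis \<Longrightarrow> w b \<le> c"
  shows "exp (- (c * (norm x)\<^sup>2 / 2)) \<le> gauss w x"
proof -
  have "exp (- (c * (norm x)\<^sup>2 / 2)) = exp (\<Sum>b\<in>Basis. - (c * (x \<bullet> b)\<^sup>2 / 2))"
  proof -
    have "(norm x)\<^sup>2 = (\<Sum>b\<in>Basis. (x \<bullet> b)\<^sup>2)"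
      unfolding rsq_Basis[symmetric] rsq_def ..
    then show ?thesis by (simp add: sum_negf sum_distrib_left sum_divide_distrib)
  qed
  also have "\<dots> = (\<Prod>b\<in>Basis. exp (- (c * (x \<bullet> b)\<^sup>2 / 2)))" by (rule exp_sum) simp
  also have "\<dots> \<le> gauss w x"
    unfolding gauss_def using assms by (intro prod_mono) (auto intro!: mult_right_mono)
  finally show ?thesis .
qed

text \<open>The function of space-time with phase \<open>q\<close> and Fourier data \<open>f\<close>, without the factor
\<open>(2 * pi) ^ DIM('a)\<close> of the inverse Fourier transform.\<close>

definition wave :: "('a::euclidean_space \<Rightarrow> real) \<Rightarrow> ('a \<Rightarrow> complex) \<Rightarrow> real \<times> 'a \<Rightarrow> complex" where
  "wave q f z = (\<integral>\<xi>. exp (\<i> * of_real (z \<bullet> (q \<xi>, \<xi>))) * f \<xi> \<partial>lborel)"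

lemma wave_measurable [measurable (raw)]:
  assumes [measurable]: "q \<in> borel_measurable borel" "f \<in> borel_measurable borel"
  shows "wave q f \<in> borel_measurable borel"
  unfolding wave_def[abs_def] by (rule lborel.borel_measurable_lebesgue_integral) measurable

text \<open>Write the weight as a superposition of Gaussians, apply the Schur test at each scale \<open>\<tau>\<close>, and integrate the
result over \<open>\<tau>\<close>; the inner integral is then \<open>phase_kernel\<close>. The Gaussian in all coordinates of \<open>x\<close> is
smaller than the one in the coordinates of \<open>S\<close> only, which accounts for the weight \<open>|x|\<^sup>-\<^sup>s\<close> also when \<open>S\<close> is not the whole basis.\<close>

theorem smoothing_apriori:
  fixes S :: "'a::euclidean_space set"
  assumes S: "S \<subseteq> Basis" and s: "1 / 2 < s" "s < real (card S) / 2" and m: "0 < m"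
  obtains A :: real where "0 \<le> A"
    "\<And>(q :: 'a \<Rightarrow> real) (g :: 'a \<Rightarrow> complex). radial_phase S m q \<Longrightarrow> g \<in> borel_measurable borel \<Longrightarrow>
      integrable lborel (\<lambda>\<xi>. of_real (rsq S \<xi> powr ((m / 2 - s) / 2)) * g \<xi>) \<Longrightarrow>
      (\<integral>\<^sup>+z. ennreal (norm (snd z) powr (- 2 * s) * (cmod (wave q (\<lambda>\<xi>. of_real (rsq S \<xi> powr ((m / 2 - s) / 2)) * g \<xi>) z))\<^sup>2) \<partial>lborel)
      \<le> ennreal A * L2_sq lborel g"
proof -
  obtain C where C: "0 \<le> C" and kernel:
    "\<And>(q :: 'a \<Rightarrow> real) \<epsilon> \<delta> c \<xi>. radial_phase S m q \<Longrightarrow> 0 < \<epsilon> \<Longrightarrow> 0 < \<delta> \<Longrightarrow> phase_kernel S m s q \<epsilon> \<delta> c \<xi> \<le> ennreal C"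
    using phase_kernel_bound[OF S s m] by blast
  define k where "k = s * exp (1 / 2)"
  have k: "0 \<le> k" using s by (simp add: k_def)
  define A where "A = k * C"
  show ?thesis
  proof (rule that[of A])
    show "0 \<le> A" using k C by (simp add: A_def)
    fix q :: "'a \<Rightarrow> real" and g :: "'a \<Rightarrow> complex"
    assume q: "radial_phase S m q" and gm [measurable]: "g \<in> borel_measurable borel"
    note [measurable] = radial_phase_measurable[OF q]
    define v where "v \<xi> = rsq S \<xi> powr ((m / 2 - s) / 2)" for \<xi>
    assume "integrable lborel (\<lambda>\<xi>. of_real (rsq S \<xi> powr ((m / 2 - s) / 2)) * g \<xi>)"
    then have vg: "integrable lborel (\<lambda>\<xi>. of_real (v \<xi>) * g \<xi>)" by (simp add: v_def)
    have vm [measurable]: "v \<in> borel_measurable borel" unfolding v_def by measurable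
    have v0: "0 \<le> v \<xi>" for \<xi> by (simp add: v_def)
    have v2: "(v \<xi>)\<^sup>2 = rsq S \<xi> powr (m / 2 - s)" for \<xi>
      by (simp add: v_def power2_eq_square powr_add[symmetric])
    define p where "p \<xi> = (q \<xi>, \<xi>)" for \<xi>
    have pm [measurable]: "p \<in> borel_measurable borel" unfolding p_def by measurable
    define U where "U = wave q (\<lambda>\<xi>. of_real (v \<xi>) * g \<xi>)"
    have U: "U z = (\<integral>\<xi>. exp (\<i> * of_real (z \<bullet> p \<xi>)) * (of_real (v \<xi>) * g \<xi>) \<partial>lborel)" for z
      unfolding U_def wave_def p_def ..
    have [measurable]: "U \<in> borel_measurable borel" unfolding U_def by measurable
    define I where "I = L2_sq lborel g"
    \<comment> \<open>The cutoff in time and space; the spatial factor adds \<open>\<epsilon>\<close> to the parameter of every coordinate.\<close>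
    define E where "E \<epsilon> z = exp (- (\<epsilon> * (fst z)\<^sup>2 / 2)) * exp (- (\<epsilon> * (norm (snd z))\<^sup>2 / 2))" for \<epsilon> and z :: "real \<times> 'a"
    have [measurable]: "E \<epsilon> \<in> borel_measurable borel" for \<epsilon>
      unfolding E_def by (intro borel_measurable_continuous_onI continuous_intros) auto
    have [measurable]: "(\<lambda>z::real \<times> 'a. norm (snd z)) \<in> borel_measurable borel"
      by (intro borel_measurable_continuous_onI continuous_intros)
    have E0: "0 \<le> E \<epsilon> z" for \<epsilon> z by (simp add: E_def)
    let ?N = "\<lambda>z. ennreal (norm (snd z) powr (- 2 * s) * (cmod (U z))\<^sup>2)"
    let ?e = "\<lambda>\<tau> z. ennreal (exp (- (\<tau> * (norm (snd z))\<^sup>2 / 2)))"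
    let ?X = "\<lambda>\<epsilon> \<tau> z. ennreal (\<tau> powr (s - 1)) * indicator {0<..} \<tau> * (ennreal (E \<epsilon> z * (cmod (U z))\<^sup>2) * ?e \<tau> z)"
    let ?Y = "\<lambda>B \<tau> \<xi>. ennreal ((cmod (g \<xi>))\<^sup>2) * (ennreal (\<tau> powr (s - 1)) * B \<tau> \<xi> * indicator {0<..} \<tau>)"
    have main: "(\<integral>\<^sup>+z. ennreal (E \<epsilon> z) * ?N z \<partial>lborel) \<le> ennreal A * I" if \<epsilon>: "0 < \<epsilon>" for \<epsilon>
    proof -
      \<comment> \<open>Coordinates outside \<open>S\<close> keep only the cutoff, so that their parameter does not depend on \<open>\<tau>\<close>.\<close>
      define w where "w \<tau> = (\<lambda>b::'a. if b \<in> S then \<tau> else \<epsilon>)" for \<tau>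
      define B where "B \<tau> \<xi> = (\<integral>\<^sup>+\<eta>. ennreal (rsq S \<eta> powr (m / 2 - s)) * ennreal (gauss_hat1 \<epsilon> (q \<xi> - q \<eta>)) * ennreal (gauss_hat (w \<tau>) (\<xi> - \<eta>)) \<partial>lborel)" for \<tau> \<xi>
      have [measurable]: "(\<lambda>z. gauss_hat (w (fst z)) (snd z)) \<in> borel_measurable (borel \<Otimes>\<^sub>M borel)"
        unfolding gauss_hat_def w_def by measurable
      have [measurable]: "(\<lambda>(\<tau>, \<xi>). B \<tau> \<xi>) \<in> borel_measurable (lborel \<Otimes>\<^sub>M lborel)"
        unfolding B_def gauss_hat_def w_def by measurable
      have [measurable]: "B \<tau> \<in> borel_measurable borel" "(\<lambda>\<tau>. B \<tau> \<xi>) \<in> borel_measurable borel" for \<tau> \<xi>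
        unfolding B_def gauss_hat_def w_def by measurable
      have one: "(\<integral>\<^sup>+z. ennreal (E \<epsilon> z * (cmod (U z))\<^sup>2) * ?e \<tau> z \<partial>lborel)
          \<le> (\<integral>\<^sup>+\<xi>. ennreal ((cmod (g \<xi>))\<^sup>2) * B \<tau> \<xi> \<partial>lborel)" if \<tau>: "0 < \<tau>" for \<tau>
      proof -
        have w: "0 < w \<tau> b" "w \<tau> b \<le> \<epsilon> + \<tau>" for b using \<epsilon> \<tau> by (auto simp: w_def)
        have cpos: "0 < pair_weight \<epsilon> (w \<tau>) b" for b using \<epsilon> w by (auto simp: pair_weight_def split: prod.splits)
        have "E \<epsilon> z * (cmod (U z))\<^sup>2 * exp (- (\<tau> * (norm (snd z))\<^sup>2 / 2)) \<le> gauss (pair_weight \<epsilon> (w \<tau>)) z * (cmod (U z))\<^sup>2" for z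
        proof -
          have "exp (- ((\<epsilon> + \<tau>) * (norm (snd z))\<^sup>2 / 2)) \<le> gauss (w \<tau>) (snd z)"
            by (rule gauss_ge) (rule w)
          then have "exp (- (\<epsilon> * (fst z)\<^sup>2 / 2)) * exp (- ((\<epsilon> + \<tau>) * (norm (snd z))\<^sup>2 / 2)) \<le> gauss (pair_weight \<epsilon> (w \<tau>)) (fst z, snd z)"
            unfolding gauss_pair by (intro mult_left_mono) auto
          also have "exp (- (\<epsilon> * (fst z)\<^sup>2 / 2)) * exp (- ((\<epsilon> + \<tau>) * (norm (snd z))\<^sup>2 / 2)) = E \<epsilon> z * exp (- (\<tau> * (norm (snd z))\<^sup>2 / 2))"
            unfolding E_def by (simp only: exp_add[symmetric]) (simp add: field_simps)
          finally have "E \<epsilon> z * exp (- (\<tau> * (norm (snd z))\<^sup>2 / 2)) * (cmod (U z))\<^sup>2 \<le> gauss (pair_weight \<epsilon> (w \<tau>)) z * (cmod (U z))\<^sup>2"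
            by (intro mult_right_mono) auto
          then show ?thesis by (simp only: mult_ac)
        qed
        then have "(\<integral>\<^sup>+z. ennreal (E \<epsilon> z * (cmod (U z))\<^sup>2) * ?e \<tau> z \<partial>lborel)
           \<le> (\<integral>\<^sup>+z. ennreal (gauss (pair_weight \<epsilon> (w \<tau>)) z * (cmod (U z))\<^sup>2) \<partial>lborel)"
          by (intro nn_integral_mono) (simp add: ennreal_mult[symmetric] E0 ennreal_leI)
        also have "\<dots> \<le> (\<integral>\<^sup>+\<xi>. ennreal ((cmod (g \<xi>))\<^sup>2) * (\<integral>\<^sup>+\<eta>. ennreal ((v \<eta>)\<^sup>2 * gauss_hat (pair_weight \<epsilon> (w \<tau>)) (p \<xi> - p \<eta>)) \<partial>lborel) \<partial>lborel)"
          unfolding U by (rule gaussian_schur[OF cpos vg pm vm gm v0])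
        also have "\<dots> = (\<integral>\<^sup>+\<xi>. ennreal ((cmod (g \<xi>))\<^sup>2) * B \<tau> \<xi> \<partial>lborel)"
          unfolding B_def p_def using \<epsilon> w
          by (simp add: gauss_hat_pair v2 ennreal_mult gauss_hat1_nonneg gauss_hat_nonneg mult.assoc)
        finally show ?thesis .
      qed
      have "(\<integral>\<^sup>+z. ennreal (E \<epsilon> z) * ?N z \<partial>lborel)
        \<le> (\<integral>\<^sup>+z. ennreal k * (\<integral>\<^sup>+\<tau>. ?X \<epsilon> \<tau> z \<partial>lborel) \<partial>lborel)"
      proof (rule nn_integral_mono)
        fix z :: "real \<times> 'a"
        define R where "R = (\<integral>\<^sup>+\<tau>. ennreal (\<tau> powr (s - 1)) * ?e \<tau> z * indicator {0<..} \<tau> \<partial>lborel)"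
        have "ennreal (norm (snd z) powr (- 2 * s)) \<le> ennreal k * R"
          unfolding k_def R_def using s by (intro weight_le_gaussians) auto
        then have "ennreal (E \<epsilon> z * (cmod (U z))\<^sup>2) * ennreal (norm (snd z) powr (- 2 * s)) \<le> ennreal (E \<epsilon> z * (cmod (U z))\<^sup>2) * (ennreal k * R)"
          by (rule mult_left_mono) simp
        also have "\<dots> = ennreal k * (ennreal (E \<epsilon> z * (cmod (U z))\<^sup>2) * R)" by (simp only: mult_ac)
        also have "ennreal (E \<epsilon> z * (cmod (U z))\<^sup>2) * R = (\<integral>\<^sup>+\<tau>. ennreal (E \<epsilon> z * (cmod (U z))\<^sup>2) * (ennreal (\<tau> powr (s - 1)) * ?e \<tau> z * indicator {0<..} \<tau>) \<partial>lborel)"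
          unfolding R_def by (rule nn_integral_cmult[symmetric]) measurable
        finally show "ennreal (E \<epsilon> z) * ?N z
          \<le> ennreal k * (\<integral>\<^sup>+\<tau>. ?X \<epsilon> \<tau> z \<partial>lborel)"
          by (simp add: ennreal_mult E0 mult_ac)
      qed
      also have "\<dots> = ennreal k * (\<integral>\<^sup>+z. (\<integral>\<^sup>+\<tau>. ?X \<epsilon> \<tau> z \<partial>lborel) \<partial>lborel)"
        by (rule nn_integral_cmult) measurable
      also have "(\<integral>\<^sup>+z. (\<integral>\<^sup>+\<tau>. ?X \<epsilon> \<tau> z \<partial>lborel) \<partial>lborel)
         = (\<integral>\<^sup>+\<tau>. (\<integral>\<^sup>+z. ?X \<epsilon> \<tau> z \<partial>lborel) \<partial>lborel)"
        by (rule lborel_pair.Fubini') measurable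
      also have "\<dots> \<le> (\<integral>\<^sup>+\<tau>. (\<integral>\<^sup>+\<xi>. ?Y B \<tau> \<xi> \<partial>lborel) \<partial>lborel)"
      proof (rule nn_integral_mono)
        fix \<tau> :: real
        define a where "a = ennreal (\<tau> powr (s - 1)) * indicator {0<..} \<tau>"
        have "(\<integral>\<^sup>+z. a * (ennreal (E \<epsilon> z * (cmod (U z))\<^sup>2) * ?e \<tau> z) \<partial>lborel)
            = a * (\<integral>\<^sup>+z. (ennreal (E \<epsilon> z * (cmod (U z))\<^sup>2) * ?e \<tau> z) \<partial>lborel)"
          by (rule nn_integral_cmult) measurable
        also have "\<dots> \<le> a * (\<integral>\<^sup>+\<xi>. ennreal ((cmod (g \<xi>))\<^sup>2) * B \<tau> \<xi> \<partial>lborel)"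
          using one[of \<tau>] by (cases "0 < \<tau>") (auto simp: a_def intro!: mult_left_mono)
        also have "\<dots> = (\<integral>\<^sup>+\<xi>. a * (ennreal ((cmod (g \<xi>))\<^sup>2) * B \<tau> \<xi>) \<partial>lborel)"
          by (rule nn_integral_cmult[symmetric]) measurable
        also have "\<dots> = (\<integral>\<^sup>+\<xi>. ?Y B \<tau> \<xi> \<partial>lborel)"
          by (intro nn_integral_cong) (simp only: a_def mult_ac)
        finally show "(\<integral>\<^sup>+z. ?X \<epsilon> \<tau> z \<partial>lborel)
          \<le> (\<integral>\<^sup>+\<xi>. ?Y B \<tau> \<xi> \<partial>lborel)"
          unfolding a_def .
      qed
      also have "\<dots> = (\<integral>\<^sup>+\<xi>. (\<integral>\<^sup>+\<tau>. ?Y B \<tau> \<xi> \<partial>lborel) \<partial>lborel)"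
        by (rule lborel_pair.Fubini'[symmetric]) measurable
      also have "\<dots> \<le> (\<integral>\<^sup>+\<xi>. ennreal ((cmod (g \<xi>))\<^sup>2) * ennreal C \<partial>lborel)"
      proof (rule nn_integral_mono)
        fix \<xi>
        have "(\<integral>\<^sup>+\<tau>. ?Y B \<tau> \<xi> \<partial>lborel) = ennreal ((cmod (g \<xi>))\<^sup>2) * (\<integral>\<^sup>+\<tau>. ennreal (\<tau> powr (s - 1)) * B \<tau> \<xi> * indicator {0<..} \<tau> \<partial>lborel)"
          by (rule nn_integral_cmult) measurable
        also have "\<dots> \<le> ennreal ((cmod (g \<xi>))\<^sup>2) * ennreal C"
        proof (rule mult_left_mono)
          show "(\<integral>\<^sup>+\<tau>. ennreal (\<tau> powr (s - 1)) * B \<tau> \<xi> * indicator {0<..} \<tau> \<partial>lborel) \<le> ennreal C"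
            using kernel[OF q \<epsilon> \<epsilon>] unfolding phase_kernel_def B_def w_def .
        qed simp
        finally show "(\<integral>\<^sup>+\<tau>. ?Y B \<tau> \<xi> \<partial>lborel) \<le> ennreal ((cmod (g \<xi>))\<^sup>2) * ennreal C" .
      qed
      also have "\<dots> = I * ennreal C" unfolding I_def by (rule nn_integral_multc) measurable
      finally have "(\<integral>\<^sup>+z. ennreal (E \<epsilon> z) * ?N z \<partial>lborel) \<le> ennreal k * (I * ennreal C)"
        by (simp add: mult_left_mono)
      also have "\<dots> = ennreal A * I" using k C by (simp add: A_def ennreal_mult mult_ac)
      finally show ?thesis .
    qed
    define h where "h n = 1 / real (Suc n)" for n
    have h: "0 < h n" for n by (auto simp: h_def)
    have h0: "h \<longlonglongrightarrow> 0" unfolding h_def by (rule LIMSEQ_Suc[OF lim_1_over_n])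
    have "(\<integral>\<^sup>+z. ?N z \<partial>lborel)
       = (\<integral>\<^sup>+z. liminf (\<lambda>n. ennreal (E (h n) z) * ?N z) \<partial>lborel)"
    proof (rule nn_integral_cong)
      fix z :: "real \<times> 'a"
      have "(\<lambda>n. E (h n) z) \<longlonglongrightarrow> exp (- (0 * (fst z)\<^sup>2 / 2)) * exp (- (0 * (norm (snd z))\<^sup>2 / 2))"
        unfolding E_def by (intro tendsto_intros h0) auto
      then have "(\<lambda>n. ennreal (E (h n) z * (norm (snd z) powr (- 2 * s) * (cmod (U z))\<^sup>2))) \<longlonglongrightarrow> ennreal (1 * (norm (snd z) powr (- 2 * s) * (cmod (U z))\<^sup>2))"
        by (intro tendsto_ennrealI tendsto_mult tendsto_const) simp
      then have "(\<lambda>n. ennreal (E (h n) z) * ?N z) \<longlonglongrightarrow> ?N z"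
        by (simp add: ennreal_mult E0)
      then show "?N z = liminf (\<lambda>n. ennreal (E (h n) z) * ?N z)"
        by (intro lim_imp_Liminf[symmetric]) auto
    qed
    also have "\<dots> \<le> liminf (\<lambda>n. \<integral>\<^sup>+z. ennreal (E (h n) z) * ?N z \<partial>lborel)"
      by (rule nn_integral_liminf) measurable
    also have "\<dots> \<le> ennreal A * I"
      by (rule Liminf_le) (use main[OF h] in \<open>auto intro!: always_eventually\<close>)
    finally show "(\<integral>\<^sup>+z. ennreal (norm (snd z) powr (- 2 * s) * (cmod (wave q (\<lambda>\<xi>. of_real (rsq S \<xi> powr ((m / 2 - s) / 2)) * g \<xi>) z))\<^sup>2) \<partial>lborel)
      \<le> ennreal A * L2_sq lborel g"
      unfolding U_def I_def v_def .
  qed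
qed

section \<open>The estimate for square integrable data\<close>

definition weighted_spacetime_bound :: "('a::euclidean_space \<Rightarrow> real) \<Rightarrow> (real \<Rightarrow> 'a \<Rightarrow> complex) \<Rightarrow> real \<Rightarrow> bool" where
  "weighted_spacetime_bound w p C \<longleftrightarrow>
     (\<forall>\<phi>. in_L2 lborel \<phi> \<longrightarrow>
       (\<exists>u. (AE t in lborel. is_multiplier_image (p t) \<phi> (u t)) \<and>
            in_L2 lborel (\<lambda>(t, x). of_real (w x) * u t x) \<and>
            L2_norm lborel (\<lambda>(t, x). of_real (w x) * u t x) \<le> C * L2_norm lborel \<phi>))"

text \<open>By \<open>smoothing_apriori\<close>, applied to differences, the waves with truncated Fourier data form a Cauchy
sequence after multiplication by the weight; \<open>u\<close> is their limit divided by the weight. On almost every time slice a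
subsequence converges in the weighted space, so pairings with rapidly decreasing functions converge. For the truncated waves the
pairing with the transform of \<open>\<psi>\<close> is given by \<open>inverse_fourier_pairing\<close>, and its limit is the
pairing of \<open>\<psi>\<close> with the multiplier times the transform of \<open>\<phi>\<close>.\<close>

theorem smoothing_estimate:
  fixes S :: "'a::euclidean_space set"
  assumes S: "S \<subseteq> Basis" and s: "1 / 2 < s" "s < real (card S) / 2" and m: "0 < m"
    and a: "a = m / 2 - s"
  shows "\<exists>C. \<forall>q. radial_phase S m q \<longrightarrow>
      weighted_spacetime_bound (\<lambda>x. norm x powr (- s)) (\<lambda>t \<xi>. of_real (rsq S \<xi> powr (a / 2)) * exp (\<i> * of_real (t * q \<xi>))) C"
proof -
  obtain A where A: "0 \<le> A" and apriori: "\<And>(q :: 'a \<Rightarrow> real) (g :: 'a \<Rightarrow> complex). radial_phase S m q \<Longrightarrow> g \<in> borel_measurable borel \<Longrightarrow>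
      integrable lborel (\<lambda>\<xi>. of_real (rsq S \<xi> powr ((m / 2 - s) / 2)) * g \<xi>) \<Longrightarrow>
      (\<integral>\<^sup>+z. ennreal (norm (snd z) powr (- 2 * s) * (cmod (wave q (\<lambda>\<xi>. of_real (rsq S \<xi> powr ((m / 2 - s) / 2)) * g \<xi>) z))\<^sup>2) \<partial>lborel)
      \<le> ennreal A * L2_sq lborel g"
    using smoothing_apriori[OF S s m] by blast
  define c where "c = (2 * pi) ^ DIM('a)"
  have c: "0 < c" by (simp add: c_def)
  define A' where "A' = A / c\<^sup>2"
  have A': "0 \<le> A'" using A c by (simp add: A'_def)
  \<comment> \<open>One factor \<open>4\<close> comes from passing to the limit with \<open>L2_sum_le\<close>, the factor \<open>4 * c\<close> from \<open>L2_fourier_exists\<close>.\<close>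
  define C where "C = sqrt (4 * A' * (4 * c))"
  have C0: "0 \<le> C" using A' c by (simp add: C_def)
  show ?thesis
  proof (intro exI[of _ C] allI impI, unfold weighted_spacetime_bound_def, intro allI impI)
    fix q :: "'a \<Rightarrow> real" and \<phi> :: "'a \<Rightarrow> complex"
    assume q: "radial_phase S m q" and \<phi>: "in_L2 lborel \<phi>"
    note qm [measurable] = radial_phase_measurable[OF q]
    define v where "v \<xi> = rsq S \<xi> powr (a / 2)" for \<xi>
    have vm [measurable]: "v \<in> borel_measurable borel" unfolding v_def by measurable
    have v0: "0 \<le> v \<xi>" for \<xi> by (simp add: v_def)
    define W where "W x = norm x powr (- s)" for x :: 'a
    have Wm [measurable]: "W \<in> borel_measurable borel" unfolding W_def by measurable
    have W0: "0 < W x" if "x \<noteq> 0" for x using that by (simp add: W_def)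
    define L where "L = L2_norm lborel \<phi>"
    have L: "0 \<le> L" by (simp add: L_def L2_norm_def)
    have L2\<phi>: "L2_sq lborel \<phi> = ennreal (L\<^sup>2)"
      unfolding L_def by (rule in_L2_nn_integral(2)[OF \<phi>])
    obtain g where gm [measurable]: "g \<in> borel_measurable borel" and ft: "has_fourier_transform \<phi> g"
      and gle: "L2_sq lborel g \<le> ennreal (4 * c) * ennreal (L\<^sup>2)"
      using L2_fourier_exists[OF in_L2_nn_integral(1)[OF \<phi>]] unfolding c_def L2\<phi> by auto
    define Q where "Q = L2_sq lborel g"
    have Q: "Q < \<infinity>" using le_less_trans[OF gle] by (simp add: Q_def ennreal_mult_less_top)
    \<comment> \<open>Cutting off where \<open>\<xi>\<close> or the amplitude is large makes the Fourier data integrable.\<close>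
    define T where "T k = {\<xi>. norm \<xi> \<le> real k \<and> v \<xi> \<le> real k}" for k
    have Tm [measurable]: "T k \<in> sets borel" for k unfolding T_def by measurable
    have incT: "incseq T" by (auto simp: incseq_def T_def)
    have UT: "(\<Union>k. T k) = UNIV"
    proof (intro equalityI subsetI UNIV_I)
      fix \<xi> :: 'a
      obtain k where "max (norm \<xi>) (v \<xi>) \<le> real k" using real_arch_simple by blast
      then show "\<xi> \<in> (\<Union>k. T k)" by (auto simp: T_def)
    qed
    define G where "G k \<xi> = g \<xi> * indicator (T k) \<xi>" for k \<xi>
    have Gm [measurable]: "G k \<in> borel_measurable borel" for k unfolding G_def by measurable
    have vG: "integrable lborel (\<lambda>\<xi>. of_real (v \<xi>) * G k \<xi>)" for k
    proof -
      have "integrable lborel (\<lambda>\<xi>. g \<xi> * indicator (T k) \<xi>)"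
        by (rule L2_bounded_set_integrable[OF gm Tm]) (use Q in \<open>auto simp: Q_def T_def bounded_iff\<close>)
      then have "integrable lborel (\<lambda>\<xi>. of_real (real k) * (g \<xi> * indicator (T k) \<xi>))"
        by (rule integrable_mult_right)
      then show ?thesis
        by (rule Bochner_Integration.integrable_bound)
           (auto simp: G_def norm_mult T_def indicator_def v0 intro!: AE_I2 mult_right_mono)
    qed
    define e where "e k = (\<integral>\<^sup>+x. ennreal ((cmod (g x))\<^sup>2) * indicator (- T k) x \<partial>lborel)" for k
    have e0: "e \<longlonglongrightarrow> 0"
      unfolding e_def by (rule tail_tendsto_0) (use Q incT UT in \<open>auto simp: Q_def\<close>)
    have eQ: "e k \<le> Q" for k unfolding e_def Q_def by (intro nn_integral_mono) (auto simp: indicator_def)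
    define V where "V k z = wave q (\<lambda>\<xi>. of_real (v \<xi>) * G k \<xi>) z / of_real c" for k z
    have Vm [measurable]: "V k \<in> borel_measurable borel" for k unfolding V_def[abs_def] by measurable
    have [measurable]: "(\<lambda>z::real \<times> 'a. W (snd z)) \<in> borel_measurable borel"
    proof -
      have "(\<lambda>z::real \<times> 'a. norm (snd z)) \<in> borel_measurable borel"
        by (intro borel_measurable_continuous_onI continuous_intros)
      then show ?thesis unfolding W_def by measurable
    qed
    have est: "(\<integral>\<^sup>+z. ennreal ((W (snd z) * cmod (wave q (\<lambda>\<xi>. of_real (v \<xi>) * f \<xi>) z / of_real c))\<^sup>2) \<partial>lborel)
         \<le> ennreal A' * L2_sq lborel f"
      if fm [measurable]: "f \<in> borel_measurable borel" and fi: "integrable lborel (\<lambda>\<xi>. of_real (v \<xi>) * f \<xi>)" for f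
    proof -
      define I where "I = wave q (\<lambda>\<xi>. of_real (v \<xi>) * f \<xi>)"
      have [measurable]: "I \<in> borel_measurable borel" unfolding I_def by measurable
      have [measurable]: "(\<lambda>z::real \<times> 'a. norm (snd z)) \<in> borel_measurable borel"
        by (intro borel_measurable_continuous_onI continuous_intros)
      have "(\<integral>\<^sup>+z. ennreal ((W (snd z) * cmod (I z / of_real c))\<^sup>2) \<partial>lborel) = (\<integral>\<^sup>+z. ennreal (1 / c\<^sup>2) * ennreal (norm (snd z) powr (- 2 * s) * (cmod (I z))\<^sup>2) \<partial>lborel)"
      proof (rule nn_integral_cong)
        fix z :: "real \<times> 'a"
        have "(W (snd z))\<^sup>2 = norm (snd z) powr (- 2 * s)" by (simp add: W_def power2_eq_square powr_add[symmetric])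
        then have "(W (snd z) * cmod (I z / of_real c))\<^sup>2 = (1 / c\<^sup>2) * (norm (snd z) powr (- 2 * s) * (cmod (I z))\<^sup>2)"
          by (simp add: power_mult_distrib norm_divide power_divide)
        then show "ennreal ((W (snd z) * cmod (I z / of_real c))\<^sup>2) = ennreal (1 / c\<^sup>2) * ennreal (norm (snd z) powr (- 2 * s) * (cmod (I z))\<^sup>2)"
          by (simp only: ennreal_mult'[symmetric] zero_le_divide_1_iff zero_le_power2)
      qed
      also have "\<dots> = ennreal (1 / c\<^sup>2) * (\<integral>\<^sup>+z. ennreal (norm (snd z) powr (- 2 * s) * (cmod (I z))\<^sup>2) \<partial>lborel)"
        by (rule nn_integral_cmult) measurable
      also have "\<dots> \<le> ennreal (1 / c\<^sup>2) * (ennreal A * L2_sq lborel f)"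
        using apriori[OF q fm] fi unfolding I_def v_def a by (intro mult_left_mono) auto
      also have "\<dots> = ennreal A' * L2_sq lborel f"
        using A c by (simp add: A'_def mult.assoc[symmetric] ennreal_mult[symmetric])
      finally show ?thesis unfolding I_def .
    qed
    define F where "F k z = of_real (W (snd z)) * V k z" for k z
    have Fm [measurable]: "F k \<in> borel_measurable borel" for k unfolding F_def by measurable
    have cauchy: "L2_sq lborel (\<lambda>z. F l z - F k z) \<le> ennreal A' * e k" if kl: "k \<le> l" for k l
    proof -
      have ie: "integrable lborel (\<lambda>\<xi>. exp (\<i> * of_real (z \<bullet> (q \<xi>, \<xi>))) * (of_real (v \<xi>) * G k \<xi>))" for z :: "real \<times> 'a" and k
        by (rule Bochner_Integration.integrable_bound[OF vG[of k]]) (auto simp: norm_mult)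
      have diff: "cmod (F l z - F k z) = W (snd z) * cmod (wave q (\<lambda>\<xi>. of_real (v \<xi>) * (G l \<xi> - G k \<xi>)) z / of_real c)" for z
      proof -
        have "V l z - V k z = wave q (\<lambda>\<xi>. of_real (v \<xi>) * (G l \<xi> - G k \<xi>)) z / of_real c"
          unfolding V_def wave_def right_diff_distrib Bochner_Integration.integral_diff[OF ie ie] diff_divide_distrib ..
        moreover have "F l z - F k z = of_real (W (snd z)) * (V l z - V k z)"
          by (simp add: F_def right_diff_distrib)
        ultimately show ?thesis by (simp add: norm_mult W_def del: times_divide_eq_right)
      qed
      have "L2_sq lborel (\<lambda>z. F l z - F k z) \<le> ennreal A' * L2_sq lborel (\<lambda>\<xi>. G l \<xi> - G k \<xi>)"
        unfolding diff
      proof (rule est)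
        show "integrable lborel (\<lambda>\<xi>. of_real (v \<xi>) * (G l \<xi> - G k \<xi>))"
          unfolding right_diff_distrib by (intro Bochner_Integration.integrable_diff vG)
      qed measurable
      also have "\<dots> \<le> ennreal A' * e k"
        unfolding e_def G_def using incT kl
        by (intro mult_left_mono nn_integral_mono) (auto simp: indicator_def incseq_def)
      finally show ?thesis .
    qed
    have Ae0: "(\<lambda>k. ennreal A' * e k) \<longlonglongrightarrow> 0"
      using ennreal_tendsto_cmult[OF _ e0, of "ennreal A'"] by simp
    obtain Fl where Flm: "Fl \<in> borel_measurable lborel" and Fl: "\<And>k. L2_sq lborel (\<lambda>z. Fl z - F k z) \<le> ennreal A' * e k"
      using L2_complete[of F lborel "\<lambda>k. ennreal A' * e k"] cauchy Ae0 Fm by auto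
    have [measurable]: "Fl \<in> borel_measurable borel" using Flm by simp
    \<comment> \<open>At the origin \<open>W\<close> is \<open>0\<close>, and the quotient is \<open>0\<close> as well.\<close>
    define u where "u t x = Fl (t, x) / of_real (W x)" for t x
    have Wu: "of_real (W x) * u t x = (if x = 0 then 0 else Fl (t, x))" for t x
      using W0[of x] by (auto simp: u_def W_def)
    have um: "u t \<in> borel_measurable borel" for t unfolding u_def by measurable
    have norm: "L2_sq lborel (\<lambda>z. case z of (t, x) \<Rightarrow> of_real (norm x powr (- s)) * u t x) \<le> ennreal ((C * L)\<^sup>2)"
    proof -
      have F0: "L2_sq lborel (F 0) \<le> ennreal A' * Q"
      proof -
        have "L2_sq lborel (F 0) \<le> ennreal A' * L2_sq lborel (G 0)"
        proof -
          have nF: "cmod (F 0 z) = W (snd z) * cmod (V 0 z)" for z by (simp add: F_def norm_mult W_def)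
          show ?thesis unfolding nF V_def by (rule est[OF Gm vG])
        qed
        also have "\<dots> \<le> ennreal A' * Q"
          unfolding Q_def G_def by (intro mult_left_mono nn_integral_mono) (auto simp: indicator_def)
        finally show ?thesis .
      qed
      have "L2_sq lborel (\<lambda>z. case z of (t, x) \<Rightarrow> of_real (norm x powr (- s)) * u t x) \<le> L2_sq lborel Fl"
        by (intro nn_integral_mono ennreal_leI power_mono) (auto simp only: W_def[symmetric] Wu split: prod.splits if_splits, auto)
      also have "\<dots> \<le> 2 * (ennreal A' * Q) + 2 * (ennreal A' * Q)"
        by (rule order.trans[OF L2_sum_le[of Fl lborel "F 0"]])
           (auto intro!: add_mono mult_left_mono F0 order.trans[OF Fl[of 0]] eQ)
      also have "\<dots> = ennreal (4 * A') * Q"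
        using A' by (simp add: ennreal_mult mult.assoc distrib_right[symmetric])
      also have "\<dots> \<le> ennreal (4 * A') * (ennreal (4 * c) * ennreal (L\<^sup>2))"
        using gle by (intro mult_left_mono) (auto simp: Q_def)
      also have "\<dots> = ennreal ((C * L)\<^sup>2)"
      proof -
        have CL: "(C * L)\<^sup>2 = (4 * A') * ((4 * c) * L\<^sup>2)"
          using A' c by (simp add: C_def power_mult_distrib)
        show ?thesis unfolding CL using A' c
          by (subst ennreal_mult, simp, simp, subst (2) ennreal_mult) (auto intro: less_imp_le)
      qed
      finally show ?thesis .
    qed
    have meas: "(\<lambda>(t, x). of_real (norm x powr (- s)) * u t x) \<in> borel_measurable (lborel :: (real \<times> 'a) measure)"
    proof -
      have "(\<lambda>(t, x). of_real (norm x powr (- s)) * u t x) = (\<lambda>z. of_real (W (snd z)) * (Fl z / of_real (W (snd z))))"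
        by (auto simp: u_def W_def)
      also have "\<dots> \<in> borel_measurable (lborel :: (real \<times> 'a) measure)" by measurable
      finally show ?thesis .
    qed
    have mult: "AE t in lborel. is_multiplier_image (\<lambda>\<xi>. of_real (v \<xi>) * exp (\<i> * of_real (t * q \<xi>))) \<phi> (u t)"
    proof -
      \<comment> \<open>Convergence in space-time gives, along one subsequence, convergence on almost every time slice.\<close>
      define D where "D k t = L2_sq lborel (\<lambda>x. Fl (t, x) - F k (t, x))" for k t
      have [measurable]: "D k \<in> borel_measurable borel" for k unfolding D_def by measurable
      have "(\<integral>\<^sup>+t. D k t \<partial>lborel) \<le> ennreal A' * e k" for k
      proof -
        have "(\<integral>\<^sup>+t. D k t \<partial>lborel) = (\<integral>\<^sup>+z. ennreal ((cmod (Fl z - F k z))\<^sup>2) \<partial>(lborel \<Otimes>\<^sub>M lborel))"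
          unfolding D_def by (rule lborel.nn_integral_fst) (unfold lborel_prod, measurable)
        then show ?thesis using Fl[of k] by (simp add: lborel_prod)
      qed
      then obtain r where r: "strict_mono r" "AE t in lborel. (\<forall>n. D (r n) t < \<infinity>) \<and> (\<lambda>n. D (r n) t) \<longlonglongrightarrow> 0"
        using nn_integral_tendsto_0_AE_subseq[of D lborel "\<lambda>k. ennreal A' * e k"] Ae0 by auto
      from r(2) show ?thesis
      proof eventually_elim
        case (elim t)
        define E where "E \<xi> = of_real (v \<xi>) * exp (\<i> * of_real (t * q \<xi>))" for \<xi>
        have [measurable]: "E \<in> borel_measurable borel" unfolding E_def by measurable
        have EG: "integrable lborel (\<lambda>\<xi>. E \<xi> * G k \<xi>)" for k
          by (rule Bochner_Integration.integrable_bound[OF vG[of k]]) (auto simp: norm_mult E_def)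
        have Vt: "V k (t, x) = (\<integral>\<xi>. exp (\<i> * of_real (x \<bullet> \<xi>)) * (E \<xi> * G k \<xi>) \<partial>lborel) / of_real c" for k x
          unfolding V_def wave_def
          by (intro arg_cong2[where f="(/)"] Bochner_Integration.integral_cong refl) (simp add: E_def distrib_left exp_add mult_ac)
        have Vtm [measurable]: "(\<lambda>x. V k (t, x)) \<in> borel_measurable borel" for k by measurable
        have EgL: "integrable lborel (\<lambda>\<xi>. E \<xi> * g \<xi> * \<psi> \<xi>)" if \<psi>: "schwartz \<psi>" for \<psi>
        proof -
          note [measurable] = schwartz_measurable[OF \<psi>]
          have "integrable lborel (\<lambda>\<xi>. g \<xi> * (E \<xi> * \<psi> \<xi>))"
          proof (rule L2_mult_integrable)
            have "- (real (card S) / 2) < a" using s m by (simp add: a)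
            from amplitude_schwartz_L2[OF S this \<psi>]
            show "L2_sq lborel (\<lambda>\<xi>. E \<xi> * \<psi> \<xi>) < \<infinity>"
              by (simp add: E_def norm_mult v_def)
          qed (use Q in \<open>auto simp: Q_def\<close>)
          then show ?thesis by (simp add: mult_ac)
        qed
        have pair: "integrable lborel (\<lambda>x. u t x * \<theta> x)" "(\<lambda>n. \<integral>x. V (r n) (t, x) * \<theta> x \<partial>lborel) \<longlonglongrightarrow> (\<integral>x. u t x * \<theta> x \<partial>lborel)"
          if \<theta>: "\<theta> \<in> borel_measurable borel" "integrable lborel \<theta>" "(\<integral>\<^sup>+x. ennreal ((norm x powr s * cmod (\<theta> x))\<^sup>2) \<partial>lborel) < \<infinity>" for \<theta>
        proof -
          note [measurable] = \<theta>(1) um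
          have W: "AE x in lborel. 0 < W x"
            using AE_norm_pos by eventually_elim (simp add: W_def)
          have "(\<integral>\<^sup>+x. ennreal ((cmod (\<theta> x) / W x)\<^sup>2) \<partial>lborel) = (\<integral>\<^sup>+x. ennreal ((norm x powr s * cmod (\<theta> x))\<^sup>2) \<partial>lborel)"
            by (intro nn_integral_cong) (simp add: W_def powr_minus divide_inverse mult.commute)
          then have w: "(\<integral>\<^sup>+x. ennreal ((cmod (\<theta> x) / W x)\<^sup>2) \<partial>lborel) < \<infinity>" using \<theta>(3) by simp
          have d: "(\<integral>\<^sup>+x. ennreal ((W x * cmod (V (r n) (t, x) - u t x))\<^sup>2) \<partial>lborel) \<le> D (r n) t" for n
            unfolding D_def
          proof (intro nn_integral_mono ennreal_leI power_mono)
            fix x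
            have "W x * cmod (V (r n) (t, x) - u t x) = cmod (of_real (W x) * (V (r n) (t, x) - u t x))"
              by (simp add: norm_mult W_def)
            also have "\<dots> \<le> cmod (Fl (t, x) - F (r n) (t, x))"
              unfolding right_diff_distrib Wu by (auto simp: F_def norm_minus_commute W_def)
            finally show "W x * cmod (V (r n) (t, x) - u t x) \<le> cmod (Fl (t, x) - F (r n) (t, x))" .
          qed (simp add: W_def)
          have int: "integrable lborel (\<lambda>x. V (r n) (t, x) * \<theta> x)" for n
          proof -
            \<comment> \<open>Each truncated wave is bounded by the integral of its Fourier data.\<close>
            define B where "B = (\<integral>\<xi>. cmod (E \<xi> * G (r n) \<xi>) \<partial>lborel) / c"
            have "cmod (V (r n) (t, x)) \<le> B" for x
            proof -
              have "cmod (\<integral>\<xi>. exp (\<i> * of_real (x \<bullet> \<xi>)) * (E \<xi> * G (r n) \<xi>) \<partial>lborel) \<le> (\<integral>\<xi>. cmod (exp (\<i> * of_real (x \<bullet> \<xi>)) * (E \<xi> * G (r n) \<xi>)) \<partial>lborel)"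
                by (rule integral_norm_bound)
              also have "\<dots> = (\<integral>\<xi>. cmod (E \<xi> * G (r n) \<xi>) \<partial>lborel)" by (simp add: norm_mult)
              finally show ?thesis unfolding Vt B_def using c by (simp add: norm_divide divide_right_mono)
            qed
            then have bnd: "AE x in lborel. norm (V (r n) (t, x) * \<theta> x) \<le> norm (of_real B * \<theta> x)"
              by (intro AE_I2) (auto simp: norm_mult intro!: mult_right_mono order.trans[OF _ abs_ge_self])
            have i: "integrable lborel (\<lambda>x. of_real B * \<theta> x)" using \<theta>(2) by simp
            have "(\<lambda>x. V (r n) (t, x) * \<theta> x) \<in> borel_measurable lborel" by measurable
            then show ?thesis by (rule Bochner_Integration.integrable_bound[OF i _ bnd])
          qed
          have D0: "D (r n) t < \<infinity>" "(\<lambda>n. D (r n) t) \<longlonglongrightarrow> 0" for n using elim by auto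
          have mb: "(\<lambda>x. V (r n) (t, x)) \<in> borel_measurable lborel" "u t \<in> borel_measurable lborel" "\<theta> \<in> borel_measurable lborel" "W \<in> borel_measurable lborel" for n
            by measurable
          show "integrable lborel (\<lambda>x. u t x * \<theta> x)"
            by (rule weighted_pairing_tendsto(1)[of "\<lambda>n x. V (r n) (t, x)", OF mb W w d D0 int])
          show "(\<lambda>n. \<integral>x. V (r n) (t, x) * \<theta> x \<partial>lborel) \<longlonglongrightarrow> (\<integral>x. u t x * \<theta> x \<partial>lborel)"
            by (rule weighted_pairing_tendsto(2)[of "\<lambda>n x. V (r n) (t, x)", OF mb W w d D0 int])
        qed
        have s0: "0 \<le> s" using s by simp
        have "has_fourier_transform (u t) (\<lambda>\<xi>. E \<xi> * g \<xi>)"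
          unfolding has_fourier_transform_def tempered_def
        proof (intro conjI allI impI)
          fix \<psi> :: "'a \<Rightarrow> complex" assume \<psi>: "schwartz \<psi>"
          show "integrable lborel (\<lambda>x. u t x * \<psi> x)"
            by (rule pair(1)[OF schwartz_measurable[OF \<psi>] schwartz_integrable[OF \<psi>] schwartz_weighted_L2(1)[OF \<psi> s0]])
          show "integrable lborel (\<lambda>\<xi>. E \<xi> * g \<xi> * \<psi> \<xi>)" by (rule EgL[OF \<psi>])
          note [measurable] = schwartz_measurable[OF \<psi>]
          have l1: "(\<lambda>n. \<integral>x. V (r n) (t, x) * fourier \<psi> x \<partial>lborel) \<longlonglongrightarrow> (\<integral>x. u t x * fourier \<psi> x \<partial>lborel)"
            by (rule pair(2)[OF schwartz_fourier_measurable[OF \<psi>] schwartz_fourier_integrable[OF \<psi>] schwartz_weighted_L2(2)[OF \<psi> s0]])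
          have "(\<integral>x. V k (t, x) * fourier \<psi> x \<partial>lborel) = (\<integral>\<xi>. E \<xi> * G k \<xi> * \<psi> \<xi> \<partial>lborel)" for k
          proof -
            have "(\<integral>x. V k (t, x) * fourier \<psi> x \<partial>lborel) = (\<integral>x. ((\<integral>\<xi>. exp (\<i> * of_real (x \<bullet> \<xi>)) * (E \<xi> * G k \<xi>) \<partial>lborel) * fourier \<psi> x) / of_real c \<partial>lborel)"
              unfolding Vt by simp
            also have "\<dots> = (of_real c * (\<integral>\<xi>. E \<xi> * G k \<xi> * \<psi> \<xi> \<partial>lborel)) / of_real c"
              unfolding integral_divide_zero inverse_fourier_pairing[OF EG \<psi>] c_def ..
            finally show ?thesis using c by simp
          qed
          moreover have "(\<lambda>n. \<integral>\<xi>. E \<xi> * G (r n) \<xi> * \<psi> \<xi> \<partial>lborel) \<longlonglongrightarrow> (\<integral>\<xi>. E \<xi> * g \<xi> * \<psi> \<xi> \<partial>lborel)"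
          proof (rule integral_dominated_convergence[where w="\<lambda>\<xi>. cmod (E \<xi> * g \<xi> * \<psi> \<xi>)"])
            show "AE \<xi> in lborel. (\<lambda>n. E \<xi> * G (r n) \<xi> * \<psi> \<xi>) \<longlonglongrightarrow> E \<xi> * g \<xi> * \<psi> \<xi>"
            proof (rule AE_I2)
              fix \<xi> :: 'a
              obtain k where "\<xi> \<in> T k" using UT by blast
              then have "\<xi> \<in> T (r n)" if "k \<le> n" for n
                using incT seq_suble[OF r(1), of n] that unfolding incseq_def by (meson order.trans subsetD)
              then have "eventually (\<lambda>n. E \<xi> * G (r n) \<xi> * \<psi> \<xi> = E \<xi> * g \<xi> * \<psi> \<xi>) sequentially"
                unfolding eventually_sequentially by (intro exI[of _ k]) (auto simp: G_def)
              then show "(\<lambda>n. E \<xi> * G (r n) \<xi> * \<psi> \<xi>) \<longlonglongrightarrow> E \<xi> * g \<xi> * \<psi> \<xi>" by (rule tendsto_eventually)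
            qed
            show "AE \<xi> in lborel. norm (E \<xi> * G (r n) \<xi> * \<psi> \<xi>) \<le> cmod (E \<xi> * g \<xi> * \<psi> \<xi>)" for n
              by (intro AE_I2) (auto simp: norm_mult G_def indicator_def)
            show "integrable lborel (\<lambda>\<xi>. cmod (E \<xi> * g \<xi> * \<psi> \<xi>))" by (rule integrable_norm[OF EgL[OF \<psi>]])
          qed measurable
          ultimately show "(\<integral>x. u t x * fourier \<psi> x \<partial>lborel) = (\<integral>\<xi>. E \<xi> * g \<xi> * \<psi> \<xi> \<partial>lborel)"
            using LIMSEQ_unique[OF l1] by simp
        qed (use um in measurable)
        then show ?case
          unfolding is_multiplier_image_def E_def using ft by blast
      qed
    qed
    show "\<exists>u. (AE t in lborel. is_multiplier_image (\<lambda>\<xi>. of_real (rsq S \<xi> powr (a / 2)) * exp (\<i> * of_real (t * q \<xi>))) \<phi> (u t)) \<and>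
         in_L2 lborel (\<lambda>(t, x). of_real (norm x powr (- s)) * u t x) \<and>
         L2_norm lborel (\<lambda>(t, x). of_real (norm x powr (- s)) * u t x) \<le> C * L2_norm lborel \<phi>"
      using mult in_L2I[OF meas norm] C0 L unfolding v_def L_def by (intro exI[of _ u]) auto
  qed
qed

lemma rsq_omit:
  fixes x :: "real ^ 'n::finite"
  shows "rsq (Basis - {axis k 1}) x = rsq Basis (omit k x)"
proof -
  have k: "axis k 1 \<in> (Basis :: (real ^ 'n) set)" by (simp add: axis_in_Basis_iff)
  have "rsq Basis (omit k x) = (omit k x \<bullet> axis k 1)\<^sup>2 + rsq (Basis - {axis k 1}) (omit k x)"
    unfolding rsq_def by (rule sum.remove[OF finite_Basis k])
  also have "omit k x \<bullet> axis k 1 = 0" by (simp add: omit_def inner_axis)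
  also have "rsq (Basis - {axis k 1}) (omit k x) = rsq (Basis - {axis k 1}) x"
    unfolding rsq_def
  proof (rule sum.cong[OF refl])
    fix b :: "real ^ 'n" assume "b \<in> Basis - {axis k 1}"
    then obtain j where "b = axis j 1" "j \<noteq> k" by (auto simp: Basis_vec_def)
    then show "(omit k x \<bullet> b)\<^sup>2 = (x \<bullet> b)\<^sup>2" by (simp add: omit_def inner_axis)
  qed
  finally show ?thesis by simp
qed

theorem corollary3p3:
  fixes m \<alpha> :: real and k :: "'n::finite"
  shows
   "(0 < m \<and> (m - real CARD('n)) / 2 < \<alpha> \<and> \<alpha> < (m - 1) / 2 \<longrightarrow>
      (\<exists>C::real. \<forall>\<phi> :: real ^ 'n \<Rightarrow> complex. in_L2 lborel \<phi> \<longrightarrow>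
        (\<exists>u :: real \<Rightarrow> real ^ 'n \<Rightarrow> complex.
           (AE t in lborel. is_multiplier_image
              (\<lambda>\<xi>. of_real (norm \<xi> powr \<alpha>) * exp (\<i> * of_real (t * norm \<xi> powr m)))
              \<phi> (u t)) \<and>
           in_L2 lborel (\<lambda>(t, x). of_real (norm x powr (\<alpha> - m / 2)) * u t x) \<and>
           L2_norm lborel (\<lambda>(t, x). of_real (norm x powr (\<alpha> - m / 2)) * u t x)
             \<le> C * L2_norm lborel \<phi>)))
    \<and>
    (0 < m \<and> (m - real CARD('n) + 1) / 2 < \<alpha> \<and> \<alpha> < (m - 1) / 2 \<longrightarrow>
      (\<exists>C::real. \<forall>\<phi> :: real ^ 'n \<Rightarrow> complex. in_L2 lborel \<phi> \<longrightarrow>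
        (\<exists>u :: real \<Rightarrow> real ^ 'n \<Rightarrow> complex.
           (AE t in lborel. is_multiplier_image
              (\<lambda>\<xi>. of_real (norm (omit k \<xi>) powr \<alpha>) *
                   exp (\<i> * of_real (t * (\<bar>\<xi> $ k\<bar> powr m - norm (omit k \<xi>) powr m))))
              \<phi> (u t)) \<and>
           in_L2 lborel (\<lambda>(t, x). of_real (norm x powr (\<alpha> - m / 2)) * u t x) \<and>
           L2_norm lborel (\<lambda>(t, x). of_real (norm x powr (\<alpha> - m / 2)) * u t x)
             \<le> C * L2_norm lborel \<phi>)))"
proof (intro conjI impI, goal_cases)
  case A: 1
  define s where "s = m / 2 - \<alpha>"
  have as: "\<alpha> = m / 2 - s" and sm: "\<alpha> - m / 2 = - s" by (simp_all add: s_def)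
  have s: "1 / 2 < s" "s < real (card (Basis :: (real ^ 'n) set)) / 2" and m: "0 < m"
    using A by (auto simp: s_def field_simps)
  have "radial_phase (Basis :: (real ^ 'n) set) m (\<lambda>\<xi>. 0 + 1 * rsq Basis \<xi> powr (m / 2))"
    unfolding radial_phase_def by (intro exI[of _ "\<lambda>_. 0"] exI[of _ 1]) simp
  then obtain C where C: "weighted_spacetime_bound (\<lambda>x::real ^ 'n. norm x powr (- s))
        (\<lambda>t \<xi>. of_real (rsq Basis \<xi> powr (\<alpha> / 2)) * exp (\<i> * of_real (t * rsq Basis \<xi> powr (m / 2)))) C"
    using smoothing_estimate[OF order.refl s m as] by auto
  show ?case
    unfolding sm norm_powr_rsq[of _ \<alpha>] norm_powr_rsq[of _ m]
    using C unfolding weighted_spacetime_bound_def by (rule exI[of _ C])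
next
  case A: 2
  define s where "s = m / 2 - \<alpha>"
  have as: "\<alpha> = m / 2 - s" and sm: "\<alpha> - m / 2 = - s" by (simp_all add: s_def)
  define S where "S = Basis - {axis k 1 :: real ^ 'n}"
  have k: "axis k 1 \<in> (Basis :: (real ^ 'n) set)" by (simp add: axis_in_Basis_iff)
  have S: "S \<subseteq> Basis" "real (card S) = real CARD('n) - 1" "Basis - S = {axis k 1}"
    using k by (auto simp: S_def card_Diff_singleton of_nat_diff)
  have s: "1 / 2 < s" "s < real (card S) / 2" and m: "0 < m"
    using A by (auto simp: s_def S field_simps)
  have om: "norm (omit k \<xi>) powr p = rsq S \<xi> powr (p / 2)" for \<xi> p
    unfolding S_def rsq_omit by (rule norm_powr_rsq)
  have "radial_phase S m (\<lambda>\<xi>. \<bar>\<xi> $ k\<bar> powr m + (- 1) * rsq S \<xi> powr (m / 2))"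
    unfolding radial_phase_def S(3)
    by (intro exI[of _ "\<lambda>\<xi>. \<bar>\<xi> $ k\<bar> powr m"] exI[of _ "- 1"]) (simp add: inner_axis)
  then obtain C where C: "weighted_spacetime_bound (\<lambda>x::real ^ 'n. norm x powr (- s))
        (\<lambda>t \<xi>. of_real (rsq S \<xi> powr (\<alpha> / 2)) * exp (\<i> * of_real (t * (\<bar>\<xi> $ k\<bar> powr m - rsq S \<xi> powr (m / 2))))) C"
    using smoothing_estimate[OF S(1) s m as] by auto
  show ?case
    unfolding sm om
    using C unfolding weighted_spacetime_bound_def by (rule exI[of _ C])
qed

end
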